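(* Let $E,F$ be left $A$-modules. A full quantization $q\colon\mathrm{Symb}^\bullet_d(E,F)\to\mathrm{Diff}_d(E,F)$ for $(E,F)$ has the total symbol map $\varsigma_q$ as inverse, realizing an ${}_A\mathrm{Hom}(F,F)$-linear isomorphism $$\mathrm{Diff}_d(E,F)\simeq\mathrm{Symb}^\bullet_d(E,F).$$ Consequently, a natural full quantization $q$ for $E$ realizes a natural isomorphism of functors from left $A$-modules to $\Bbbk$-modules $\mathrm{Diff}_d(E,-)\simeq\mathrm{Symb}^\bullet_d(E,-)$. Moreover, for every $\Delta\in\mathrm{Diff}_d(E,F)$ we have $$\Delta=\sum_{k\in\mathbb N}\Delta^{(k)}_q,\qquad\text{where }\Delta^{(k)}_q:=q^k([\Delta]^k_q).$$
   Context: **Setting.** $\Bbbk$ is a commutative unital ring, $A$ an associative unital $\Bbbk$-algebra, $\otimes=\otimes_\Bbbk$. $(\Omega^\bullet_d,\wedge,d)$ is an exterior algebra over $A$: a differential graded $\Bbbk$-algebra with $\Omega^0_d=A$, generated by $A$ and $dA$, $d$ satisfying the graded Leibniz rule. $\Omega^k_dE=\Omega^k_d\otimes_AE$. **Jets.** For a left $A$-module $E$, $J^1_dE=(A\otimes E)/\{\sum_ia_i\otimes e_i:\sum_ia_ie_i=0,\ \sum_ida_i\otimes_Ae_i=0\}$, with $a[b\otimes e]=[ab\otimes e]$, functorial in $E$; $j^1_{d,E}(e)=[1\otimes e]$. Put $J^0_dE=E$, $l^1=\mathrm{id}$, $j^0=\mathrm{id}$; for $n\ge2$, $l^n_{d,E}\colon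 J^n_dE\hookrightarrow J^1_dJ^{n-1}_dE$ is the inclusion of the left $A$-submodule of those $x$ such that $J^1_d(l^{n-1}_{d,E})(x)\in J^1_dJ^1_dJ^{n-2}_dE$ is annihilated by both maps $[a\otimes[c\otimes e]]\mapsto a\,dc\otimes_Ae\in\Omega^1_dJ^{n-2}_dE$ and $[a\otimes[c\otimes e]]\mapsto da\wedge dc\otimes_Ae\in\Omega^2_dJ^{n-2}_dE$. The prolongation $j^n_{d,E}\colon E\to J^n_dE$ is the $\Bbbk$-linear map with $l^n_{d,E}\circ j^n_{d,E}=j^1_{d,J^{n-1}_dE}\circ j^{n-1}_{d,E}$. **Differential operators and symbols.** $\mathrm{Diff}^n_d(E,F)$ is the set of $\Bbbk$-linear $\Delta\colon E\to F$ for which there is a left $A$-linear $\widetilde\Delta\colon J^n_dE\to F$ with $\widetilde\Delta\circ j^n_{d,E}=\Delta$; $\mathrm{Diff}^{n-1}_d(E,F)\subseteq\mathrm{Diff}^n_d(E,F)$, $\mathrm{Diff}^{-1}_d=0$, $\mathrm{Diff}_d(E,F)=\bigcup_n\mathrm{Diff}^n_d(E,F)$. $\mathrm{Symb}^n_d(E,F)=\mathrm{Diff}^n_d(E,F)/\mathrm{Diff}^{n-1}_d(E,F)$ with quotient map $\varsigma^n_{d,E,F}$; $\mathrm{Symb}^\bullet_d(E,F)=\bigoplus_n\mathrm{Symb}^n_d(E,F)$. All are left ${}_A\mathrm{Hom}(F,F)$-modules, and functorial in $F$, by postcomposition. **Quantizations.** An $n$-quantization for $(E,F)$ is an ${}_A\mathrm{Hom}(F,F)$-linear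 map $q^n\colon\mathrm{Symb}^n_d(E,F)\to\mathrm{Diff}^n_d(E,F)$ with $\varsigma^n_{d,E,F}\circ q^n=\mathrm{id}$. A full quantization for $(E,F)$ is $q=\sum_nq^n\colon\mathrm{Symb}^\bullet_d(E,F)\to\mathrm{Diff}_d(E,F)$ for a collection $\{q^n\}_{n\in\mathbb N}$ of $n$-quantizations. A natural $n$-quantization for $E$ is a natural transformation $q^n\colon\mathrm{Symb}^n_d(E,-)\to\mathrm{Diff}^n_d(E,-)$ of functors to $\Bbbk$-modules with $\varsigma^n_{d,E}\circ q^n=\mathrm{id}$; a natural full quantization is $q=\sum_nq^n$ for a collection of these. **Truncation and total symbol.** Given a full quantization $q$ and $\Delta\in\mathrm{Diff}^n_d(E,F)$, the $k$-truncations are $\Delta_{\le k}:=\Delta$ for $k\ge n$ and recursively $\Delta_{\le k}:=\Delta_{\le k+1}-q^{k+1}(\varsigma^{k+1}_{d,E,F}(\Delta_{\le k+1}))$ for $0\le k<n$; they do not depend on the choice of $n$, and $\Delta_{\le k}\in\mathrm{Diff}^k_d(E,F)$. Put $[\Delta]^k_q:=\varsigma^k_{d,E,F}(\Delta_{\le k})$. The total symbol map is $\varsigma_q\colon\mathrm{Diff}_d(E,F)\to\mathrm{Symb}^\bullet_d(E,F)$, $\varsigma_q(\Delta)=\sum_{k\in\mathbb N}[\Delta]^k_q$. *)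

theory Defs
  imports
    "HOL-Algebra.Module"
    "HOL-Algebra.AbelCoset"
    "HOL-Algebra.Generated_Rings"
    "HOL-Algebra.Free_Abelian_Groups"
begin

section \<open>Modules, algebras and exterior algebras\<close>

text \<open>
  The locale \<open>module\<close> of the library asks for a commutative ring of scalars. The record
  \<open>module\<close> is used for all modules below; its ring fields \<open>mult\<close> and \<open>one\<close> carry no
  information unless the record is an algebra, and are \<open>undefined\<close> in the constructions.
\<close>

locale left_module = R?: ring R + M?: abelian_group M
  for R :: "('r, 'x) ring_scheme" (structure) and M :: "('r, 'm, 'y) module_scheme" (structure) +
  assumes smult_closed: "\<lbrakk>a \<in> carrier R; x \<in> carrier M\<rbrakk> \<Longrightarrow> a \<odot>\<^bsub>M\<^esub> x \<in> carrier M"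
    and smult_l_distr: "\<lbrakk>a \<in> carrier R; b \<in> carrier R; x \<in> carrier M\<rbrakk>
      \<Longrightarrow> (a \<oplus>\<^bsub>R\<^esub> b) \<odot>\<^bsub>M\<^esub> x = a \<odot>\<^bsub>M\<^esub> x \<oplus>\<^bsub>M\<^esub> b \<odot>\<^bsub>M\<^esub> x"
    and smult_r_distr: "\<lbrakk>a \<in> carrier R; x \<in> carrier M; y \<in> carrier M\<rbrakk>
      \<Longrightarrow> a \<odot>\<^bsub>M\<^esub> (x \<oplus>\<^bsub>M\<^esub> y) = a \<odot>\<^bsub>M\<^esub> x \<oplus>\<^bsub>M\<^esub> a \<odot>\<^bsub>M\<^esub> y"
    and smult_assoc: "\<lbrakk>a \<in> carrier R; b \<in> carrier R; x \<in> carrier M\<rbrakk>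
      \<Longrightarrow> (a \<otimes>\<^bsub>R\<^esub> b) \<odot>\<^bsub>M\<^esub> x = a \<odot>\<^bsub>M\<^esub> (b \<odot>\<^bsub>M\<^esub> x)"
    and smult_one: "x \<in> carrier M \<Longrightarrow> \<one>\<^bsub>R\<^esub> \<odot>\<^bsub>M\<^esub> x = x"

definition linear_map ::
  "('r, 'x) ring_scheme \<Rightarrow> ('r, 'm, 'y) module_scheme \<Rightarrow> ('r, 'n, 'z) module_scheme
    \<Rightarrow> ('m \<Rightarrow> 'n) \<Rightarrow> bool" where
  "linear_map R M N f \<longleftrightarrow>
     f \<in> carrier M \<rightarrow> carrier N \<and>
     (\<forall>x\<in>carrier M. \<forall>y\<in>carrier M. f (x \<oplus>\<^bsub>M\<^esub> y) = f x \<oplus>\<^bsub>N\<^esub> f y) \<and>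
     (\<forall>a\<in>carrier R. \<forall>x\<in>carrier M. f (a \<odot>\<^bsub>M\<^esub> x) = a \<odot>\<^bsub>N\<^esub> f x)"

text \<open>Members of Hom sets are extensional, so that equality in them is equality of maps.\<close>

definition lin_hom ::
  "('r, 'x) ring_scheme \<Rightarrow> ('r, 'm, 'y) module_scheme \<Rightarrow> ('r, 'n, 'z) module_scheme
    \<Rightarrow> ('m \<Rightarrow> 'n) set" where
  "lin_hom R M N = {f \<in> extensional (carrier M). linear_map R M N f}"

definition linear_isomorphism ::
  "('r, 'x) ring_scheme \<Rightarrow> ('r, 'm, 'y) module_scheme \<Rightarrow> ('r, 'n, 'z) module_scheme
    \<Rightarrow> ('m \<Rightarrow> 'n) \<Rightarrow> ('n \<Rightarrow> 'm) \<Rightarrow> bool" where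
  "linear_isomorphism R M N f g \<longleftrightarrow>
     linear_map R M N f \<and> linear_map R N M g \<and>
     (\<forall>x\<in>carrier M. g (f x) = x) \<and> (\<forall>y\<in>carrier N. f (g y) = y)"

definition restrict_scalars ::
  "('s \<Rightarrow> 'r) \<Rightarrow> ('r, 'm, 'y) module_scheme \<Rightarrow> ('s, 'm) module" where
  "restrict_scalars \<phi> M =
     \<lparr>carrier = carrier M, monoid.mult = monoid.mult M, one = one M, ring.zero = ring.zero M, add = add M,
      smult = (\<lambda>s x. \<phi> s \<odot>\<^bsub>M\<^esub> x)\<rparr>"

definition quot_module :: "('r, 'm, 'y) module_scheme \<Rightarrow> 'm set \<Rightarrow> ('r, 'm set) module" where
  "quot_module M H =
     \<lparr>carrier = a_rcosets\<^bsub>M\<^esub> H, monoid.mult = undefined, one = undefined,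
      ring.zero = H, add = (\<lambda>X Y. X <+>\<^bsub>M\<^esub> Y),
      smult = (\<lambda>a X. H <+>\<^bsub>M\<^esub> ((\<lambda>x. a \<odot>\<^bsub>M\<^esub> x) ` X))\<rparr>"

text \<open>The map into the quotient of \<open>N\<close> by \<open>H\<close> that \<open>f\<close> induces on cosets.\<close>

definition quot_map :: "('r, 'n, 'y) module_scheme \<Rightarrow> 'n set \<Rightarrow> ('m \<Rightarrow> 'n) \<Rightarrow> 'm set \<Rightarrow> 'n set" where
  "quot_map N H f X = H <+>\<^bsub>N\<^esub> (f ` X)"

definition direct_sum :: "(nat \<Rightarrow> ('r, 'm, 'y) module_scheme) \<Rightarrow> ('r, nat \<Rightarrow> 'm) module" where
  "direct_sum M =
     \<lparr>carrier = {s. (\<forall>n. s n \<in> carrier (M n)) \<and> finite {n. s n \<noteq> \<zero>\<^bsub>M n\<^esub>}},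
      monoid.mult = undefined, one = undefined,
      ring.zero = (\<lambda>n. \<zero>\<^bsub>M n\<^esub>), add = (\<lambda>s t n. s n \<oplus>\<^bsub>M n\<^esub> t n),
      smult = (\<lambda>a s n. a \<odot>\<^bsub>M n\<^esub> s n)\<rparr>"

text \<open>The sum of a family all but finitely many members of which vanish.\<close>

definition supp_sum :: "('m, 'y) ring_scheme \<Rightarrow> (nat \<Rightarrow> 'm) \<Rightarrow> 'm" where
  "supp_sum M x = (\<Oplus>\<^bsub>M\<^esub>n\<in>{n. x n \<noteq> \<zero>\<^bsub>M\<^esub>}. x n)"

definition list_sum :: "('m, 'y) ring_scheme \<Rightarrow> 'm list \<Rightarrow> 'm" where
  "list_sum M xs = foldr (\<lambda>x y. x \<oplus>\<^bsub>M\<^esub> y) xs \<zero>\<^bsub>M\<^esub>"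

text \<open>
  The additive map \<open>M \<rightarrow> N\<close> sending the generator \<open>g t\<close> of \<open>M\<close> to \<open>h t\<close>, for all
  \<open>t \<in> I\<close>. It is meant for cases where the \<open>g t\<close> generate \<open>M\<close> as a monoid and the prescription
  is consistent.
\<close>

definition map_on_generators ::
  "'i set \<Rightarrow> ('m, 'y) ring_scheme \<Rightarrow> ('n, 'z) ring_scheme \<Rightarrow> ('i \<Rightarrow> 'm) \<Rightarrow> ('i \<Rightarrow> 'n) \<Rightarrow> 'm \<Rightarrow> 'n" where
  "map_on_generators I M N g h x =
     (THE y. \<exists>ts. set ts \<subseteq> I \<and> x = list_sum M (map g ts) \<and> y = list_sum N (map h ts))"

locale unital_algebra = module K A + ring A
  for K :: "('k, 'x) ring_scheme" (structure) and A :: "('k, 'a, 'y) module_scheme" (structure) +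
  assumes smult_mult_l: "\<lbrakk>c \<in> carrier K; x \<in> carrier A; y \<in> carrier A\<rbrakk>
      \<Longrightarrow> (c \<odot>\<^bsub>A\<^esub> x) \<otimes>\<^bsub>A\<^esub> y = c \<odot>\<^bsub>A\<^esub> (x \<otimes>\<^bsub>A\<^esub> y)"
    and smult_mult_r: "\<lbrakk>c \<in> carrier K; x \<in> carrier A; y \<in> carrier A\<rbrakk>
      \<Longrightarrow> x \<otimes>\<^bsub>A\<^esub> (c \<odot>\<^bsub>A\<^esub> y) = c \<odot>\<^bsub>A\<^esub> (x \<otimes>\<^bsub>A\<^esub> y)"

text \<open>The algebra fields of the record describe the total algebra of forms with its wedge product.\<close>

record ('k, 'a) calculus = "('k, 'a) module" +
  forms :: "nat \<Rightarrow> 'a set"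
  ext_d :: "'a \<Rightarrow> 'a"

definition form_module :: "('k, 'a) calculus \<Rightarrow> nat \<Rightarrow> ('k, 'a) calculus" where
  "form_module \<Omega> n = \<Omega>\<lparr>carrier := forms \<Omega> n\<rparr>"

text \<open>
  Since \<open>A\<close> contains the image of the scalars, the subring generated by \<open>A\<close> and \<open>dA\<close> is the
  subalgebra generated by them.
\<close>

locale exterior_algebra = A: unital_algebra K A + Om: unital_algebra K \<Omega>
  for K :: "'k ring" and A :: "('k, 'a) module" and \<Omega> :: "('k, 'a) calculus" +
  assumes forms_submodule: "submodule (forms \<Omega> n) K \<Omega>"
    and forms_direct_sum:
      "bij_betw (supp_sum \<Omega>) (carrier (direct_sum (form_module \<Omega>))) (carrier \<Omega>)"
    and wedge_closed: "\<lbrakk>x \<in> forms \<Omega> m; y \<in> forms \<Omega> n\<rbrakk> \<Longrightarrow> x \<otimes>\<^bsub>\<Omega>\<^esub> y \<in> forms \<Omega> (m + n)"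
    and carrier_A: "carrier A = forms \<Omega> 0"
    and one_A: "\<one>\<^bsub>A\<^esub> = \<one>\<^bsub>\<Omega>\<^esub>"
    and mult_A: "\<lbrakk>x \<in> carrier A; y \<in> carrier A\<rbrakk> \<Longrightarrow> x \<otimes>\<^bsub>A\<^esub> y = x \<otimes>\<^bsub>\<Omega>\<^esub> y"
    and add_A: "\<lbrakk>x \<in> carrier A; y \<in> carrier A\<rbrakk> \<Longrightarrow> x \<oplus>\<^bsub>A\<^esub> y = x \<oplus>\<^bsub>\<Omega>\<^esub> y"
    and smult_A: "\<lbrakk>c \<in> carrier K; x \<in> carrier A\<rbrakk> \<Longrightarrow> c \<odot>\<^bsub>A\<^esub> x = c \<odot>\<^bsub>\<Omega>\<^esub> x"
    and d_linear: "linear_map K \<Omega> \<Omega> (ext_d \<Omega>)"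
    and d_degree: "x \<in> forms \<Omega> n \<Longrightarrow> ext_d \<Omega> x \<in> forms \<Omega> (Suc n)"
    and d_d: "x \<in> carrier \<Omega> \<Longrightarrow> ext_d \<Omega> (ext_d \<Omega> x) = \<zero>\<^bsub>\<Omega>\<^esub>"
    and leibniz: "\<lbrakk>x \<in> forms \<Omega> n; y \<in> carrier \<Omega>\<rbrakk> \<Longrightarrow>
      ext_d \<Omega> (x \<otimes>\<^bsub>\<Omega>\<^esub> y) =
        ext_d \<Omega> x \<otimes>\<^bsub>\<Omega>\<^esub> y \<oplus>\<^bsub>\<Omega>\<^esub> (\<ominus>\<^bsub>\<Omega>\<^esub> \<one>\<^bsub>\<Omega>\<^esub>) [^]\<^bsub>\<Omega>\<^esub> n \<otimes>\<^bsub>\<Omega>\<^esub> (x \<otimes>\<^bsub>\<Omega>\<^esub> ext_d \<Omega> y)"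
    and generated: "generate_ring \<Omega> (carrier A \<union> ext_d \<Omega> ` carrier A) = carrier \<Omega>"


section \<open>Tensor products\<close>

text \<open>
  The free abelian group on \<open>S \<times> T\<close>, with left scalars acting on the first components through
  \<open>lact\<close>.
\<close>

definition free_pairs ::
  "('s \<Rightarrow> 'w \<Rightarrow> 'w) \<Rightarrow> 'w set \<Rightarrow> 'n set \<Rightarrow> ('s, ('w \<times> 'n) \<Rightarrow>\<^sub>0 int) module" where
  "free_pairs lact S T =
     \<lparr>carrier = carrier (free_Abelian_group (S \<times> T)), monoid.mult = undefined, one = undefined,
      ring.zero = 0, add = (+),
      smult = (\<lambda>s. frag_extend (\<lambda>(w, x). frag_of (lact s w, x)))\<rparr>"

definition tensor_relators ::
  "('w, 'y) ring_scheme \<Rightarrow> ('w \<Rightarrow> 'r \<Rightarrow> 'w) \<Rightarrow> ('r, 'x) ring_scheme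
    \<Rightarrow> ('r, 'n, 'z) module_scheme \<Rightarrow> (('w \<times> 'n) \<Rightarrow>\<^sub>0 int) set" where
  "tensor_relators W ract R N =
     {frag_of (w \<oplus>\<^bsub>W\<^esub> w', x) - frag_of (w, x) - frag_of (w', x) | w w' x.
        w \<in> carrier W \<and> w' \<in> carrier W \<and> x \<in> carrier N} \<union>
     {frag_of (w, x \<oplus>\<^bsub>N\<^esub> x') - frag_of (w, x) - frag_of (w, x') | w x x'.
        w \<in> carrier W \<and> x \<in> carrier N \<and> x' \<in> carrier N} \<union>
     {frag_of (ract w r, x) - frag_of (w, r \<odot>\<^bsub>N\<^esub> x) | w r x.
        w \<in> carrier W \<and> r \<in> carrier R \<and> x \<in> carrier N}"

definition tensor_null ::
  "('w, 'y) ring_scheme \<Rightarrow> ('w \<Rightarrow> 'r \<Rightarrow> 'w) \<Rightarrow> ('r, 'x) ring_scheme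
    \<Rightarrow> ('r, 'n, 'z) module_scheme \<Rightarrow> (('w \<times> 'n) \<Rightarrow>\<^sub>0 int) set" where
  "tensor_null W ract R N =
     generate (free_Abelian_group (carrier W \<times> carrier N)) (tensor_relators W ract R N)"

text \<open>
  The tensor product over \<open>R\<close> of \<open>W\<close>, a right \<open>R\<close>-module through \<open>ract\<close>, and the left \<open>R\<close>-module
  \<open>N\<close>; \<open>lact\<close> is a commuting left action on \<open>W\<close>.
\<close>

definition tensor ::
  "('s \<Rightarrow> 'w \<Rightarrow> 'w) \<Rightarrow> ('w, 'y) ring_scheme \<Rightarrow> ('w \<Rightarrow> 'r \<Rightarrow> 'w) \<Rightarrow> ('r, 'x) ring_scheme
    \<Rightarrow> ('r, 'n, 'z) module_scheme \<Rightarrow> ('s, (('w \<times> 'n) \<Rightarrow>\<^sub>0 int) set) module" where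
  "tensor lact W ract R N =
     quot_module (free_pairs lact (carrier W) (carrier N)) (tensor_null W ract R N)"

definition pure_tensor ::
  "('w, 'y) ring_scheme \<Rightarrow> ('w \<Rightarrow> 'r \<Rightarrow> 'w) \<Rightarrow> ('r, 'x) ring_scheme
    \<Rightarrow> ('r, 'n, 'z) module_scheme \<Rightarrow> 'w \<Rightarrow> 'n \<Rightarrow> (('w \<times> 'n) \<Rightarrow>\<^sub>0 int) set" where
  "pure_tensor W ract R N w x =
     tensor_null W ract R N #>\<^bsub>free_Abelian_group (carrier W \<times> carrier N)\<^esub> frag_of (w, x)"

text \<open>A left \<open>A\<close>-module as a \<open>K\<close>-module.\<close>

definition scalar_module ::
  "('k, 'a) module \<Rightarrow> ('a, 'm) module \<Rightarrow> ('k, 'm) module" where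
  "scalar_module A M = restrict_scalars (\<lambda>c. c \<odot>\<^bsub>A\<^esub> \<one>\<^bsub>A\<^esub>) M"

text \<open>\<open>A \<otimes>\<^sub>K M\<close> and \<open>\<Omega>\<^sup>k \<otimes>\<^sub>A M\<close>, both as left \<open>A\<close>-modules.\<close>

definition base_tensor ::
  "'k ring \<Rightarrow> ('k, 'a) module \<Rightarrow> ('a, 'm) module \<Rightarrow> ('a, (('a \<times> 'm) \<Rightarrow>\<^sub>0 int) set) module" where
  "base_tensor K A M = tensor (monoid.mult A) A (\<lambda>b c. c \<odot>\<^bsub>A\<^esub> b) K (scalar_module A M)"

definition base_pure ::
  "'k ring \<Rightarrow> ('k, 'a) module \<Rightarrow> ('a, 'm) module \<Rightarrow> 'a \<Rightarrow> 'm \<Rightarrow> (('a \<times> 'm) \<Rightarrow>\<^sub>0 int) set" where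
  "base_pure K A M = pure_tensor A (\<lambda>b c. c \<odot>\<^bsub>A\<^esub> b) K (scalar_module A M)"

definition form_tensor ::
  "('k, 'a) module \<Rightarrow> ('k, 'a) calculus \<Rightarrow> nat \<Rightarrow> ('a, 'm) module
    \<Rightarrow> ('a, (('a \<times> 'm) \<Rightarrow>\<^sub>0 int) set) module" where
  "form_tensor A \<Omega> k M = tensor (monoid.mult \<Omega>) (form_module \<Omega> k) (monoid.mult \<Omega>) A M"

definition form_pure ::
  "('k, 'a) module \<Rightarrow> ('k, 'a) calculus \<Rightarrow> nat \<Rightarrow> ('a, 'm) module
    \<Rightarrow> 'a \<Rightarrow> 'm \<Rightarrow> (('a \<times> 'm) \<Rightarrow>\<^sub>0 int) set" where
  "form_pure A \<Omega> k M = pure_tensor (form_module \<Omega> k) (monoid.mult \<Omega>) A M"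


section \<open>Jets\<close>

definition jet1_null ::
  "'k ring \<Rightarrow> ('k, 'a) module \<Rightarrow> ('k, 'a) calculus \<Rightarrow> ('a, 'm) module
    \<Rightarrow> (('a \<times> 'm) \<Rightarrow>\<^sub>0 int) set set" where
  "jet1_null K A \<Omega> M =
     {list_sum (base_tensor K A M) (map (\<lambda>(a, e). base_pure K A M a e) ts) | ts.
        set ts \<subseteq> carrier A \<times> carrier M \<and>
        list_sum M (map (\<lambda>(a, e). a \<odot>\<^bsub>M\<^esub> e) ts) = \<zero>\<^bsub>M\<^esub> \<and>
        list_sum (form_tensor A \<Omega> 1 M) (map (\<lambda>(a, e). form_pure A \<Omega> 1 M (ext_d \<Omega> a) e) ts)
          = \<zero>\<^bsub>form_tensor A \<Omega> 1 M\<^esub>}"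

definition jet1 ::
  "'k ring \<Rightarrow> ('k, 'a) module \<Rightarrow> ('k, 'a) calculus \<Rightarrow> ('a, 'm) module
    \<Rightarrow> ('a, (('a \<times> 'm) \<Rightarrow>\<^sub>0 int) set set) module" where
  "jet1 K A \<Omega> M = quot_module (base_tensor K A M) (jet1_null K A \<Omega> M)"

text \<open>The class \<open>[a \<otimes> e]\<close>.\<close>

definition jet1_class ::
  "'k ring \<Rightarrow> ('k, 'a) module \<Rightarrow> ('k, 'a) calculus \<Rightarrow> ('a, 'm) module
    \<Rightarrow> 'a \<Rightarrow> 'm \<Rightarrow> (('a \<times> 'm) \<Rightarrow>\<^sub>0 int) set set" where
  "jet1_class K A \<Omega> M a e = jet1_null K A \<Omega> M +>\<^bsub>base_tensor K A M\<^esub> base_pure K A M a e"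

definition jet1_prolong ::
  "'k ring \<Rightarrow> ('k, 'a) module \<Rightarrow> ('k, 'a) calculus \<Rightarrow> ('a, 'm) module
    \<Rightarrow> 'm \<Rightarrow> (('a \<times> 'm) \<Rightarrow>\<^sub>0 int) set set" where
  "jet1_prolong K A \<Omega> M e = jet1_class K A \<Omega> M \<one>\<^bsub>A\<^esub> e"

definition jet1_map ::
  "'k ring \<Rightarrow> ('k, 'a) module \<Rightarrow> ('k, 'a) calculus \<Rightarrow> ('a, 'm) module \<Rightarrow> ('a, 'n) module
    \<Rightarrow> ('m \<Rightarrow> 'n) \<Rightarrow> (('a \<times> 'm) \<Rightarrow>\<^sub>0 int) set set \<Rightarrow> (('a \<times> 'n) \<Rightarrow>\<^sub>0 int) set set" where
  "jet1_map K A \<Omega> M N f =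
     map_on_generators (carrier A \<times> carrier M) (jet1 K A \<Omega> M) (jet1 K A \<Omega> N)
       (\<lambda>(a, e). jet1_class K A \<Omega> M a e) (\<lambda>(a, e). jet1_class K A \<Omega> N a (f e))"

text \<open>The maps \<open>[a \<otimes> [c \<otimes> e]] \<mapsto> a dc \<otimes> e\<close> and \<open>[a \<otimes> [c \<otimes> e]] \<mapsto> da \<and> dc \<otimes> e\<close>.\<close>

definition obstruction1 ::
  "'k ring \<Rightarrow> ('k, 'a) module \<Rightarrow> ('k, 'a) calculus \<Rightarrow> ('a, 'm) module
    \<Rightarrow> (('a \<times> (('a \<times> 'm) \<Rightarrow>\<^sub>0 int) set set) \<Rightarrow>\<^sub>0 int) set set \<Rightarrow> (('a \<times> 'm) \<Rightarrow>\<^sub>0 int) set" where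
  "obstruction1 K A \<Omega> M =
     map_on_generators (carrier A \<times> carrier A \<times> carrier M)
       (jet1 K A \<Omega> (jet1 K A \<Omega> M)) (form_tensor A \<Omega> 1 M)
       (\<lambda>(a, c, e). jet1_class K A \<Omega> (jet1 K A \<Omega> M) a (jet1_class K A \<Omega> M c e))
       (\<lambda>(a, c, e). form_pure A \<Omega> 1 M (a \<otimes>\<^bsub>\<Omega>\<^esub> ext_d \<Omega> c) e)"

definition obstruction2 ::
  "'k ring \<Rightarrow> ('k, 'a) module \<Rightarrow> ('k, 'a) calculus \<Rightarrow> ('a, 'm) module
    \<Rightarrow> (('a \<times> (('a \<times> 'm) \<Rightarrow>\<^sub>0 int) set set) \<Rightarrow>\<^sub>0 int) set set \<Rightarrow> (('a \<times> 'm) \<Rightarrow>\<^sub>0 int) set" where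
  "obstruction2 K A \<Omega> M =
     map_on_generators (carrier A \<times> carrier A \<times> carrier M)
       (jet1 K A \<Omega> (jet1 K A \<Omega> M)) (form_tensor A \<Omega> 2 M)
       (\<lambda>(a, c, e). jet1_class K A \<Omega> (jet1 K A \<Omega> M) a (jet1_class K A \<Omega> M c e))
       (\<lambda>(a, c, e). form_pure A \<Omega> 2 M (ext_d \<Omega> a \<otimes>\<^bsub>\<Omega>\<^esub> ext_d \<Omega> c) e)"

text \<open>
  The type of elements of \<open>J\<^sup>1J\<^sup>n\<^sup>-\<^sup>1E\<close> grows with \<open>n\<close>, so the iterated jets of \<open>E\<close> are carried over to
  one datatype: a class in \<open>J\<^sup>1M\<close> is encoded by a chosen list of pairs \<open>(a\<^sub>i, e\<^sub>i)\<close> for which the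
  class is \<open>\<Sum>\<^sub>i [a\<^sub>i \<otimes> e\<^sub>i]\<close>, where the \<open>e\<^sub>i\<close> are themselves encoded elements of \<open>M\<close>.
\<close>

datatype ('a, 'e) jet_elem = Zeroth (zeroth: 'e) | Prolonged "('a \<times> ('a, 'e) jet_elem) list"

fun jet_decode ::
  "'k ring \<Rightarrow> ('k, 'a) module \<Rightarrow> ('k, 'a) calculus \<Rightarrow> ('a, ('a, 'e) jet_elem) module
    \<Rightarrow> ('a, 'e) jet_elem \<Rightarrow> (('a \<times> ('a, 'e) jet_elem) \<Rightarrow>\<^sub>0 int) set set" where
  "jet_decode K A \<Omega> M (Prolonged ts) =
     list_sum (jet1 K A \<Omega> M) (map (\<lambda>(a, e). jet1_class K A \<Omega> M a e) ts)"
| "jet_decode K A \<Omega> M (Zeroth e) = undefined"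

definition jet_encode ::
  "'k ring \<Rightarrow> ('k, 'a) module \<Rightarrow> ('k, 'a) calculus \<Rightarrow> ('a, ('a, 'e) jet_elem) module
    \<Rightarrow> (('a \<times> ('a, 'e) jet_elem) \<Rightarrow>\<^sub>0 int) set set \<Rightarrow> ('a, 'e) jet_elem" where
  "jet_encode K A \<Omega> M x =
     Prolonged (SOME ts. set ts \<subseteq> carrier A \<times> carrier M \<and> jet_decode K A \<Omega> M (Prolonged ts) = x)"

text \<open>Transport of structure along a bijection \<open>f\<close> with inverse \<open>g\<close>.\<close>

definition transport_module ::
  "('m \<Rightarrow> 'n) \<Rightarrow> ('n \<Rightarrow> 'm) \<Rightarrow> ('r, 'm) module \<Rightarrow> ('r, 'n) module" where
  "transport_module f g M =
     \<lparr>carrier = f ` carrier M, monoid.mult = undefined, one = undefined,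
      ring.zero = f \<zero>\<^bsub>M\<^esub>, add = (\<lambda>x y. f (g x \<oplus>\<^bsub>M\<^esub> g y)), smult = (\<lambda>a x. f (a \<odot>\<^bsub>M\<^esub> g x))\<rparr>"

text \<open>
  For \<open>n \<ge> 1\<close> the inclusion \<open>l\<^sup>n\<close> of \<open>J\<^sup>nE\<close> into \<open>J\<^sup>1J\<^sup>n\<^sup>-\<^sup>1E\<close> is \<open>jet_decode\<close> at
  \<open>J\<^sup>n\<^sup>-\<^sup>1E\<close>; for \<open>n = 1\<close> it is onto.
\<close>

fun jet ::
  "'k ring \<Rightarrow> ('k, 'a) module \<Rightarrow> ('k, 'a) calculus \<Rightarrow> ('a, 'e) module \<Rightarrow> nat
    \<Rightarrow> ('a, ('a, 'e) jet_elem) module" where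
  "jet K A \<Omega> E 0 = transport_module Zeroth zeroth E"
| "jet K A \<Omega> E (Suc 0) =
     transport_module (jet_encode K A \<Omega> (jet K A \<Omega> E 0)) (jet_decode K A \<Omega> (jet K A \<Omega> E 0))
       (jet1 K A \<Omega> (jet K A \<Omega> E 0))"
| "jet K A \<Omega> E (Suc (Suc n)) =
     (let M = jet K A \<Omega> E n; N = jet K A \<Omega> E (Suc n);
          prolongable = {x \<in> carrier (jet1 K A \<Omega> N).
            let y = jet1_map K A \<Omega> N (jet1 K A \<Omega> M) (jet_decode K A \<Omega> M) x
            in obstruction1 K A \<Omega> M y = \<zero>\<^bsub>form_tensor A \<Omega> 1 M\<^esub> \<and>
               obstruction2 K A \<Omega> M y = \<zero>\<^bsub>form_tensor A \<Omega> 2 M\<^esub>}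
      in transport_module (jet_encode K A \<Omega> N) (jet_decode K A \<Omega> N)
           ((jet1 K A \<Omega> N)\<lparr>carrier := prolongable\<rparr>))"

primrec jet_prolong ::
  "'k ring \<Rightarrow> ('k, 'a) module \<Rightarrow> ('k, 'a) calculus \<Rightarrow> ('a, 'e) module \<Rightarrow> nat
    \<Rightarrow> 'e \<Rightarrow> ('a, 'e) jet_elem" where
  "jet_prolong K A \<Omega> E 0 = Zeroth"
| "jet_prolong K A \<Omega> E (Suc n) =
     (\<lambda>e. jet_encode K A \<Omega> (jet K A \<Omega> E n)
        (jet1_prolong K A \<Omega> (jet K A \<Omega> E n) (jet_prolong K A \<Omega> E n e)))"


section \<open>Differential operators and symbols\<close>

definition diffops ::
  "'k ring \<Rightarrow> ('k, 'a) module \<Rightarrow> ('k, 'a) calculus \<Rightarrow> ('a, 'e) module \<Rightarrow> ('a, 'f) module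
    \<Rightarrow> nat \<Rightarrow> ('e \<Rightarrow> 'f) set" where
  "diffops K A \<Omega> E F n =
     {\<Delta> \<in> lin_hom K (scalar_module A E) (scalar_module A F).
        \<exists>\<Delta>'. linear_map A (jet K A \<Omega> E n) F \<Delta>' \<and>
             (\<forall>e\<in>carrier E. \<Delta>' (jet_prolong K A \<Omega> E n e) = \<Delta> e)}"

text \<open>Operators of order at most \<open>n - 1\<close>, including \<open>n = 0\<close>.\<close>

fun lower_diffops ::
  "'k ring \<Rightarrow> ('k, 'a) module \<Rightarrow> ('k, 'a) calculus \<Rightarrow> ('a, 'e) module \<Rightarrow> ('a, 'f) module
    \<Rightarrow> nat \<Rightarrow> ('e \<Rightarrow> 'f) set" where
  "lower_diffops K A \<Omega> E F 0 = {\<lambda>e\<in>carrier E. \<zero>\<^bsub>F\<^esub>}"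
| "lower_diffops K A \<Omega> E F (Suc n) = diffops K A \<Omega> E F n"

definition endo_ring :: "('k, 'a) module \<Rightarrow> ('a, 'f) module \<Rightarrow> ('f \<Rightarrow> 'f) ring" where
  "endo_ring A F =
     \<lparr>carrier = lin_hom A F F, monoid.mult = (\<lambda>g h. compose (carrier F) g h), one = (\<lambda>x\<in>carrier F. x),
      ring.zero = (\<lambda>x\<in>carrier F. \<zero>\<^bsub>F\<^esub>), add = (\<lambda>g h. \<lambda>x\<in>carrier F. g x \<oplus>\<^bsub>F\<^esub> h x)\<rparr>"

text \<open>A set of maps from \<open>E\<close> to \<open>F\<close>, as a module over the endomorphisms of \<open>F\<close>.\<close>

definition map_module ::
  "('a, 'e) module \<Rightarrow> ('a, 'f) module \<Rightarrow> ('e \<Rightarrow> 'f) set \<Rightarrow> ('f \<Rightarrow> 'f, 'e \<Rightarrow> 'f) module" where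
  "map_module E F S =
     \<lparr>carrier = S, monoid.mult = undefined, one = undefined,
      ring.zero = (\<lambda>e\<in>carrier E. \<zero>\<^bsub>F\<^esub>), add = (\<lambda>\<Delta> \<Delta>'. \<lambda>e\<in>carrier E. \<Delta> e \<oplus>\<^bsub>F\<^esub> \<Delta>' e),
      smult = (\<lambda>h \<Delta>. compose (carrier E) h \<Delta>)\<rparr>"

definition Diff_n ::
  "'k ring \<Rightarrow> ('k, 'a) module \<Rightarrow> ('k, 'a) calculus \<Rightarrow> ('a, 'e) module \<Rightarrow> ('a, 'f) module
    \<Rightarrow> nat \<Rightarrow> ('f \<Rightarrow> 'f, 'e \<Rightarrow> 'f) module" where
  "Diff_n K A \<Omega> E F n = map_module E F (diffops K A \<Omega> E F n)"

definition Diff ::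
  "'k ring \<Rightarrow> ('k, 'a) module \<Rightarrow> ('k, 'a) calculus \<Rightarrow> ('a, 'e) module \<Rightarrow> ('a, 'f) module
    \<Rightarrow> ('f \<Rightarrow> 'f, 'e \<Rightarrow> 'f) module" where
  "Diff K A \<Omega> E F = map_module E F (\<Union>n. diffops K A \<Omega> E F n)"

definition Symb_n ::
  "'k ring \<Rightarrow> ('k, 'a) module \<Rightarrow> ('k, 'a) calculus \<Rightarrow> ('a, 'e) module \<Rightarrow> ('a, 'f) module
    \<Rightarrow> nat \<Rightarrow> ('f \<Rightarrow> 'f, ('e \<Rightarrow> 'f) set) module" where
  "Symb_n K A \<Omega> E F n = quot_module (Diff_n K A \<Omega> E F n) (lower_diffops K A \<Omega> E F n)"

definition symbol ::
  "'k ring \<Rightarrow> ('k, 'a) module \<Rightarrow> ('k, 'a) calculus \<Rightarrow> ('a, 'e) module \<Rightarrow> ('a, 'f) module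
    \<Rightarrow> nat \<Rightarrow> ('e \<Rightarrow> 'f) \<Rightarrow> ('e \<Rightarrow> 'f) set" where
  "symbol K A \<Omega> E F n \<Delta> = lower_diffops K A \<Omega> E F n +>\<^bsub>Diff_n K A \<Omega> E F n\<^esub> \<Delta>"

definition Symb ::
  "'k ring \<Rightarrow> ('k, 'a) module \<Rightarrow> ('k, 'a) calculus \<Rightarrow> ('a, 'e) module \<Rightarrow> ('a, 'f) module
    \<Rightarrow> ('f \<Rightarrow> 'f, nat \<Rightarrow> ('e \<Rightarrow> 'f) set) module" where
  "Symb K A \<Omega> E F = direct_sum (\<lambda>n. Symb_n K A \<Omega> E F n)"


section \<open>Functoriality in the target\<close>

text \<open>
  The arrow parts \<open>Diff_map\<close> (which serves every order) and \<open>Symb_n_map\<close> are both induced by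
  postcomposition. The scalars \<open>K\<close> act on modules over \<open>endo_ring A F\<close> through the homotheties of \<open>F\<close>, which are
  \<open>A\<close>-linear because the image of \<open>K\<close> in \<open>A\<close> is central.
\<close>

definition homothety :: "('k, 'a) module \<Rightarrow> ('a, 'f) module \<Rightarrow> 'k \<Rightarrow> 'f \<Rightarrow> 'f" where
  "homothety A F c = (\<lambda>x\<in>carrier F. (c \<odot>\<^bsub>A\<^esub> \<one>\<^bsub>A\<^esub>) \<odot>\<^bsub>F\<^esub> x)"

definition Diff_map ::
  "('a, 'e) module \<Rightarrow> ('a, 'f) module \<Rightarrow> ('a, 'f) module \<Rightarrow> ('f \<Rightarrow> 'f) \<Rightarrow> ('e \<Rightarrow> 'f) \<Rightarrow> 'e \<Rightarrow> 'f" where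
  "Diff_map E F G f \<Delta> = compose (carrier E) f \<Delta>"

definition Symb_n_map ::
  "'k ring \<Rightarrow> ('k, 'a) module \<Rightarrow> ('k, 'a) calculus \<Rightarrow> ('a, 'e) module \<Rightarrow> nat
    \<Rightarrow> ('a, 'f) module \<Rightarrow> ('a, 'f) module \<Rightarrow> ('f \<Rightarrow> 'f) \<Rightarrow> ('e \<Rightarrow> 'f) set \<Rightarrow> ('e \<Rightarrow> 'f) set" where
  "Symb_n_map K A \<Omega> E n F G f =
     quot_map (Diff_n K A \<Omega> E G n) (lower_diffops K A \<Omega> E G n) (\<lambda>\<Delta>. compose (carrier E) f \<Delta>)"

definition Symb_map ::
  "'k ring \<Rightarrow> ('k, 'a) module \<Rightarrow> ('k, 'a) calculus \<Rightarrow> ('a, 'e) module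
    \<Rightarrow> ('a, 'f) module \<Rightarrow> ('a, 'f) module \<Rightarrow> ('f \<Rightarrow> 'f)
    \<Rightarrow> (nat \<Rightarrow> ('e \<Rightarrow> 'f) set) \<Rightarrow> nat \<Rightarrow> ('e \<Rightarrow> 'f) set" where
  "Symb_map K A \<Omega> E F G f s = (\<lambda>n. Symb_n_map K A \<Omega> E n F G f (s n))"

text \<open>
  A functor from left \<open>A\<close>-modules to \<open>K\<close>-modules is given by an object part and an arrow part; the
  latter takes source, target and the map. The left \<open>A\<close>-modules are those with elements in the
  (arbitrary) type \<open>'f\<close>.
\<close>

definition natural_transformation ::
  "'k ring \<Rightarrow> ('k, 'a) module
    \<Rightarrow> (('a, 'f) module \<Rightarrow> ('k, 'm) module)
    \<Rightarrow> (('a, 'f) module \<Rightarrow> ('a, 'f) module \<Rightarrow> ('f \<Rightarrow> 'f) \<Rightarrow> 'm \<Rightarrow> 'm)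
    \<Rightarrow> (('a, 'f) module \<Rightarrow> ('k, 'n) module)
    \<Rightarrow> (('a, 'f) module \<Rightarrow> ('a, 'f) module \<Rightarrow> ('f \<Rightarrow> 'f) \<Rightarrow> 'n \<Rightarrow> 'n)
    \<Rightarrow> (('a, 'f) module \<Rightarrow> 'm \<Rightarrow> 'n) \<Rightarrow> bool" where
  "natural_transformation K A S S_map T T_map \<eta> \<longleftrightarrow>
     (\<forall>F. left_module A F \<longrightarrow> linear_map K (S F) (T F) (\<eta> F)) \<and>
     (\<forall>F G f. left_module A F \<longrightarrow> left_module A G \<longrightarrow> f \<in> lin_hom A F G \<longrightarrow>
        (\<forall>x\<in>carrier (S F). \<eta> G (S_map F G f x) = T_map F G f (\<eta> F x)))"

definition natural_isomorphism ::
  "'k ring \<Rightarrow> ('k, 'a) module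
    \<Rightarrow> (('a, 'f) module \<Rightarrow> ('k, 'm) module)
    \<Rightarrow> (('a, 'f) module \<Rightarrow> ('a, 'f) module \<Rightarrow> ('f \<Rightarrow> 'f) \<Rightarrow> 'm \<Rightarrow> 'm)
    \<Rightarrow> (('a, 'f) module \<Rightarrow> ('k, 'n) module)
    \<Rightarrow> (('a, 'f) module \<Rightarrow> ('a, 'f) module \<Rightarrow> ('f \<Rightarrow> 'f) \<Rightarrow> 'n \<Rightarrow> 'n)
    \<Rightarrow> (('a, 'f) module \<Rightarrow> 'm \<Rightarrow> 'n) \<Rightarrow> (('a, 'f) module \<Rightarrow> 'n \<Rightarrow> 'm) \<Rightarrow> bool" where
  "natural_isomorphism K A S S_map T T_map \<eta> \<theta> \<longleftrightarrow>
     natural_transformation K A S S_map T T_map \<eta> \<and>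
     natural_transformation K A T T_map S S_map \<theta> \<and>
     (\<forall>F. left_module A F \<longrightarrow> linear_isomorphism K (S F) (T F) (\<eta> F) (\<theta> F))"


section \<open>Quantizations\<close>

definition n_quantization ::
  "'k ring \<Rightarrow> ('k, 'a) module \<Rightarrow> ('k, 'a) calculus \<Rightarrow> ('a, 'e) module \<Rightarrow> ('a, 'f) module
    \<Rightarrow> nat \<Rightarrow> (('e \<Rightarrow> 'f) set \<Rightarrow> 'e \<Rightarrow> 'f) \<Rightarrow> bool" where
  "n_quantization K A \<Omega> E F n q \<longleftrightarrow>
     linear_map (endo_ring A F) (Symb_n K A \<Omega> E F n) (Diff_n K A \<Omega> E F n) q \<and>
     (\<forall>s\<in>carrier (Symb_n K A \<Omega> E F n). symbol K A \<Omega> E F n (q s) = s)"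

text \<open>A full quantization is represented by its collection of \<open>n\<close>-quantizations.\<close>

definition full_quantization ::
  "'k ring \<Rightarrow> ('k, 'a) module \<Rightarrow> ('k, 'a) calculus \<Rightarrow> ('a, 'e) module \<Rightarrow> ('a, 'f) module
    \<Rightarrow> (nat \<Rightarrow> ('e \<Rightarrow> 'f) set \<Rightarrow> 'e \<Rightarrow> 'f) \<Rightarrow> bool" where
  "full_quantization K A \<Omega> E F q \<longleftrightarrow> (\<forall>n. n_quantization K A \<Omega> E F n (q n))"

definition quantization_map ::
  "'k ring \<Rightarrow> ('k, 'a) module \<Rightarrow> ('k, 'a) calculus \<Rightarrow> ('a, 'e) module \<Rightarrow> ('a, 'f) module
    \<Rightarrow> (nat \<Rightarrow> ('e \<Rightarrow> 'f) set \<Rightarrow> 'e \<Rightarrow> 'f) \<Rightarrow> (nat \<Rightarrow> ('e \<Rightarrow> 'f) set) \<Rightarrow> 'e \<Rightarrow> 'f" where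
  "quantization_map K A \<Omega> E F q s = supp_sum (Diff K A \<Omega> E F) (\<lambda>n. q n (s n))"

definition natural_n_quantization ::
  "'k ring \<Rightarrow> ('k, 'a) module \<Rightarrow> ('k, 'a) calculus \<Rightarrow> ('a, 'e) module \<Rightarrow> nat
    \<Rightarrow> (('a, 'f) module \<Rightarrow> ('e \<Rightarrow> 'f) set \<Rightarrow> 'e \<Rightarrow> 'f) \<Rightarrow> bool" where
  "natural_n_quantization K A \<Omega> E n q \<longleftrightarrow>
     natural_transformation K A
       (\<lambda>F. restrict_scalars (homothety A F) (Symb_n K A \<Omega> E F n)) (Symb_n_map K A \<Omega> E n)
       (\<lambda>F. restrict_scalars (homothety A F) (Diff_n K A \<Omega> E F n)) (Diff_map E) q \<and>
     (\<forall>F. left_module A F \<longrightarrow>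
        (\<forall>s\<in>carrier (Symb_n K A \<Omega> E F n). symbol K A \<Omega> E F n (q F s) = s))"

definition natural_full_quantization ::
  "'k ring \<Rightarrow> ('k, 'a) module \<Rightarrow> ('k, 'a) calculus \<Rightarrow> ('a, 'e) module
    \<Rightarrow> (nat \<Rightarrow> ('a, 'f) module \<Rightarrow> ('e \<Rightarrow> 'f) set \<Rightarrow> 'e \<Rightarrow> 'f) \<Rightarrow> bool" where
  "natural_full_quantization K A \<Omega> E q \<longleftrightarrow> (\<forall>n. natural_n_quantization K A \<Omega> E n (q n))"


section \<open>Truncations and the total symbol\<close>

text \<open>The \<open>k\<close>-truncation of \<open>\<Delta>\<close> computed from the bound \<open>n\<close> on the order of \<open>\<Delta>\<close>.\<close>

function truncation_from ::
  "'k ring \<Rightarrow> ('k, 'a) module \<Rightarrow> ('k, 'a) calculus \<Rightarrow> ('a, 'e) module \<Rightarrow> ('a, 'f) module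
    \<Rightarrow> (nat \<Rightarrow> ('e \<Rightarrow> 'f) set \<Rightarrow> 'e \<Rightarrow> 'f) \<Rightarrow> nat \<Rightarrow> ('e \<Rightarrow> 'f) \<Rightarrow> nat \<Rightarrow> 'e \<Rightarrow> 'f" where
  "truncation_from K A \<Omega> E F q n \<Delta> k =
     (if n \<le> k then \<Delta>
      else let \<Delta>' = truncation_from K A \<Omega> E F q n \<Delta> (Suc k)
           in \<Delta>' \<ominus>\<^bsub>Diff K A \<Omega> E F\<^esub> q (Suc k) (symbol K A \<Omega> E F (Suc k) \<Delta>'))"
  by pat_completeness auto
termination
  by (relation "measure (\<lambda>(K, A, \<Omega>, E, F, q, n, \<Delta>, k). n - k)") auto

declare truncation_from.simps [simp del]

text \<open>The truncations do not depend on the bound; the least one is taken.\<close>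

definition truncation ::
  "'k ring \<Rightarrow> ('k, 'a) module \<Rightarrow> ('k, 'a) calculus \<Rightarrow> ('a, 'e) module \<Rightarrow> ('a, 'f) module
    \<Rightarrow> (nat \<Rightarrow> ('e \<Rightarrow> 'f) set \<Rightarrow> 'e \<Rightarrow> 'f) \<Rightarrow> ('e \<Rightarrow> 'f) \<Rightarrow> nat \<Rightarrow> 'e \<Rightarrow> 'f" where
  "truncation K A \<Omega> E F q \<Delta> k =
     truncation_from K A \<Omega> E F q (LEAST n. \<Delta> \<in> diffops K A \<Omega> E F n) \<Delta> k"

text \<open>The family of the symbols \<open>[\<Delta>]\<^sup>k\<^sub>q\<close>, as an element of the direct sum of the symbol modules.\<close>

definition total_symbol ::
  "'k ring \<Rightarrow> ('k, 'a) module \<Rightarrow> ('k, 'a) calculus \<Rightarrow> ('a, 'e) module \<Rightarrow> ('a, 'f) module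
    \<Rightarrow> (nat \<Rightarrow> ('e \<Rightarrow> 'f) set \<Rightarrow> 'e \<Rightarrow> 'f) \<Rightarrow> ('e \<Rightarrow> 'f) \<Rightarrow> nat \<Rightarrow> ('e \<Rightarrow> 'f) set" where
  "total_symbol K A \<Omega> E F q \<Delta> k = symbol K A \<Omega> E F k (truncation K A \<Omega> E F q \<Delta> k)"

text \<open>The component \<open>\<Delta>\<^sup>(\<^sup>k\<^sup>)\<^sub>q\<close>.\<close>

definition quantized_component ::
  "'k ring \<Rightarrow> ('k, 'a) module \<Rightarrow> ('k, 'a) calculus \<Rightarrow> ('a, 'e) module \<Rightarrow> ('a, 'f) module
    \<Rightarrow> (nat \<Rightarrow> ('e \<Rightarrow> 'f) set \<Rightarrow> 'e \<Rightarrow> 'f) \<Rightarrow> ('e \<Rightarrow> 'f) \<Rightarrow> nat \<Rightarrow> 'e \<Rightarrow> 'f" where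
  "quantized_component K A \<Omega> E F q \<Delta> k = q k (total_symbol K A \<Omega> E F q \<Delta> k)"

end

theory Submission
  imports Defs
begin

text \<open>
  By definition, \<open>J\<^sup>1M\<close> is the image of \<open>A \<otimes> M\<close> in \<open>M \<times> (\<Omega>\<^sup>1 \<otimes> M)\<close> under \<open>a \<otimes> x \<mapsto> (ax, da \<otimes> x)\<close>.
  Both components extend to \<open>J\<^sup>1M\<close> (as \<open>jet1_eval\<close> and \<open>jet1_d\<close>) and jointly determine its elements,
  so every map out of iterated jets, in particular the two obstruction maps, can be assembled from
  them. The iterated jets are therefore left \<open>A\<close>-modules, and evaluation gives linear projections
  \<open>J\<^sup>n\<^sup>+\<^sup>1E \<rightarrow> J\<^sup>nE\<close> compatible with the prolongations: an operator of order \<open>n\<close> also has order \<open>n + 1\<close>.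

  For a full quantization, subtracting \<open>q\<^sup>k[\<Delta>]\<^sup>k\<close> from the \<open>k\<close>-truncation of \<open>\<Delta>\<close> lowers its order, and
  the truncations telescope to \<open>\<Delta> = \<Sum>\<^sub>k q\<^sup>k[\<Delta>]\<^sup>k\<close>. Conversely \<open>q\<close> is injective: if
  \<open>\<Sum>\<^sub>k\<^sub>\<le>\<^sub>N q\<^sup>k(s\<^sub>k) = 0\<close>, then \<open>q\<^sup>N(s\<^sub>N)\<close> has order less than \<open>N\<close>, so its symbol \<open>s\<^sub>N\<close> vanishes. Hence the
  total symbol is a two-sided inverse, and linearity and naturality pass from \<open>q\<close> to it.
\<close>

section \<open>Additive maps, generators and quotients\<close>

text \<open>Most maps on jets are given by definite descriptions on generators, so nothing can be
  derived about one of them until an additive map with the prescribed values is exhibited; much of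
  the first half produces such witnesses. Additivity is the basic notion, rather than linearity,
  because \<open>d_tensor\<close> and the second obstruction obey a Leibniz rule instead of being
  \<open>A\<close>-linear, and because additive maps can be compared on generators without any
  scalars. The failure of linearity is harmless for one reason, used twice: the correction term is
  built from a companion map (\<open>eval_tensor\<close>, respectively the first obstruction), so it
  vanishes on the common kernel, which is therefore a submodule. What the second half needs from the
  jets is only \<open>diffops_Suc\<close>: it makes the operators of lower order a subgroup of those
  of order \<open>n\<close>, so that symbols form a quotient. In the natural version a quantization
  is assumed linear over \<open>K\<close> only; naturality under endomorphisms of \<open>F\<close>
  supplies the remaining linearity.\<close>

definition additive_map :: "('m, 'y) ring_scheme \<Rightarrow> ('n, 'z) ring_scheme \<Rightarrow> ('m \<Rightarrow> 'n) \<Rightarrow> bool" where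
  "additive_map M N f \<longleftrightarrow>
     f \<in> carrier M \<rightarrow> carrier N \<and>
     (\<forall>x\<in>carrier M. \<forall>y\<in>carrier M. f (x \<oplus>\<^bsub>M\<^esub> y) = f x \<oplus>\<^bsub>N\<^esub> f y)"

lemma additive_mapI:
  "\<lbrakk>\<And>x. x \<in> carrier M \<Longrightarrow> f x \<in> carrier N;
    \<And>x y. \<lbrakk>x \<in> carrier M; y \<in> carrier M\<rbrakk> \<Longrightarrow> f (x \<oplus>\<^bsub>M\<^esub> y) = f x \<oplus>\<^bsub>N\<^esub> f y\<rbrakk> \<Longrightarrow> additive_map M N f"
  by (auto simp: additive_map_def)

lemma additive_map_closed: "\<lbrakk>additive_map M N f; x \<in> carrier M\<rbrakk> \<Longrightarrow> f x \<in> carrier N"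
  by (auto simp: additive_map_def)

lemma additive_map_add:
  "\<lbrakk>additive_map M N f; x \<in> carrier M; y \<in> carrier M\<rbrakk> \<Longrightarrow> f (x \<oplus>\<^bsub>M\<^esub> y) = f x \<oplus>\<^bsub>N\<^esub> f y"
  by (auto simp: additive_map_def)

lemma linear_map_additive: "linear_map R M N f \<Longrightarrow> additive_map M N f"
  by (auto simp: additive_map_def linear_map_def)

lemma linear_mapI:
  "\<lbrakk>additive_map M N f;
    \<And>a x. \<lbrakk>a \<in> carrier R; x \<in> carrier M\<rbrakk> \<Longrightarrow> f (a \<odot>\<^bsub>M\<^esub> x) = a \<odot>\<^bsub>N\<^esub> f x\<rbrakk> \<Longrightarrow> linear_map R M N f"
  by (auto simp: additive_map_def linear_map_def)

lemma linear_map_smult: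
  "\<lbrakk>linear_map R M N f; a \<in> carrier R; x \<in> carrier M\<rbrakk> \<Longrightarrow> f (a \<odot>\<^bsub>M\<^esub> x) = a \<odot>\<^bsub>N\<^esub> f x"
  by (auto simp: linear_map_def)

lemma linear_map_closed: "\<lbrakk>linear_map R M N f; x \<in> carrier M\<rbrakk> \<Longrightarrow> f x \<in> carrier N"
  by (auto simp: linear_map_def)

lemma linear_map_comp: "\<lbrakk>linear_map R M N f; linear_map R N P g\<rbrakk> \<Longrightarrow> linear_map R M P (\<lambda>x. g (f x))"
  by (fastforce simp: linear_map_def Pi_iff)

lemma additive_map_id: "additive_map M M (\<lambda>x. x)"
  by (auto simp: additive_map_def)

lemma additive_map_comp:
  "\<lbrakk>additive_map M N f; additive_map N P g\<rbrakk> \<Longrightarrow> additive_map M P (\<lambda>x. g (f x))"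
  by (fastforce simp: additive_map_def Pi_iff)

lemma additive_map_zero:
  assumes "additive_map M N f" "abelian_group M" "abelian_group N"
  shows "f \<zero>\<^bsub>M\<^esub> = \<zero>\<^bsub>N\<^esub>"
proof -
  interpret M: abelian_group M by fact
  interpret N: abelian_group N by fact
  have "f \<zero>\<^bsub>M\<^esub> \<oplus>\<^bsub>N\<^esub> f \<zero>\<^bsub>M\<^esub> = f \<zero>\<^bsub>M\<^esub>"
    using additive_map_add[OF assms(1), of "\<zero>\<^bsub>M\<^esub>" "\<zero>\<^bsub>M\<^esub>"] by simp
  then show ?thesis
    using additive_map_closed[OF assms(1), of "\<zero>\<^bsub>M\<^esub>"] by simp
qed

lemma additive_map_uminus:
  assumes "additive_map M N f" "abelian_group M" "abelian_group N" "x \<in> carrier M"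
  shows "f (\<ominus>\<^bsub>M\<^esub> x) = \<ominus>\<^bsub>N\<^esub> f x"
proof -
  interpret M: abelian_group M by fact
  interpret N: abelian_group N by fact
  have "f (\<ominus>\<^bsub>M\<^esub> x) \<oplus>\<^bsub>N\<^esub> f x = \<zero>\<^bsub>N\<^esub>"
    using additive_map_add[OF assms(1), of "\<ominus>\<^bsub>M\<^esub> x" x] additive_map_zero[OF assms(1-3)] assms(4)
    by (simp add: M.l_neg)
  then show ?thesis
    using additive_map_closed[OF assms(1)] assms(4) N.minus_equality by auto
qed

lemma additive_map_minus:
  assumes "additive_map M N f" "abelian_group M" "abelian_group N" "x \<in> carrier M" "y \<in> carrier M"
  shows "f (x \<ominus>\<^bsub>M\<^esub> y) = f x \<ominus>\<^bsub>N\<^esub> f y"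
  using additive_map_add[OF assms(1)] additive_map_uminus[OF assms(1-3)] assms(2,4,5)
  by (simp add: a_minus_def abelian_group.a_inv_closed)

lemma additive_map_sum:
  assumes "additive_map M N f" "additive_map M N g" "abelian_group N"
  shows "additive_map M N (\<lambda>x. f x \<oplus>\<^bsub>N\<^esub> g x)"
proof -
  interpret N: abelian_group N by fact
  show ?thesis
    using assms(1,2) by (auto intro!: additive_mapI simp: additive_map_closed additive_map_add N.a_ac)
qed

lemma additive_map_neg:
  assumes "additive_map M N f" "abelian_group N"
  shows "additive_map M N (\<lambda>x. \<ominus>\<^bsub>N\<^esub> f x)"
proof -
  interpret N: abelian_group N by fact
  show ?thesis
    using assms(1) by (auto intro!: additive_mapI simp: additive_map_closed additive_map_add N.minus_add)
qed

lemma additive_map_diff: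
  assumes "additive_map M N f" "additive_map M N g" "abelian_group N"
  shows "additive_map M N (\<lambda>x. f x \<ominus>\<^bsub>N\<^esub> g x)"
  using additive_map_sum[OF assms(1) additive_map_neg[OF assms(2,3)] assms(3)]
  by (simp add: a_minus_def)

section \<open>Sums over lists and monoid generators\<close>

lemma list_sum_Nil [simp]: "list_sum M [] = \<zero>\<^bsub>M\<^esub>"
  and list_sum_Cons [simp]: "list_sum M (x # xs) = x \<oplus>\<^bsub>M\<^esub> list_sum M xs"
  by (simp_all add: list_sum_def)

context abelian_monoid
begin

lemma list_sum_closed: "set xs \<subseteq> carrier G \<Longrightarrow> list_sum G xs \<in> carrier G"
  by (induction xs) auto

lemma list_sum_append:
  "\<lbrakk>set xs \<subseteq> carrier G; set ys \<subseteq> carrier G\<rbrakk>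
    \<Longrightarrow> list_sum G (xs @ ys) = list_sum G xs \<oplus> list_sum G ys"
  by (induction xs) (auto simp: list_sum_closed a_assoc)

end

lemma additive_map_list_sum:
  assumes "additive_map M N f" "abelian_group M" "abelian_group N" "set xs \<subseteq> carrier M"
  shows "f (list_sum M xs) = list_sum N (map f xs)"
proof -
  interpret M: abelian_group M by fact
  show ?thesis
    using assms(4)
    by (induction xs)
      (auto simp: additive_map_zero[OF assms(1-3)] additive_map_add[OF assms(1)] M.list_sum_closed)
qed

text \<open>Generation as a monoid: finite sums only, without negatives or scalars. This is the kind
  of generation under which the description in \<open>map_on_generators\<close> finds a value at
  every element.\<close>

definition generated_by :: "'i set \<Rightarrow> ('m, 'y) ring_scheme \<Rightarrow> ('i \<Rightarrow> 'm) \<Rightarrow> bool" where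
  "generated_by I M g \<longleftrightarrow>
     g \<in> I \<rightarrow> carrier M \<and> (\<forall>x\<in>carrier M. \<exists>ts. set ts \<subseteq> I \<and> x = list_sum M (map g ts))"

lemma generated_byE:
  assumes "generated_by I M g" "x \<in> carrier M"
  obtains ts where "set ts \<subseteq> I" "x = list_sum M (map g ts)"
  using assms by (auto simp: generated_by_def)

lemma generated_by_closed: "\<lbrakk>generated_by I M g; t \<in> I\<rbrakk> \<Longrightarrow> g t \<in> carrier M"
  by (auto simp: generated_by_def)

text \<open>Expanding \<open>x\<close> in generators turns both sides into the same list sum. It
  replaces induction over elements: later identities on tensor products and jets are checked only on
  pure tensors and classes.\<close>

lemma additive_map_eqI:
  assumes "generated_by I M g" "additive_map M N f" "additive_map M N f'"
    and "abelian_group M" "abelian_group N"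
    and "\<And>t. t \<in> I \<Longrightarrow> f (g t) = f' (g t)" and "x \<in> carrier M"
  shows "f x = f' x"
proof -
  obtain ts where ts: "set ts \<subseteq> I" "x = list_sum M (map g ts)"
    using assms(1,7) by (rule generated_byE)
  have "set (map g ts) \<subseteq> carrier M"
    using ts(1) generated_by_closed[OF assms(1)] by auto
  moreover have "map f (map g ts) = map f' (map g ts)"
    using ts(1) assms(6) by auto
  ultimately show ?thesis
    using ts(2) additive_map_list_sum[OF assms(2,4,5)] additive_map_list_sum[OF assms(3,4,5)]
    by metis
qed

text \<open>Consistency is asked only against the one list \<open>ts\<close>: every other list
  representing the same element must give the same value, and then the description has exactly one
  solution.\<close>

lemma map_on_generators_list_sum:
  assumes "\<And>us. \<lbrakk>set us \<subseteq> I; list_sum M (map g us) = list_sum M (map g ts)\<rbrakk>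
      \<Longrightarrow> list_sum N (map h us) = list_sum N (map h ts)"
    and "set ts \<subseteq> I"
  shows "map_on_generators I M N g h (list_sum M (map g ts)) = list_sum N (map h ts)"
  unfolding map_on_generators_def
proof (rule the_equality)
  show "\<exists>us. set us \<subseteq> I \<and> list_sum M (map g ts) = list_sum M (map g us) \<and>
      list_sum N (map h ts) = list_sum N (map h us)"
    using assms(2) by blast
next
  fix y assume "\<exists>us. set us \<subseteq> I \<and> list_sum M (map g ts) = list_sum M (map g us) \<and>
      y = list_sum N (map h us)"
  then show "y = list_sum N (map h ts)"
    using assms(1) by fastforce
qed

text \<open>An additive map with the prescribed values is itself a proof of consistency, since it
  computes the value from the element and not from the list that represents it.\<close>

lemma map_on_generators_unique:
  assumes "generated_by I M g" "additive_map M N \<phi>" "abelian_group M" "abelian_group N"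
    and "\<And>t. t \<in> I \<Longrightarrow> \<phi> (g t) = h t" and "x \<in> carrier M"
  shows "map_on_generators I M N g h x = \<phi> x"
proof -
  have \<phi>: "\<phi> (list_sum M (map g ts)) = list_sum N (map h ts)" if "set ts \<subseteq> I" for ts
  proof -
    have "set (map g ts) \<subseteq> carrier M"
      using that generated_by_closed[OF assms(1)] by auto
    moreover have "map \<phi> (map g ts) = map h ts"
      using that assms(5) by auto
    ultimately show ?thesis
      using additive_map_list_sum[OF assms(2-4)] by metis
  qed
  obtain ts where ts: "set ts \<subseteq> I" "x = list_sum M (map g ts)"
    using assms(1,6) by (rule generated_byE)
  have "map_on_generators I M N g h (list_sum M (map g ts)) = list_sum N (map h ts)"
  proof (rule map_on_generators_list_sum[OF _ ts(1)])
    fix us assume "set us \<subseteq> I" "list_sum M (map g us) = list_sum M (map g ts)"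
    then show "list_sum N (map h us) = list_sum N (map h ts)"
      using \<phi> ts(1) by metis
  qed
  then show ?thesis
    using \<phi>[OF ts(1)] ts(2) by simp
qed

text \<open>Here no map is known in advance, only consistency of the prescription. This is the form
  in which maps out of a tensor product are first created; afterwards an existing map serves as
  witness.\<close>

lemma
  assumes gen: "generated_by I M g" and h: "h \<in> I \<rightarrow> carrier N"
    and M: "abelian_group M" and N: "abelian_group N"
    and cons: "\<And>ts us. \<lbrakk>set ts \<subseteq> I; set us \<subseteq> I; list_sum M (map g ts) = list_sum M (map g us)\<rbrakk>
      \<Longrightarrow> list_sum N (map h ts) = list_sum N (map h us)"
  shows map_on_generators_additive: "additive_map M N (map_on_generators I M N g h)"
    and map_on_generators_value: "t \<in> I \<Longrightarrow> map_on_generators I M N g h (g t) = h t"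
proof -
  interpret M: abelian_group M by fact
  interpret N: abelian_group N by fact
  let ?f = "map_on_generators I M N g h"
  have f: "?f (list_sum M (map g ts)) = list_sum N (map h ts)" if "set ts \<subseteq> I" for ts
    by (rule map_on_generators_list_sum[OF cons that]) (use that in auto)
  have gM: "set (map g ts) \<subseteq> carrier M" if "set ts \<subseteq> I" for ts
    using that generated_by_closed[OF gen] by auto
  have hN: "set (map h ts) \<subseteq> carrier N" if "set ts \<subseteq> I" for ts
    using that h by auto
  show "additive_map M N ?f"
  proof (rule additive_mapI)
    fix x assume "x \<in> carrier M"
    then obtain ts where "set ts \<subseteq> I" "x = list_sum M (map g ts)"
      by (rule generated_byE[OF gen])
    then show "?f x \<in> carrier N"
      using N.list_sum_closed[OF hN] f by simp
  next
    fix x y assume x: "x \<in> carrier M" and y: "y \<in> carrier M"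
    obtain ts where ts: "set ts \<subseteq> I" "x = list_sum M (map g ts)"
      using x by (rule generated_byE[OF gen])
    obtain us where us: "set us \<subseteq> I" "y = list_sum M (map g us)"
      using y by (rule generated_byE[OF gen])
    have "x \<oplus>\<^bsub>M\<^esub> y = list_sum M (map g (ts @ us))"
      using M.list_sum_append[OF gM[OF ts(1)] gM[OF us(1)]] ts(2) us(2) by simp
    then have "?f (x \<oplus>\<^bsub>M\<^esub> y) = list_sum N (map h (ts @ us))"
      using f[of "ts @ us"] ts(1) us(1) by simp
    then show "?f (x \<oplus>\<^bsub>M\<^esub> y) = ?f x \<oplus>\<^bsub>N\<^esub> ?f y"
      using N.list_sum_append[OF hN[OF ts(1)] hN[OF us(1)]] f[OF ts(1)] f[OF us(1)] ts(2) us(2)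
      by simp
  qed
  show "?f (g t) = h t" if "t \<in> I"
    using f[of "[t]"] that h generated_by_closed[OF gen that] by (auto simp: Pi_iff)
qed

text \<open>For fixed scalars both sides of each remaining axiom are additive in the module element,
  so the axioms need checking at generators only.\<close>

lemma left_module_of_generators:
  fixes M :: "('r, 'm, 'y) module_scheme"
  assumes "ring R" and M: "abelian_group M" and gen: "generated_by I M g"
    and smult: "\<And>a. a \<in> carrier R \<Longrightarrow> additive_map M M (\<lambda>x. a \<odot>\<^bsub>M\<^esub> x)"
    and "\<And>a b t. \<lbrakk>a \<in> carrier R; b \<in> carrier R; t \<in> I\<rbrakk>
      \<Longrightarrow> (a \<oplus>\<^bsub>R\<^esub> b) \<odot>\<^bsub>M\<^esub> g t = a \<odot>\<^bsub>M\<^esub> g t \<oplus>\<^bsub>M\<^esub> b \<odot>\<^bsub>M\<^esub> g t"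
    and "\<And>a b t. \<lbrakk>a \<in> carrier R; b \<in> carrier R; t \<in> I\<rbrakk>
      \<Longrightarrow> (a \<otimes>\<^bsub>R\<^esub> b) \<odot>\<^bsub>M\<^esub> g t = a \<odot>\<^bsub>M\<^esub> (b \<odot>\<^bsub>M\<^esub> g t)"
    and "\<And>t. t \<in> I \<Longrightarrow> \<one>\<^bsub>R\<^esub> \<odot>\<^bsub>M\<^esub> g t = g t"
  shows "left_module R M"
proof -
  interpret R: ring R by fact
  interpret M: abelian_group M by fact
  show ?thesis
  proof (intro left_module.intro left_module_axioms.intro)
    show "ring R" "abelian_group M" by fact+
  next
    fix a x assume "a \<in> carrier R" "x \<in> carrier M"
    then show "a \<odot>\<^bsub>M\<^esub> x \<in> carrier M"
      using additive_map_closed[OF smult] by simp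
  next
    fix a b x assume a: "a \<in> carrier R" and b: "b \<in> carrier R" and x: "x \<in> carrier M"
    note eqI = additive_map_eqI[OF gen _ _ M M _ x]
    show "(a \<oplus>\<^bsub>R\<^esub> b) \<odot>\<^bsub>M\<^esub> x = a \<odot>\<^bsub>M\<^esub> x \<oplus>\<^bsub>M\<^esub> b \<odot>\<^bsub>M\<^esub> x"
      by (rule eqI[OF smult additive_map_sum[OF smult smult M]]) (use a b assms(5) in auto)
    show "(a \<otimes>\<^bsub>R\<^esub> b) \<odot>\<^bsub>M\<^esub> x = a \<odot>\<^bsub>M\<^esub> (b \<odot>\<^bsub>M\<^esub> x)"
      by (rule eqI[OF smult additive_map_comp[OF smult smult]]) (use a b assms(6) in auto)
  next
    fix a x y assume "a \<in> carrier R" "x \<in> carrier M" "y \<in> carrier M"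
    then show "a \<odot>\<^bsub>M\<^esub> (x \<oplus>\<^bsub>M\<^esub> y) = a \<odot>\<^bsub>M\<^esub> x \<oplus>\<^bsub>M\<^esub> a \<odot>\<^bsub>M\<^esub> y"
      using additive_map_add[OF smult] by simp
  next
    fix x assume x: "x \<in> carrier M"
    show "\<one>\<^bsub>R\<^esub> \<odot>\<^bsub>M\<^esub> x = x"
      by (rule additive_map_eqI[OF gen smult additive_map_id M M _ x]) (use assms(7) in auto)
  qed
qed

lemma left_module_smult_additive:
  "\<lbrakk>left_module R M; a \<in> carrier R\<rbrakk> \<Longrightarrow> additive_map M M (\<lambda>x. a \<odot>\<^bsub>M\<^esub> x)"
  by (auto intro: additive_mapI simp: left_module.smult_closed left_module.smult_r_distr)

lemma left_module_abelian_group: "left_module R M \<Longrightarrow> abelian_group M"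
  by (simp add: left_module_def)

section \<open>Quotients by additive subgroups\<close>

lemma additive_subgroupI':
  assumes "abelian_group M" "H \<subseteq> carrier M" "\<zero>\<^bsub>M\<^esub> \<in> H"
    and "\<And>x y. \<lbrakk>x \<in> H; y \<in> H\<rbrakk> \<Longrightarrow> x \<oplus>\<^bsub>M\<^esub> y \<in> H" and "\<And>x. x \<in> H \<Longrightarrow> \<ominus>\<^bsub>M\<^esub> x \<in> H"
  shows "additive_subgroup H M"
proof -
  interpret M: abelian_group M by fact
  show ?thesis
    using assms(2-5)
    by (intro additive_subgroupI group.subgroupI[OF M.a_group]) (auto simp flip: a_inv_def)
qed

lemma quot_module_sel [simp]:
  "carrier (quot_module M H) = a_rcosets\<^bsub>M\<^esub> H" "\<zero>\<^bsub>quot_module M H\<^esub> = H"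
  "X \<oplus>\<^bsub>quot_module M H\<^esub> Y = X <+>\<^bsub>M\<^esub> Y"
  "a \<odot>\<^bsub>quot_module M H\<^esub> X = quot_map M H (\<lambda>x. a \<odot>\<^bsub>M\<^esub> x) X"
  by (simp_all add: quot_module_def quot_map_def)

context
  fixes H and M :: "('r, 'm, 'y) module_scheme"
  assumes M: "abelian_group M" and H: "additive_subgroup H M"
begin

interpretation abelian_subgroup H M
  by (intro abelian_subgroupI3 M H)

lemma abelian_group_quot_module: "abelian_group (quot_module M H)"
proof -
  interpret Q: comm_group "M A_Mod H" by (rule a_factorgroup_is_comm_group)
  have "carrier (M A_Mod H) = a_rcosets\<^bsub>M\<^esub> H" "\<one>\<^bsub>M A_Mod H\<^esub> = H"
    by (simp_all add: A_FactGroup_def FactGroup_def A_RCOSETS_def)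
  then show ?thesis
    using Q.m_closed Q.one_closed Q.m_assoc Q.m_comm Q.l_one Q.l_inv_ex
    by (intro abelian_groupI) auto
qed

lemma quot_module_coset: "x \<in> carrier M \<Longrightarrow> H +>\<^bsub>M\<^esub> x \<in> carrier (quot_module M H)"
  using a_rcosetsI[OF a_subset] by simp

lemma quot_moduleE:
  assumes "X \<in> carrier (quot_module M H)"
  obtains x where "x \<in> carrier M" "X = H +>\<^bsub>M\<^esub> x"
  using assms by (auto simp: A_RCOSETS_def')

lemma coset_additive: "additive_map M (quot_module M H) (\<lambda>x. H +>\<^bsub>M\<^esub> x)"
  by (rule additive_mapI) (simp_all add: a_rcosetsI[OF a_subset] a_rcos_sum)

lemma coset_eq_iff:
  assumes "x \<in> carrier M" "y \<in> carrier M"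
  shows "H +>\<^bsub>M\<^esub> x = H +>\<^bsub>M\<^esub> y \<longleftrightarrow> x \<ominus>\<^bsub>M\<^esub> y \<in> H"
proof
  assume "H +>\<^bsub>M\<^esub> x = H +>\<^bsub>M\<^esub> y"
  then have "x \<in> H +>\<^bsub>M\<^esub> y"
    using assms a_rcos_self by metis
  then show "x \<ominus>\<^bsub>M\<^esub> y \<in> H"
    using a_rcos_module[OF assms(2,1)] by (simp add: minus_eq)
next
  assume "x \<ominus>\<^bsub>M\<^esub> y \<in> H"
  then have "x \<in> H +>\<^bsub>M\<^esub> y"
    using a_rcos_module[OF assms(2,1)] by (simp add: minus_eq)
  then show "H +>\<^bsub>M\<^esub> x = H +>\<^bsub>M\<^esub> y"
    using a_repr_independence'[OF _ assms(2)] by metis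
qed

lemma coset_eq_zero_iff: "x \<in> carrier M \<Longrightarrow> H +>\<^bsub>M\<^esub> x = H \<longleftrightarrow> x \<in> H"
  using a_rcos_const a_rcos_self by metis

text \<open>The image of a coset of \<open>H\<close> lies in one coset of \<open>H'\<close> but may
  be a proper part of it; adding \<open>H'\<close> fills it up to the whole coset.\<close>

lemma quot_map_coset:
  fixes H' and N :: "('s, 'n, 'z) module_scheme"
  assumes "abelian_group N" "additive_subgroup H' N" "additive_map M N f" "f ` H \<subseteq> H'"
    and x: "x \<in> carrier M"
  shows "quot_map N H' f (H +>\<^bsub>M\<^esub> x) = H' +>\<^bsub>N\<^esub> f x"
proof -
  interpret N: abelian_subgroup H' N
    by (intro abelian_subgroupI3 assms)
  note Hc = a_subset
  have "f ` (H +>\<^bsub>M\<^esub> x) \<subseteq> H' +>\<^bsub>N\<^esub> f x"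
    using x Hc assms(4) by (fastforce simp: a_r_coset_def' additive_map_add[OF assms(3)])
  moreover have "f x \<in> f ` (H +>\<^bsub>M\<^esub> x)"
    using a_rcos_self[OF x] by simp
  moreover have fx: "f x \<in> carrier N" using assms(3) x by (rule additive_map_closed)
  ultimately have "H' <+>\<^bsub>N\<^esub> f ` (H +>\<^bsub>M\<^esub> x) \<subseteq> H' <+>\<^bsub>N\<^esub> (H' +>\<^bsub>N\<^esub> f x)"
    by (force simp: set_add_def')
  moreover have "H' +>\<^bsub>N\<^esub> f x \<subseteq> H' <+>\<^bsub>N\<^esub> f ` (H +>\<^bsub>M\<^esub> x)"
    using \<open>f x \<in> f ` (H +>\<^bsub>M\<^esub> x)\<close> unfolding set_add_def' a_r_coset_def'[of _ H'] by blast
  moreover have "H' <+>\<^bsub>N\<^esub> (H' +>\<^bsub>N\<^esub> f x) = H' +>\<^bsub>N\<^esub> f x"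
    using N.rcosets_add_eq N.a_rcosetsI[OF N.a_subset fx] by simp
  ultimately show ?thesis unfolding quot_map_def by auto
qed

lemma quot_map_additive:
  fixes H' and N :: "('s, 'n, 'z) module_scheme"
  assumes "abelian_group N" "additive_subgroup H' N" "additive_map M N f" "f ` H \<subseteq> H'"
  shows "additive_map (quot_module M H) (quot_module N H') (quot_map N H' f)"
proof (rule additive_mapI)
  interpret N: abelian_subgroup H' N
    by (intro abelian_subgroupI3 assms)
  note f = quot_map_coset[OF assms] and fc = additive_map_closed[OF assms(3)]
  fix X assume "X \<in> carrier (quot_module M H)"
  then obtain x where x: "x \<in> carrier M" "X = H +>\<^bsub>M\<^esub> x" by (rule quot_moduleE)
  then show "quot_map N H' f X \<in> carrier (quot_module N H')"
    using f[OF x(1)] fc N.a_rcosetsI[OF N.a_subset] by simp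
  fix Y assume "Y \<in> carrier (quot_module M H)"
  then obtain y where y: "y \<in> carrier M" "Y = H +>\<^bsub>M\<^esub> y" by (rule quot_moduleE)
  show "quot_map N H' f (X \<oplus>\<^bsub>quot_module M H\<^esub> Y) =
      quot_map N H' f X \<oplus>\<^bsub>quot_module N H'\<^esub> quot_map N H' f Y"
    using x y fc by (simp add: f a_rcos_sum N.a_rcos_sum additive_map_add[OF assms(3)])
qed

lemma generated_by_quot_module:
  assumes "generated_by I M g"
  shows "generated_by I (quot_module M H) (\<lambda>t. H +>\<^bsub>M\<^esub> g t)"
  unfolding generated_by_def
proof (intro conjI ballI Pi_I)
  show "H +>\<^bsub>M\<^esub> g t \<in> carrier (quot_module M H)" if "t \<in> I" for t
    using that quot_module_coset generated_by_closed[OF assms] by blast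
  fix X assume "X \<in> carrier (quot_module M H)"
  then obtain x where x: "x \<in> carrier M" "X = H +>\<^bsub>M\<^esub> x" by (rule quot_moduleE)
  obtain ts where ts: "set ts \<subseteq> I" "x = list_sum M (map g ts)"
    using assms x(1) by (rule generated_byE)
  have "set (map g ts) \<subseteq> carrier M"
    using ts(1) generated_by_closed[OF assms] by auto
  from additive_map_list_sum[OF coset_additive M abelian_group_quot_module this]
  show "\<exists>ts. set ts \<subseteq> I \<and> X = list_sum (quot_module M H) (map (\<lambda>t. H +>\<^bsub>M\<^esub> g t) ts)"
    using ts x(2) by (auto simp: comp_def)
qed

end

section \<open>Tensor products\<close>

lemma free_pairs_sel [simp]:
  "carrier (free_pairs lact S T) = carrier (free_Abelian_group (S \<times> T))"
  "\<zero>\<^bsub>free_pairs lact S T\<^esub> = 0" "u \<oplus>\<^bsub>free_pairs lact S T\<^esub> v = u + v"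
  "s \<odot>\<^bsub>free_pairs lact S T\<^esub> u = frag_extend (\<lambda>(w, x). frag_of (lact s w, x)) u"
  by (simp_all add: free_pairs_def)

lemma abelian_group_free_pairs: "abelian_group (free_pairs lact S T)"
proof (rule abelian_groupI)
  fix u assume "u \<in> carrier (free_pairs lact S T)"
  then show "\<exists>v\<in>carrier (free_pairs lact S T). v \<oplus>\<^bsub>free_pairs lact S T\<^esub> u = \<zero>\<^bsub>free_pairs lact S T\<^esub>"
    by (intro bexI[of _ "- u"]) auto
qed (auto dest: subsetD[OF keys_add])

lemma free_pairs_uminus:
  assumes "u \<in> carrier (free_pairs lact S T)"
  shows "\<ominus>\<^bsub>free_pairs lact S T\<^esub> u = - u"
proof -
  interpret abelian_group "free_pairs lact S T" by (rule abelian_group_free_pairs)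
  show ?thesis using assms minus_equality[of "- u" u] by simp
qed

lemma free_pairs_minus:
  assumes "u \<in> carrier (free_pairs lact S T)" "v \<in> carrier (free_pairs lact S T)"
  shows "u \<ominus>\<^bsub>free_pairs lact S T\<^esub> v = u - v"
  using free_pairs_uminus[OF assms(2)] by (simp add: a_minus_def)

text \<open>Common setting for the tensor product over \<open>K\<close> of \<open>A\<close> with a
  module and for the one over \<open>A\<close> of forms with a module. The two closure conditions
  keep all relators inside the free abelian group on pairs.\<close>

locale balanced_pair =
  W: abelian_group W + N: abelian_group N
  for W :: "('w, 'y) ring_scheme" and ract :: "'w \<Rightarrow> 'r \<Rightarrow> 'w" and R :: "('r, 'x) ring_scheme"
    and N :: "('r, 'n, 'z) module_scheme" +
  assumes ract_closed: "\<lbrakk>w \<in> carrier W; r \<in> carrier R\<rbrakk> \<Longrightarrow> ract w r \<in> carrier W"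
    and smult_closed: "\<lbrakk>r \<in> carrier R; x \<in> carrier N\<rbrakk> \<Longrightarrow> r \<odot>\<^bsub>N\<^esub> x \<in> carrier N"
begin

abbreviation "pairs lact \<equiv> free_pairs lact (carrier W) (carrier N)"
abbreviation "null \<equiv> tensor_null W ract R N"
abbreviation "product lact \<equiv> tensor lact W ract R N"
abbreviation "pure \<equiv> pure_tensor W ract R N"

lemma relators_closed: "tensor_relators W ract R N \<subseteq> carrier (free_Abelian_group (carrier W \<times> carrier N))"
proof -
  have keys: "Poly_Mapping.keys (frag_of a - frag_of b - frag_of c) \<subseteq> {a, b, c}" 
    "Poly_Mapping.keys (frag_of a - frag_of b) \<subseteq> {a, b}" for a b c :: "'w \<times> 'n"
    using keys_diff[of "frag_of a - frag_of b" "frag_of c"] keys_diff[of "frag_of a" "frag_of b"]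
    by auto
  show ?thesis
    unfolding tensor_relators_def
    by (auto dest!: subsetD[OF keys(1)] subsetD[OF keys(2)] simp: ract_closed smult_closed)
qed

lemma additive_subgroup_null: "additive_subgroup null (pairs lact)"
proof (rule additive_subgroupI'[OF abelian_group_free_pairs])
  note sub = group.generate_is_subgroup[OF group_free_Abelian_group relators_closed]
  show c: "null \<subseteq> carrier (pairs lact)"
    using subgroup.subset[OF sub] by (simp add: tensor_null_def)
  show "\<zero>\<^bsub>pairs lact\<^esub> \<in> null"
    using subgroup.one_closed[OF sub] by (simp add: tensor_null_def)
  show "x \<oplus>\<^bsub>pairs lact\<^esub> y \<in> null" if "x \<in> null" "y \<in> null" for x y
    using subgroup.m_closed[OF sub] that by (simp add: tensor_null_def)
  show "\<ominus>\<^bsub>pairs lact\<^esub> x \<in> null" if "x \<in> null" for x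
  proof -
    have "x \<in> carrier (pairs lact)" using c that by blast
    then show ?thesis
      using subgroup.m_inv_closed[OF sub, of x] that by (simp add: free_pairs_uminus tensor_null_def)
  qed
qed

text \<open>Induction over the generated subgroup reduces the inclusion to the relators. It is
  applied with \<open>H\<close> trivial, to let balanced maps descend, and with \<open>H\<close> the
  null subgroup itself, to let the left action descend.\<close>

lemma null_image:
  assumes h: "additive_map (pairs lact) P h" and P: "abelian_group P" and H: "additive_subgroup H P"
    and rel: "h ` tensor_relators W ract R N \<subseteq> H"
  shows "h ` null \<subseteq> H"
proof -
  interpret H: additive_subgroup H P by fact
  have "h z \<in> H" if "z \<in> null" for z
    using that unfolding tensor_null_def
  proof (induction rule: generate.induct)
    case one
    show ?case using additive_map_zero[OF h abelian_group_free_pairs P] by simp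
  next
    case (incl z)
    then show ?case using rel by blast
  next
    case (inv z)
    then have z: "z \<in> carrier (pairs lact)" using relators_closed unfolding free_pairs_sel by blast
    then have "h (inv\<^bsub>free_Abelian_group (carrier W \<times> carrier N)\<^esub> z) = \<ominus>\<^bsub>P\<^esub> h z"
      using additive_map_uminus[OF h abelian_group_free_pairs P z]
      by (simp add: free_pairs_uminus)
    then show ?case using inv rel H.a_inv_closed by auto
  next
    case (eng u v)
    have "u \<in> carrier (pairs lact)" "v \<in> carrier (pairs lact)"
      using eng(1,2) additive_subgroup.a_subset[OF additive_subgroup_null, of lact]
      unfolding tensor_null_def free_pairs_sel by blast+
    then show ?case using additive_map_add[OF h] eng(3,4) by simp
  qed
  then show ?thesis by blast
qed

lemma pure_coset: "pure w x = null +>\<^bsub>pairs lact\<^esub> frag_of (w, x)"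
  by (simp add: pure_tensor_def a_r_coset_def r_coset_def)

lemma abelian_group_product: "abelian_group (product lact)"
  unfolding tensor_def by (rule abelian_group_quot_module[OF abelian_group_free_pairs additive_subgroup_null])

lemma pure_closed: "\<lbrakk>w \<in> carrier W; x \<in> carrier N\<rbrakk> \<Longrightarrow> pure w x \<in> carrier (product lact)"
  unfolding tensor_def pure_coset[of _ _ lact]
  by (rule quot_module_coset[OF abelian_group_free_pairs additive_subgroup_null]) simp

lemma coset_additive': "additive_map (pairs lact) (product lact) (\<lambda>u. null +>\<^bsub>pairs lact\<^esub> u)"
  unfolding tensor_def by (rule coset_additive[OF abelian_group_free_pairs additive_subgroup_null])

lemma relator_coset:
  assumes "u - v \<in> tensor_relators W ract R N"
    "u \<in> carrier (pairs lact)" "v \<in> carrier (pairs lact)"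
  shows "null +>\<^bsub>pairs lact\<^esub> u = null +>\<^bsub>pairs lact\<^esub> v"
  using assms coset_eq_iff[OF abelian_group_free_pairs additive_subgroup_null, of u lact v]
  by (simp add: free_pairs_minus tensor_null_def generate.incl)

lemma pure_add_left:
  assumes "w \<in> carrier W" "w' \<in> carrier W" "x \<in> carrier N"
  shows "pure (w \<oplus>\<^bsub>W\<^esub> w') x = pure w x \<oplus>\<^bsub>product lact\<^esub> pure w' x"
proof -
  have k: "frag_of (w, x) + frag_of (w', x) \<in> carrier (pairs lact)"
    using assms by (auto dest: subsetD[OF keys_add])
  have "pure (w \<oplus>\<^bsub>W\<^esub> w') x = null +>\<^bsub>pairs lact\<^esub> (frag_of (w, x) + frag_of (w', x))"
    unfolding pure_coset[of _ _ lact] using assms k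
    by (intro relator_coset)
      (auto simp: tensor_relators_def diff_diff_eq)
  also have "\<dots> = pure w x \<oplus>\<^bsub>product lact\<^esub> pure w' x"
    unfolding pure_coset[of _ _ lact]
    using additive_map_add[OF coset_additive', of "frag_of (w, x)" lact "frag_of (w', x)"] assms by simp
  finally show ?thesis .
qed

lemma pure_add_right:
  assumes "w \<in> carrier W" "x \<in> carrier N" "x' \<in> carrier N"
  shows "pure w (x \<oplus>\<^bsub>N\<^esub> x') = pure w x \<oplus>\<^bsub>product lact\<^esub> pure w x'"
proof -
  have k: "frag_of (w, x) + frag_of (w, x') \<in> carrier (pairs lact)"
    using assms by (auto dest: subsetD[OF keys_add])
  have "pure w (x \<oplus>\<^bsub>N\<^esub> x') = null +>\<^bsub>pairs lact\<^esub> (frag_of (w, x) + frag_of (w, x'))"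
    unfolding pure_coset[of _ _ lact] using assms k
    by (intro relator_coset)
      (auto simp: tensor_relators_def diff_diff_eq)
  also have "\<dots> = pure w x \<oplus>\<^bsub>product lact\<^esub> pure w x'"
    unfolding pure_coset[of _ _ lact]
    using additive_map_add[OF coset_additive', of "frag_of (w, x)" lact "frag_of (w, x')"] assms by simp
  finally show ?thesis .
qed

lemma pure_balanced:
  assumes "w \<in> carrier W" "r \<in> carrier R" "x \<in> carrier N"
  shows "pure (ract w r) x = pure w (r \<odot>\<^bsub>N\<^esub> x)"
  \<comment> \<open>No left action occurs in the claim, but cosets are taken in
    \<open>free_pairs\<close>, which expects one; the trivial action of \<open>unit\<close> fills
    the slot.\<close>
  unfolding pure_coset[of _ _ "\<lambda>(s :: unit) w. w"] using assms
  by (intro relator_coset) (auto simp: tensor_relators_def ract_closed smult_closed)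

lemma pure_uminus_left:
  assumes "w \<in> carrier W" "x \<in> carrier N"
  shows "pure (\<ominus>\<^bsub>W\<^esub> w) x = \<ominus>\<^bsub>product lact\<^esub> pure w x"
proof -
  have "additive_map W (product lact) (\<lambda>w. pure w x)"
    using assms(2) by (auto intro!: additive_mapI pure_closed simp: pure_add_left[of _ _ _ lact])
  from additive_map_uminus[OF this W.abelian_group_axioms abelian_group_product assms(1)]
  show ?thesis .
qed

text \<open>The free abelian group is exhausted by zero, generators and differences. Negatives cost
  nothing in the tensor product, because a sign can be moved into the first factor; hence sums of
  pure tensors already give everything.\<close>

lemma generated_by_pure:
  "generated_by (carrier W \<times> carrier N) (product lact) (\<lambda>(w, x). pure w x)"
  unfolding generated_by_def
proof (intro conjI ballI)
  show "(\<lambda>(w, x). pure w x) \<in> carrier W \<times> carrier N \<rightarrow> carrier (product lact)"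
    by (auto intro: pure_closed)
next
  interpret T: abelian_group "product lact" by (rule abelian_group_product)
  let ?P = "\<lambda>z. \<exists>ts. set ts \<subseteq> carrier W \<times> carrier N \<and>
    z = list_sum (product lact) (map (\<lambda>(w, x). pure w x) ts)"
  let ?c = "\<lambda>u. null +>\<^bsub>pairs lact\<^esub> u"
  have cl: "set (map (\<lambda>(w, x). pure w x) ts) \<subseteq> carrier (product lact)"
    if "set ts \<subseteq> carrier W \<times> carrier N" for ts
    using that by (auto intro!: pure_closed)
  have add: "?P (u \<oplus>\<^bsub>product lact\<^esub> v)" if uv: "?P u" "?P v" for u v
  proof -
    obtain ts us where "set ts \<subseteq> carrier W \<times> carrier N" "set us \<subseteq> carrier W \<times> carrier N"
      "u = list_sum (product lact) (map (\<lambda>(w, x). pure w x) ts)"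
      "v = list_sum (product lact) (map (\<lambda>(w, x). pure w x) us)"
      using uv by blast
    then show ?thesis
      using T.list_sum_append[OF cl cl, of ts us] by (intro exI[of _ "ts @ us"]) simp
  qed
  have uminus: "?P (\<ominus>\<^bsub>product lact\<^esub> u)" if u: "?P u" for u
  proof -
    obtain ts where ts: "set ts \<subseteq> carrier W \<times> carrier N"
      "u = list_sum (product lact) (map (\<lambda>(w, x). pure w x) ts)"
      using u by blast
    have "\<ominus>\<^bsub>product lact\<^esub> u =
        list_sum (product lact) (map (a_inv (product lact)) (map (\<lambda>(w, x). pure w x) ts))"
      unfolding ts(2)
      by (rule additive_map_list_sum[OF additive_map_neg[OF additive_map_id]
          abelian_group_product abelian_group_product cl[OF ts(1)]]) (rule abelian_group_product)
    also have "map (a_inv (product lact)) (map (\<lambda>(w, x). pure w x) ts) =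
        map (\<lambda>(w, x). pure w x) (map (\<lambda>(w, x). (\<ominus>\<^bsub>W\<^esub> w, x)) ts)"
      unfolding map_map
      by (rule map_cong) (use ts(1) in \<open>auto simp: pure_uminus_left[of _ _ lact] simp del: set_eq_iff\<close>)
    finally show ?thesis
      using ts(1) by (intro exI[of _ "map (\<lambda>(w, x). (\<ominus>\<^bsub>W\<^esub> w, x)) ts"]) auto
  qed
  have P: "?P (?c u)" if "Poly_Mapping.keys u \<subseteq> carrier W \<times> carrier N" for u
    using that
  proof (induction u rule: free_Abelian_group_induct[consumes 1, case_names 1 2 3])
    case 1
    have "?c 0 = \<zero>\<^bsub>product lact\<^esub>"
      using additive_map_zero[OF coset_additive' abelian_group_free_pairs abelian_group_product] by simp
    then show ?case by (intro exI[of _ "[]"]) simp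
  next
    case (2 u v)
    then have "?c (u - v) = ?c u \<oplus>\<^bsub>product lact\<^esub> (\<ominus>\<^bsub>product lact\<^esub> ?c v)"
      using additive_map_minus[OF coset_additive'[of lact] abelian_group_free_pairs abelian_group_product, of u v]
      by (simp add: free_pairs_minus T.minus_eq)
    then show ?case using add[OF 2(3) uminus[OF 2(4)]] by simp
  next
    case (3 a)
    then show ?case
      using pure_closed[of "fst a" "snd a" lact]
      by (intro exI[of _ "[a]"]) (auto simp: pure_coset[of _ _ lact])
  qed
  fix X assume "X \<in> carrier (product lact)"
  then obtain u where "u \<in> carrier (pairs lact)" "X = ?c u"
    unfolding tensor_def by (rule quot_moduleE[OF abelian_group_free_pairs additive_subgroup_null])
  then show "?P X" using P by simp
qed

context
  fixes Q :: "('q, 'u) ring_scheme" and \<beta> :: "'w \<Rightarrow> 'n \<Rightarrow> 'q"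
  assumes Q: "abelian_group Q"
    and left: "\<And>x. x \<in> carrier N \<Longrightarrow> additive_map W Q (\<lambda>w. \<beta> w x)"
    and right: "\<And>w. w \<in> carrier W \<Longrightarrow> additive_map N Q (\<beta> w)"
    and bal: "\<And>w r x. \<lbrakk>w \<in> carrier W; r \<in> carrier R; x \<in> carrier N\<rbrakk> \<Longrightarrow> \<beta> (ract w r) x = \<beta> w (r \<odot>\<^bsub>N\<^esub> x)"
begin

text \<open>The map \<open>h\<close> extends \<open>\<beta>\<close> from pairs to the free abelian
  group. Biadditivity and balance say that \<open>h\<close> kills the relators, hence the null
  subgroup. Two lists with the same tensor sum have formal sums that differ by a null element, so
  \<open>h\<close> takes the same value on both.\<close>

lemma tensor_sums_consistent:
  assumes ts: "set ts \<subseteq> carrier W \<times> carrier N" and us: "set us \<subseteq> carrier W \<times> carrier N"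
    and eq: "list_sum (product lact) (map (\<lambda>(w, x). pure w x) ts) =
      list_sum (product lact) (map (\<lambda>(w, x). pure w x) us)"
  shows "list_sum Q (map (\<lambda>(w, x). \<beta> w x) ts) = list_sum Q (map (\<lambda>(w, x). \<beta> w x) us)"
proof -
  interpret Q: abelian_group Q by fact
  interpret P: abelian_group "pairs lact" by (rule abelian_group_free_pairs)
  let ?c = "\<lambda>u. null +>\<^bsub>pairs lact\<^esub> u"
  have "(\<lambda>(w, x). \<beta> w x) ` (carrier W \<times> carrier N) \<subseteq> carrier (add_monoid Q)"
    using additive_map_closed[OF right] by auto
  then obtain h where h: "h \<in> hom (free_Abelian_group (carrier W \<times> carrier N)) (add_monoid Q)"
    and h_of: "\<And>t. t \<in> carrier W \<times> carrier N \<Longrightarrow> h (frag_of t) = (\<lambda>(w, x). \<beta> w x) t"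
    using comm_group.free_Abelian_group_universal[OF Q.a_comm_group] by blast
  have add: "additive_map (pairs lact) Q h"
    using h by (auto simp: additive_map_def hom_def)
  have "h (u - v) = h u \<ominus>\<^bsub>Q\<^esub> h v" if "Poly_Mapping.keys u \<subseteq> carrier W \<times> carrier N" "Poly_Mapping.keys v \<subseteq> carrier W \<times> carrier N" for u v
    using additive_map_minus[OF add P.abelian_group_axioms Q, of u v] that by (simp add: free_pairs_minus)
  note h_diff = this
  have k2: "Poly_Mapping.keys (frag_of a - frag_of b) \<subseteq> carrier W \<times> carrier N"
    if "a \<in> carrier W \<times> carrier N" "b \<in> carrier W \<times> carrier N" for a b
    using that by (auto dest: subsetD[OF keys_diff])
  have z: "additive_subgroup {\<zero>\<^bsub>Q\<^esub>} Q"
    by (rule additive_subgroupI'[OF Q]) auto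
  have \<beta>c: "\<beta> w x \<in> carrier Q" if "w \<in> carrier W" "x \<in> carrier N" for w x
    using additive_map_closed[OF right] that by blast
  have cancel: "y \<oplus>\<^bsub>Q\<^esub> z \<ominus>\<^bsub>Q\<^esub> y \<ominus>\<^bsub>Q\<^esub> z = \<zero>\<^bsub>Q\<^esub>" if "y \<in> carrier Q" "z \<in> carrier Q" for y z
    using that by (simp add: Q.minus_eq Q.a_comm[of y z] Q.a_assoc Q.r_neg)
  have "h ` tensor_relators W ract R N \<subseteq> {\<zero>\<^bsub>Q\<^esub>}"
    unfolding tensor_relators_def
    by (auto simp: h_diff h_of k2 ract_closed smult_closed bal additive_map_add[OF left]
        additive_map_add[OF right] \<beta>c cancel Q.minus_eq[of x x for x] Q.r_neg additive_map_closed[OF right])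
  then have hnull: "h ` null \<subseteq> {\<zero>\<^bsub>Q\<^esub>}" by (rule null_image[OF add Q z])
  have frag: "set (map frag_of ts) \<subseteq> carrier (pairs lact)"
    if "set ts \<subseteq> carrier W \<times> carrier N" for ts
    using that by auto
  have sum_c: "list_sum (product lact) (map (\<lambda>(w, x). pure w x) ts) = ?c (list_sum (pairs lact) (map frag_of ts))"
    if "set ts \<subseteq> carrier W \<times> carrier N" for ts
    unfolding additive_map_list_sum[OF coset_additive' P.abelian_group_axioms abelian_group_product frag[OF that]]
    by (rule arg_cong[of _ _ "list_sum _"]) (auto simp: pure_coset[of _ _ lact])
  have sum_h: "h (list_sum (pairs lact) (map frag_of ts)) = list_sum Q (map (\<lambda>(w, x). \<beta> w x) ts)"
    if "set ts \<subseteq> carrier W \<times> carrier N" for ts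
    unfolding additive_map_list_sum[OF add P.abelian_group_axioms Q frag[OF that]]
    by (rule arg_cong[of _ _ "list_sum _"]) (use that h_of in auto)
  let ?u = "list_sum (pairs lact) (map frag_of ts)" and ?v = "list_sum (pairs lact) (map frag_of us)"
  have uv: "?u \<in> carrier (pairs lact)" "?v \<in> carrier (pairs lact)"
    using P.list_sum_closed[OF frag] ts us by auto
  have "?u \<ominus>\<^bsub>pairs lact\<^esub> ?v \<in> null"
    using eq sum_c[OF ts] sum_c[OF us] coset_eq_iff[OF P.abelian_group_axioms additive_subgroup_null uv]
    by simp
  then have "h ?u \<ominus>\<^bsub>Q\<^esub> h ?v = \<zero>\<^bsub>Q\<^esub>"
    using additive_map_minus[OF add P.abelian_group_axioms Q uv] hnull by auto
  then show ?thesis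
    using sum_h[OF ts] sum_h[OF us] additive_map_closed[OF add uv(1)] additive_map_closed[OF add uv(2)]
    by (metis Q.minus_eq Q.minus_equality Q.minus_minus Q.a_inv_closed)
qed

text \<open>The existence half of the universal property; uniqueness is
  \<open>additive_map_eqI\<close> applied to pure tensors.\<close>

lemma tensor_lift:
  obtains \<phi> where "additive_map (product lact) Q \<phi>"
    "\<And>w x. \<lbrakk>w \<in> carrier W; x \<in> carrier N\<rbrakk> \<Longrightarrow> \<phi> (pure w x) = \<beta> w x"
proof -
  have \<beta>: "(\<lambda>(w, x). \<beta> w x) \<in> carrier W \<times> carrier N \<rightarrow> carrier Q"
    using additive_map_closed[OF right] by auto
  note gen = generated_by_pure[of lact] \<beta> abelian_group_product Q tensor_sums_consistent
  show ?thesis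
  proof (rule that)
    show "additive_map (product lact) Q (map_on_generators (carrier W \<times> carrier N) (product lact) Q
        (\<lambda>(w, x). pure w x) (\<lambda>(w, x). \<beta> w x))"
      by (rule map_on_generators_additive[OF gen])
    show "map_on_generators (carrier W \<times> carrier N) (product lact) Q
        (\<lambda>(w, x). pure w x) (\<lambda>(w, x). \<beta> w x) (pure w x) = \<beta> w x"
      if "w \<in> carrier W" "x \<in> carrier N" for w x
      using map_on_generators_value[OF gen, where t = "(w, x)"] that by simp
  qed
qed

end

text \<open>Acting by \<open>s\<close> on first components sends every relator to a relator of the
  same kind: additivity of the action settles the first kind, commutation with \<open>ract\<close>
  the third. So the null subgroup is preserved and the action passes to the quotient.\<close>

lemma
  assumes "additive_map W W (lact s)"
    and "\<And>w r. \<lbrakk>w \<in> carrier W; r \<in> carrier R\<rbrakk> \<Longrightarrow> lact s (ract w r) = ract (lact s w) r"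
  shows tensor_smult_additive: "additive_map (product lact) (product lact) (\<lambda>z. s \<odot>\<^bsub>product lact\<^esub> z)"
    and tensor_smult_pure:
      "\<lbrakk>w \<in> carrier W; x \<in> carrier N\<rbrakk> \<Longrightarrow> s \<odot>\<^bsub>product lact\<^esub> pure w x = pure (lact s w) x"
proof -
  let ?f = "\<lambda>u. s \<odot>\<^bsub>pairs lact\<^esub> u"
  have lc: "lact s w \<in> carrier W" if "w \<in> carrier W" for w
    using additive_map_closed[OF assms(1) that] .
  have f: "additive_map (pairs lact) (pairs lact) ?f"
  proof (rule additive_mapI)
    fix u assume u: "u \<in> carrier (pairs lact)"
    have "Poly_Mapping.keys (frag_extend (\<lambda>(w, x). frag_of (lact s w, x)) u)
        \<subseteq> (\<Union>t\<in>Poly_Mapping.keys u. Poly_Mapping.keys (case t of (w, x) \<Rightarrow> frag_of (lact s w, x)))"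
      by (rule keys_frag_extend)
    also have "\<dots> \<subseteq> carrier W \<times> carrier N"
      using u lc by auto
    finally show "?f u \<in> carrier (pairs lact)" by simp
  qed (simp add: frag_extend_add)
  have "?f z \<in> tensor_relators W ract R N" if z: "z \<in> tensor_relators W ract R N" for z
  proof -
    consider (left) w w' x where "z = frag_of (w \<oplus>\<^bsub>W\<^esub> w', x) - frag_of (w, x) - frag_of (w', x)"
        "w \<in> carrier W" "w' \<in> carrier W" "x \<in> carrier N"
      | (right) w x x' where "z = frag_of (w, x \<oplus>\<^bsub>N\<^esub> x') - frag_of (w, x) - frag_of (w, x')"
        "w \<in> carrier W" "x \<in> carrier N" "x' \<in> carrier N"
      | (bal) w r x where "z = frag_of (ract w r, x) - frag_of (w, r \<odot>\<^bsub>N\<^esub> x)"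
        "w \<in> carrier W" "r \<in> carrier R" "x \<in> carrier N"
      using z unfolding tensor_relators_def by blast
    then show ?thesis
    proof cases
      case left
      then have "?f z = frag_of (lact s w \<oplus>\<^bsub>W\<^esub> lact s w', x) - frag_of (lact s w, x) - frag_of (lact s w', x)"
        by (simp add: frag_extend_diff additive_map_add[OF assms(1)])
      then show ?thesis
        unfolding tensor_relators_def using left lc by blast
    next
      case right
      then have "?f z = frag_of (lact s w, x \<oplus>\<^bsub>N\<^esub> x') - frag_of (lact s w, x) - frag_of (lact s w, x')"
        by (simp add: frag_extend_diff)
      then show ?thesis
        unfolding tensor_relators_def using right lc by blast
    next
      case bal
      then have "?f z = frag_of (ract (lact s w) r, x) - frag_of (lact s w, r \<odot>\<^bsub>N\<^esub> x)"
        by (simp add: frag_extend_diff assms(2))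
      then show ?thesis
        unfolding tensor_relators_def using bal lc by blast
    qed
  qed
  then have "?f ` tensor_relators W ract R N \<subseteq> null"
    unfolding tensor_null_def by (intro image_subsetI generate.incl) blast
  then have n: "?f ` null \<subseteq> null"
    by (rule null_image[OF f abelian_group_free_pairs additive_subgroup_null])
  note quot = abelian_group_free_pairs additive_subgroup_null abelian_group_free_pairs additive_subgroup_null f n
  show "additive_map (product lact) (product lact) (\<lambda>z. s \<odot>\<^bsub>product lact\<^esub> z)"
    using quot_map_additive[OF quot] by (simp add: tensor_def)
  show "s \<odot>\<^bsub>product lact\<^esub> pure w x = pure (lact s w) x" if "w \<in> carrier W" "x \<in> carrier N"
    using quot_map_coset[OF quot, of "frag_of (w, x)"] that by (simp add: tensor_def pure_coset[of _ _ lact])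
qed

end

text \<open>Keeps the form degree \<open>1\<close> from being rewritten to \<open>Suc 0\<close>.\<close>

declare One_nat_def [simp del]

section \<open>Forms with values in a module\<close>

text \<open>Meant for \<open>f\<close> vanishing on the subgroup: then \<open>f\<close> is constant
  on each coset, the image of a coset is a singleton, and \<open>the_elem\<close> reads off its
  value. Unlike \<open>quot_map\<close>, the target is not a quotient.\<close>

definition quot_lift :: "('m \<Rightarrow> 'n) \<Rightarrow> 'm set \<Rightarrow> 'n" where
  "quot_lift f X = the_elem (f ` X)"

context
  fixes H and M :: "('r, 'm, 'y) module_scheme" and N :: "('n, 'z) ring_scheme" and f
  assumes M: "abelian_group M" and H: "additive_subgroup H M" and N: "abelian_group N"
    and f: "additive_map M N f" and zero: "\<And>x. x \<in> H \<Longrightarrow> f x = \<zero>\<^bsub>N\<^esub>"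
begin

lemma quot_lift_coset:
  assumes "x \<in> carrier M"
  shows "quot_lift f (H +>\<^bsub>M\<^esub> x) = f x"
proof -
  interpret N: abelian_group N by (rule N)
  interpret abelian_subgroup H M by (intro abelian_subgroupI3 M H)
  have "f (h \<oplus>\<^bsub>M\<^esub> x) = f x" if "h \<in> H" for h
    using that assms additive_map_add[OF f, of h x] zero additive_map_closed[OF f assms] a_subset by auto
  then have "f y = f x" if "y \<in> H +>\<^bsub>M\<^esub> x" for y
    using that by (auto simp: a_r_coset_def')
  moreover have "H +>\<^bsub>M\<^esub> x \<noteq> {}"
    using a_rcos_self[OF assms] by blast
  ultimately have "f ` (H +>\<^bsub>M\<^esub> x) = {f x}" by auto
  then show ?thesis by (simp add: quot_lift_def)
qed

lemma quot_lift_additive: "additive_map (quot_module M H) N (quot_lift f)"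
proof (rule additive_mapI)
  interpret abelian_subgroup H M by (intro abelian_subgroupI3 M H)
  fix X assume "X \<in> carrier (quot_module M H)"
  then obtain x where x: "x \<in> carrier M" "X = H +>\<^bsub>M\<^esub> x" by (rule quot_moduleE[OF M H])
  then show "quot_lift f X \<in> carrier N"
    using additive_map_closed[OF f] by (simp add: quot_lift_coset)
  fix Y assume "Y \<in> carrier (quot_module M H)"
  then obtain y where y: "y \<in> carrier M" "Y = H +>\<^bsub>M\<^esub> y" by (rule quot_moduleE[OF M H])
  show "quot_lift f (X \<oplus>\<^bsub>quot_module M H\<^esub> Y) = quot_lift f X \<oplus>\<^bsub>N\<^esub> quot_lift f Y"
    using x y by (simp add: quot_lift_coset a_rcos_sum additive_map_add[OF f])
qed

end

text \<open>The form used for every map defined through \<open>map_on_generators\<close>: on the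
  carrier it coincides with the witness \<open>\<phi>\<close>, from which additivity and values are
  inherited.\<close>

lemma
  assumes "generated_by I M g" "additive_map M N \<phi>" "abelian_group M" "abelian_group N"
    and "\<And>t. t \<in> I \<Longrightarrow> \<phi> (g t) = h t"
  shows map_on_generators_additive': "additive_map M N (map_on_generators I M N g h)"
    and map_on_generators_value': "t \<in> I \<Longrightarrow> map_on_generators I M N g h (g t) = h t"
proof -
  interpret M: abelian_group M by fact
  have eq: "map_on_generators I M N g h x = \<phi> x" if "x \<in> carrier M" for x
    by (rule map_on_generators_unique[OF assms(1-4) _ that]) (rule assms(5))
  show "additive_map M N (map_on_generators I M N g h)"
    using assms(2) by (auto intro!: additive_mapI simp: eq additive_map_closed additive_map_add)
  show "map_on_generators I M N g h (g t) = h t" if "t \<in> I"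
    using eq[OF generated_by_closed[OF assms(1) that]] assms(5)[OF that] by simp
qed

lemma form_module_sel [simp]:
  "carrier (form_module \<Omega> k) = forms \<Omega> k" "add (form_module \<Omega> k) = add \<Omega>"
  "ring.zero (form_module \<Omega> k) = ring.zero \<Omega>" "monoid.mult (form_module \<Omega> k) = monoid.mult \<Omega>"
  by (simp_all add: form_module_def)

lemma scalar_module_sel [simp]:
  "carrier (scalar_module A M) = carrier M" "add (scalar_module A M) = add M"
  "ring.zero (scalar_module A M) = ring.zero M"
  "c \<odot>\<^bsub>scalar_module A M\<^esub> x = (c \<odot>\<^bsub>A\<^esub> \<one>\<^bsub>A\<^esub>) \<odot>\<^bsub>M\<^esub> x"
  by (simp_all add: scalar_module_def restrict_scalars_def)

lemma abelian_group_cong: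
  assumes "abelian_group M" "carrier N = carrier M" "add N = add M" "ring.zero N = ring.zero M"
  shows "abelian_group N"
proof -
  interpret abelian_group M by fact
  show ?thesis
    using assms(2-4) by (intro abelian_groupI) (auto simp: a_ac intro: add.l_inv_ex)
qed

context exterior_algebra
begin

abbreviation "J1 \<equiv> jet1 K A \<Omega>"
abbreviation "J1_class \<equiv> jet1_class K A \<Omega>"
abbreviation "FT \<equiv> form_tensor A \<Omega>"
abbreviation "FP \<equiv> form_pure A \<Omega>"
abbreviation "BT \<equiv> base_tensor K A"
abbreviation "BP \<equiv> base_pure K A"

section \<open>Degrees and Leibniz rules in the calculus\<close>

lemma forms_closed: "x \<in> forms \<Omega> k \<Longrightarrow> x \<in> carrier \<Omega>"
  using forms_submodule[of k] subgroup.subset[of "forms \<Omega> k" "add_monoid \<Omega>"] by (auto simp: submodule_def)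

lemma abelian_group_form_module: "abelian_group (form_module \<Omega> k)"
proof (rule abelian_groupI)
  have sub: "subgroup (forms \<Omega> k) (add_monoid \<Omega>)"
    using forms_submodule[of k] by (simp add: submodule_def)
  show "\<zero>\<^bsub>form_module \<Omega> k\<^esub> \<in> carrier (form_module \<Omega> k)"
    using subgroup.one_closed[OF sub] by simp
  fix x assume x: "x \<in> carrier (form_module \<Omega> k)"
  show "\<zero>\<^bsub>form_module \<Omega> k\<^esub> \<oplus>\<^bsub>form_module \<Omega> k\<^esub> x = x"
    using x by (simp add: forms_closed)
  show "\<exists>y\<in>carrier (form_module \<Omega> k). y \<oplus>\<^bsub>form_module \<Omega> k\<^esub> x = \<zero>\<^bsub>form_module \<Omega> k\<^esub>"
    using x subgroup.m_inv_closed[OF sub, of x]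
    by (intro bexI[of _ "\<ominus>\<^bsub>\<Omega>\<^esub> x"]) (simp_all add: forms_closed Om.l_neg a_inv_def)
  fix y assume y: "y \<in> carrier (form_module \<Omega> k)"
  show "x \<oplus>\<^bsub>form_module \<Omega> k\<^esub> y \<in> carrier (form_module \<Omega> k)"
    using x y subgroup.m_closed[OF sub, of x y] by simp
  show "x \<oplus>\<^bsub>form_module \<Omega> k\<^esub> y = y \<oplus>\<^bsub>form_module \<Omega> k\<^esub> x"
    using x y by (simp add: forms_closed Om.a_comm)
  fix z assume z: "z \<in> carrier (form_module \<Omega> k)"
  show "x \<oplus>\<^bsub>form_module \<Omega> k\<^esub> y \<oplus>\<^bsub>form_module \<Omega> k\<^esub> z = x \<oplus>\<^bsub>form_module \<Omega> k\<^esub> (y \<oplus>\<^bsub>form_module \<Omega> k\<^esub> z)"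
    using x y z by (simp add: forms_closed Om.a_assoc)
qed

lemma ring_A: "ring A" by (rule A.ring_axioms)

lemma A_forms: "a \<in> carrier A \<Longrightarrow> a \<in> forms \<Omega> 0" by (simp add: carrier_A)

lemma A_closed: "a \<in> carrier A \<Longrightarrow> a \<in> carrier \<Omega>" by (simp add: carrier_A forms_closed)

lemma one_closed_A: "\<one>\<^bsub>\<Omega>\<^esub> \<in> carrier A"
  using A.one_closed by (simp add: one_A)

lemma d_A: "a \<in> carrier A \<Longrightarrow> ext_d \<Omega> a \<in> forms \<Omega> 1"
  using d_degree[of a 0] by (simp add: carrier_A One_nat_def)

lemma d_form1: "w \<in> forms \<Omega> 1 \<Longrightarrow> ext_d \<Omega> w \<in> forms \<Omega> 2"
  using d_degree[of w 1] by (simp add: numeral_2_eq_2 One_nat_def)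

lemma d_closed: "x \<in> carrier \<Omega> \<Longrightarrow> ext_d \<Omega> x \<in> carrier \<Omega>"
  using d_linear by (rule linear_map_closed)

lemma d_add: "\<lbrakk>x \<in> carrier \<Omega>; y \<in> carrier \<Omega>\<rbrakk> \<Longrightarrow> ext_d \<Omega> (x \<oplus>\<^bsub>\<Omega>\<^esub> y) = ext_d \<Omega> x \<oplus>\<^bsub>\<Omega>\<^esub> ext_d \<Omega> y"
  using additive_map_add[OF linear_map_additive[OF d_linear]] .

lemma d_mult_A:
  assumes "a \<in> carrier A" "y \<in> carrier \<Omega>"
  shows "ext_d \<Omega> (a \<otimes>\<^bsub>\<Omega>\<^esub> y) = ext_d \<Omega> a \<otimes>\<^bsub>\<Omega>\<^esub> y \<oplus>\<^bsub>\<Omega>\<^esub> a \<otimes>\<^bsub>\<Omega>\<^esub> ext_d \<Omega> y"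
  using leibniz[OF A_forms[OF assms(1)] assms(2)] assms A_closed d_closed by simp

lemma d_mult_form1:
  assumes "w \<in> forms \<Omega> 1" "y \<in> carrier \<Omega>"
  shows "ext_d \<Omega> (w \<otimes>\<^bsub>\<Omega>\<^esub> y) = ext_d \<Omega> w \<otimes>\<^bsub>\<Omega>\<^esub> y \<ominus>\<^bsub>\<Omega>\<^esub> w \<otimes>\<^bsub>\<Omega>\<^esub> ext_d \<Omega> y"
  using leibniz[OF assms] assms forms_closed d_closed
  by (simp add: Om.minus_eq Om.l_minus)

text \<open>The Leibniz rule for the product of the unit with itself gives
  \<open>d 1 = d 1 + d 1\<close>. This is what makes both obstructions vanish on
  prolongations.\<close>

lemma d_one: "ext_d \<Omega> \<one>\<^bsub>A\<^esub> = \<zero>\<^bsub>\<Omega>\<^esub>"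
proof -
  have d: "ext_d \<Omega> \<one>\<^bsub>A\<^esub> \<in> carrier \<Omega>" using d_closed A_closed by simp
  have "ext_d \<Omega> \<one>\<^bsub>A\<^esub> = ext_d \<Omega> \<one>\<^bsub>A\<^esub> \<oplus>\<^bsub>\<Omega>\<^esub> ext_d \<Omega> \<one>\<^bsub>A\<^esub>"
    using d_mult_A[of "\<one>\<^bsub>A\<^esub>" "\<one>\<^bsub>A\<^esub>"] A_closed d one_closed_A by (simp add: one_A)
  then show ?thesis using d by simp
qed

lemma wedge_form:
  "\<lbrakk>w \<in> forms \<Omega> j; v \<in> forms \<Omega> k; l = j + k\<rbrakk> \<Longrightarrow> w \<otimes>\<^bsub>\<Omega>\<^esub> v \<in> forms \<Omega> l"
  by (simp add: wedge_closed)

lemma form_act: "\<lbrakk>w \<in> forms \<Omega> k; a \<in> carrier A\<rbrakk> \<Longrightarrow> w \<otimes>\<^bsub>\<Omega>\<^esub> a \<in> forms \<Omega> k"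
  using wedge_closed[of w k a 0] by (simp add: carrier_A)

lemma act_form: "\<lbrakk>w \<in> forms \<Omega> k; a \<in> carrier A\<rbrakk> \<Longrightarrow> a \<otimes>\<^bsub>\<Omega>\<^esub> w \<in> forms \<Omega> k"
  using wedge_closed[of a 0 w k] by (simp add: carrier_A)

lemma scalar_one_closed: "c \<in> carrier K \<Longrightarrow> c \<odot>\<^bsub>A\<^esub> \<one>\<^bsub>A\<^esub> \<in> carrier A"
  by simp

lemma mult_scalar_one:
  assumes "c \<in> carrier K" "x \<in> carrier \<Omega>"
  shows "x \<otimes>\<^bsub>\<Omega>\<^esub> (c \<odot>\<^bsub>A\<^esub> \<one>\<^bsub>A\<^esub>) = c \<odot>\<^bsub>\<Omega>\<^esub> x"
  using assms Om.smult_mult_r[of c x "\<one>\<^bsub>\<Omega>\<^esub>"] smult_A[of c "\<one>\<^bsub>A\<^esub>"] one_closed_A by (simp add: one_A)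

section \<open>Tensor products of forms with a module\<close>

lemma form_balanced_pair:
  assumes "left_module A M"
  shows "balanced_pair (form_module \<Omega> k) (monoid.mult \<Omega>) A M"
  using assms abelian_group_form_module
  by (auto intro!: balanced_pair.intro balanced_pair_axioms.intro form_act
      simp: left_module.smult_closed left_module_abelian_group)

lemma abelian_group_scalar_module: "left_module A M \<Longrightarrow> abelian_group (scalar_module A M)"
  by (rule abelian_group_cong[OF left_module_abelian_group]) simp_all

lemma base_balanced_pair:
  assumes "left_module A M"
  shows "balanced_pair A (\<lambda>b c. c \<odot>\<^bsub>A\<^esub> b) K (scalar_module A M)"
  using assms abelian_group_scalar_module[OF assms]
  by (auto intro!: balanced_pair.intro balanced_pair_axioms.intro
      simp: left_module.smult_closed A.abelian_group_axioms)

lemma abelian_group_form_tensor: "left_module A M \<Longrightarrow> abelian_group (FT k M)"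
  unfolding form_tensor_def by (rule balanced_pair.abelian_group_product[OF form_balanced_pair])

lemma generated_by_form_pure:
  "left_module A M \<Longrightarrow>
    generated_by (forms \<Omega> k \<times> carrier M) (FT k M) (\<lambda>(w, x). FP k M w x)"
  using balanced_pair.generated_by_pure[OF form_balanced_pair, of M k]
  by (simp add: form_tensor_def form_pure_def)

lemma form_pure_closed:
  "\<lbrakk>left_module A M; w \<in> forms \<Omega> k; x \<in> carrier M\<rbrakk> \<Longrightarrow> FP k M w x \<in> carrier (FT k M)"
  using balanced_pair.pure_closed[OF form_balanced_pair, of M w k x]
  by (simp add: form_tensor_def form_pure_def)

lemma form_pure_additive_left:
  "\<lbrakk>left_module A M; x \<in> carrier M\<rbrakk>
    \<Longrightarrow> additive_map (form_module \<Omega> k) (FT k M) (\<lambda>w. FP k M w x)"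
  using balanced_pair.pure_add_left[OF form_balanced_pair, of M _ k _ x] form_pure_closed
  by (intro additive_mapI) (simp_all add: form_tensor_def form_pure_def)

lemma form_pure_additive_right:
  "\<lbrakk>left_module A M; w \<in> forms \<Omega> k\<rbrakk>
    \<Longrightarrow> additive_map M (FT k M) (\<lambda>x. FP k M w x)"
  using balanced_pair.pure_add_right[OF form_balanced_pair, of M w k] form_pure_closed
  by (intro additive_mapI) (simp_all add: form_tensor_def form_pure_def)

lemma form_pure_balanced:
  "\<lbrakk>left_module A M; w \<in> forms \<Omega> k; a \<in> carrier A; x \<in> carrier M\<rbrakk>
    \<Longrightarrow> FP k M (w \<otimes>\<^bsub>\<Omega>\<^esub> a) x = FP k M w (a \<odot>\<^bsub>M\<^esub> x)"
  using balanced_pair.pure_balanced[OF form_balanced_pair, of M w k a x]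
  by (simp add: form_pure_def)

lemma form_pure_zero:
  assumes "left_module A M" "x \<in> carrier M"
  shows "FP k M \<zero>\<^bsub>\<Omega>\<^esub> x = \<zero>\<^bsub>FT k M\<^esub>"
  using additive_map_zero[OF form_pure_additive_left[OF assms, of k] abelian_group_form_module
      abelian_group_form_tensor[OF assms(1)]] by simp

lemma form_tensor_lift:
  fixes Q :: "('q, 'u) ring_scheme"
  assumes M: "left_module A M" and Q: "abelian_group Q"
    and "\<And>x. x \<in> carrier M \<Longrightarrow> additive_map (form_module \<Omega> k) Q (\<lambda>w. \<beta> w x)"
    and "\<And>w. w \<in> forms \<Omega> k \<Longrightarrow> additive_map M Q (\<beta> w)"
    and "\<And>w a x. \<lbrakk>w \<in> forms \<Omega> k; a \<in> carrier A; x \<in> carrier M\<rbrakk> \<Longrightarrow> \<beta> (w \<otimes>\<^bsub>\<Omega>\<^esub> a) x = \<beta> w (a \<odot>\<^bsub>M\<^esub> x)"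
  obtains \<phi> where "additive_map (FT k M) Q \<phi>"
    "\<And>w x. \<lbrakk>w \<in> forms \<Omega> k; x \<in> carrier M\<rbrakk> \<Longrightarrow> \<phi> (FP k M w x) = \<beta> w x"
proof -
  interpret balanced_pair "form_module \<Omega> k" "monoid.mult \<Omega>" A M by (rule form_balanced_pair[OF M])
  show ?thesis
    by (rule tensor_lift[of Q \<beta> "monoid.mult \<Omega>"])
      (use assms that in \<open>auto simp: form_tensor_def form_pure_def\<close>)
qed

text \<open>Left wedge multiplication by \<open>w\<close> on the form factor; for \<open>w\<close>
  in \<open>A\<close> it is the left module action. The target degree \<open>l\<close> is a separate
  argument, so that equations such as \<open>2 = 1 + 1\<close> enter as hypotheses and terms need no
  rewriting of degrees.\<close>

definition wedge_tensor ::
  "nat \<Rightarrow> nat \<Rightarrow> ('a, 'm) module \<Rightarrow> 'a \<Rightarrow> (('a \<times> 'm) \<Rightarrow>\<^sub>0 int) set \<Rightarrow> (('a \<times> 'm) \<Rightarrow>\<^sub>0 int) set" where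
  "wedge_tensor k l M w = map_on_generators (forms \<Omega> k \<times> carrier M)
     (FT k M) (FT l M)
     (\<lambda>(v, x). FP k M v x) (\<lambda>(v, x). FP l M (w \<otimes>\<^bsub>\<Omega>\<^esub> v) x)"

text \<open>Left multiplication by \<open>w\<close> commutes with the right action of
  \<open>A\<close> by associativity of the wedge product, hence respects the balance of the tensor
  product.\<close>

lemma
  assumes M: "left_module A M" and w: "w \<in> forms \<Omega> j" and l: "l = j + k"
  shows wedge_tensor_additive:
      "additive_map (FT k M) (FT l M) (wedge_tensor k l M w)"
    and wedge_tensor_pure: "\<lbrakk>v \<in> forms \<Omega> k; x \<in> carrier M\<rbrakk>
      \<Longrightarrow> wedge_tensor k l M w (FP k M v x) = FP l M (w \<otimes>\<^bsub>\<Omega>\<^esub> v) x"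
proof -
  note cl = wedge_form[OF w _ l] and wc = forms_closed[OF w]
  have "additive_map (form_module \<Omega> k) (form_module \<Omega> l) (\<lambda>v. w \<otimes>\<^bsub>\<Omega>\<^esub> v)"
    by (rule additive_mapI) (use wc in \<open>auto intro: cl simp: forms_closed Om.r_distr\<close>)
  note left = additive_map_comp[OF this form_pure_additive_left[OF M]]
  obtain \<phi> where \<phi>: "additive_map (FT k M) (FT l M) \<phi>"
    "\<And>v x. \<lbrakk>v \<in> forms \<Omega> k; x \<in> carrier M\<rbrakk> \<Longrightarrow> \<phi> (FP k M v x) = FP l M (w \<otimes>\<^bsub>\<Omega>\<^esub> v) x"
  proof (rule form_tensor_lift[OF M abelian_group_form_tensor[OF M]])
    show "additive_map (form_module \<Omega> k) (FT l M) (\<lambda>v. FP l M (w \<otimes>\<^bsub>\<Omega>\<^esub> v) x)"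
      if "x \<in> carrier M" for x
      using left[OF that] .
    show "additive_map M (FT l M) (\<lambda>x. FP l M (w \<otimes>\<^bsub>\<Omega>\<^esub> v) x)"
      if "v \<in> forms \<Omega> k" for v
      by (rule form_pure_additive_right[OF M cl[OF that]])
    show "FP l M (w \<otimes>\<^bsub>\<Omega>\<^esub> (v \<otimes>\<^bsub>\<Omega>\<^esub> a)) x = FP l M (w \<otimes>\<^bsub>\<Omega>\<^esub> v) (a \<odot>\<^bsub>M\<^esub> x)"
      if "v \<in> forms \<Omega> k" "a \<in> carrier A" "x \<in> carrier M" for v a x
      using form_pure_balanced[OF M cl[OF that(1)] that(2,3)] that wc
      by (simp add: Om.m_assoc forms_closed A_closed)
  qed blast
  have v: "\<phi> ((\<lambda>(v, x). FP k M v x) t) = (\<lambda>(v, x). FP l M (w \<otimes>\<^bsub>\<Omega>\<^esub> v) x) t"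
    if "t \<in> forms \<Omega> k \<times> carrier M" for t
    using that \<phi>(2) by auto
  note gen = generated_by_form_pure[OF M] \<phi>(1) abelian_group_form_tensor[OF M]
    abelian_group_form_tensor[OF M] v
  show "additive_map (FT k M) (FT l M) (wedge_tensor k l M w)"
    unfolding wedge_tensor_def by (rule map_on_generators_additive'[OF gen])
  show "wedge_tensor k l M w (FP k M v x) = FP l M (w \<otimes>\<^bsub>\<Omega>\<^esub> v) x"
    if "v \<in> forms \<Omega> k" "x \<in> carrier M"
    using map_on_generators_value'[OF gen, where t = "(v, x)"] that by (simp add: wedge_tensor_def)
qed

lemma wedge_tensor_closed:
  "\<lbrakk>left_module A M; w \<in> forms \<Omega> j; l = j + k; z \<in> carrier (FT k M)\<rbrakk>
    \<Longrightarrow> wedge_tensor k l M w z \<in> carrier (FT l M)"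
  using wedge_tensor_additive additive_map_closed by metis

lemma wedge_tensor_zero:
  "\<lbrakk>left_module A M; w \<in> forms \<Omega> j; l = j + k\<rbrakk>
    \<Longrightarrow> wedge_tensor k l M w \<zero>\<^bsub>FT k M\<^esub> = \<zero>\<^bsub>FT l M\<^esub>"
  by (intro additive_map_zero[OF wedge_tensor_additive] abelian_group_form_tensor)

lemma wedge_tensor_add:
  assumes M: "left_module A M" and w: "w \<in> forms \<Omega> j" "w' \<in> forms \<Omega> j" and l: "l = j + k"
    and z: "z \<in> carrier (FT k M)"
  shows "wedge_tensor k l M (w \<oplus>\<^bsub>\<Omega>\<^esub> w') z =
    wedge_tensor k l M w z \<oplus>\<^bsub>FT l M\<^esub> wedge_tensor k l M w' z"
proof -
  interpret F: abelian_group "form_module \<Omega> j" by (rule abelian_group_form_module)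
  have s: "w \<oplus>\<^bsub>\<Omega>\<^esub> w' \<in> forms \<Omega> j" using F.a_closed[of w w'] w by simp
  show ?thesis
  proof (rule additive_map_eqI[OF generated_by_form_pure[OF M] wedge_tensor_additive[OF M s l]
        additive_map_sum[OF wedge_tensor_additive[OF M w(1) l] wedge_tensor_additive[OF M w(2) l]
          abelian_group_form_tensor[OF M]]
        abelian_group_form_tensor[OF M] abelian_group_form_tensor[OF M] _ z])
    fix t assume "t \<in> forms \<Omega> k \<times> carrier M"
    then obtain v x where t: "t = (v, x)" "v \<in> forms \<Omega> k" "x \<in> carrier M" by auto
    have "w \<otimes>\<^bsub>\<Omega>\<^esub> v \<in> forms \<Omega> l" "w' \<otimes>\<^bsub>\<Omega>\<^esub> v \<in> forms \<Omega> l"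
      using w t l by (auto intro: wedge_form)
    then show "wedge_tensor k l M (w \<oplus>\<^bsub>\<Omega>\<^esub> w') ((\<lambda>(v, x). FP k M v x) t) =
        wedge_tensor k l M w ((\<lambda>(v, x). FP k M v x) t) \<oplus>\<^bsub>FT l M\<^esub>
        wedge_tensor k l M w' ((\<lambda>(v, x). FP k M v x) t)"
      using t w additive_map_add[OF form_pure_additive_left[OF M t(3), of l], of "w \<otimes>\<^bsub>\<Omega>\<^esub> v" "w' \<otimes>\<^bsub>\<Omega>\<^esub> v"]
      by (simp add: wedge_tensor_pure[OF M _ l] s Om.l_distr forms_closed)
  qed
qed

lemma wedge_tensor_assoc:
  assumes M: "left_module A M" and w: "w \<in> forms \<Omega> j" and a: "a \<in> carrier A" and l: "l = j + k"
    and z: "z \<in> carrier (FT k M)"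
  shows "wedge_tensor k l M (w \<otimes>\<^bsub>\<Omega>\<^esub> a) z = wedge_tensor k l M w (wedge_tensor k k M a z)"
proof -
  note wa = form_act[OF w a]
  have kk: "k = 0 + k" by simp
  show ?thesis
  proof (rule additive_map_eqI[OF generated_by_form_pure[OF M] wedge_tensor_additive[OF M wa l]
        additive_map_comp[OF wedge_tensor_additive[OF M A_forms[OF a] kk] wedge_tensor_additive[OF M w l]]
        abelian_group_form_tensor[OF M] abelian_group_form_tensor[OF M] _ z])
    fix t assume "t \<in> forms \<Omega> k \<times> carrier M"
    then obtain v x where t: "t = (v, x)" "v \<in> forms \<Omega> k" "x \<in> carrier M" by auto
    show "wedge_tensor k l M (w \<otimes>\<^bsub>\<Omega>\<^esub> a) ((\<lambda>(v, x). FP k M v x) t) =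
        wedge_tensor k l M w (wedge_tensor k k M a ((\<lambda>(v, x). FP k M v x) t))"
      using t a w by (simp add: wedge_tensor_pure[OF M _ l] wedge_tensor_pure[OF M _ kk] wa A_forms
          act_form Om.m_assoc forms_closed A_closed)
  qed
qed

end

section \<open>First jets\<close>

context exterior_algebra
begin

lemma base_tensor_smult:
  assumes M: "left_module A M" and a: "a \<in> carrier A"
  shows "additive_map (BT M) (BT M) (\<lambda>z. a \<odot>\<^bsub>BT M\<^esub> z)"
    and "\<lbrakk>b \<in> carrier A; x \<in> carrier M\<rbrakk>
      \<Longrightarrow> a \<odot>\<^bsub>BT M\<^esub> BP M b x = BP M (a \<otimes>\<^bsub>A\<^esub> b) x"
proof -
  interpret balanced_pair A "\<lambda>b c. c \<odot>\<^bsub>A\<^esub> b" K "scalar_module A M" by (rule base_balanced_pair[OF M])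
  have 1: "additive_map A A (monoid.mult A a)"
    using a by (intro additive_mapI) (auto simp: A.r_distr)
  have 2: "a \<otimes>\<^bsub>A\<^esub> (c \<odot>\<^bsub>A\<^esub> b) = c \<odot>\<^bsub>A\<^esub> (a \<otimes>\<^bsub>A\<^esub> b)" if "b \<in> carrier A" "c \<in> carrier K" for b c
    using that a by (simp add: A.smult_mult_r)
  show "additive_map (BT M) (BT M) (\<lambda>z. a \<odot>\<^bsub>BT M\<^esub> z)"
    unfolding base_tensor_def by (rule tensor_smult_additive[where lact = "monoid.mult A" and s = a, OF 1 2])
  show "a \<odot>\<^bsub>BT M\<^esub> BP M b x = BP M (a \<otimes>\<^bsub>A\<^esub> b) x"
    if "b \<in> carrier A" "x \<in> carrier M"
    using tensor_smult_pure[where lact = "monoid.mult A" and s = a, OF 1 2, of b x] that by (simp add: base_tensor_def base_pure_def)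
qed

lemma abelian_group_base_tensor: "left_module A M \<Longrightarrow> abelian_group (BT M)"
  unfolding base_tensor_def by (rule balanced_pair.abelian_group_product[OF base_balanced_pair])

lemma generated_by_base_pure:
  "left_module A M \<Longrightarrow>
    generated_by (carrier A \<times> carrier M) (BT M) (\<lambda>(a, x). BP M a x)"
  using balanced_pair.generated_by_pure[OF base_balanced_pair, of M]
  by (simp add: base_tensor_def base_pure_def)

lemma base_pure_closed:
  "\<lbrakk>left_module A M; a \<in> carrier A; x \<in> carrier M\<rbrakk> \<Longrightarrow> BP M a x \<in> carrier (BT M)"
  using balanced_pair.pure_closed[OF base_balanced_pair, of M a x]
  by (simp add: base_tensor_def base_pure_def)

lemma base_pure_add_left:
  "\<lbrakk>left_module A M; a \<in> carrier A; b \<in> carrier A; x \<in> carrier M\<rbrakk>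
    \<Longrightarrow> BP M (a \<oplus>\<^bsub>A\<^esub> b) x = BP M a x \<oplus>\<^bsub>BT M\<^esub> BP M b x"
  using balanced_pair.pure_add_left[OF base_balanced_pair, of M a b x]
  by (simp add: base_tensor_def base_pure_def)

lemma base_pure_add_right:
  "\<lbrakk>left_module A M; a \<in> carrier A; x \<in> carrier M; y \<in> carrier M\<rbrakk>
    \<Longrightarrow> BP M a (x \<oplus>\<^bsub>M\<^esub> y) = BP M a x \<oplus>\<^bsub>BT M\<^esub> BP M a y"
  using balanced_pair.pure_add_right[OF base_balanced_pair, of M a x y]
  by (simp add: base_tensor_def base_pure_def)

definition eval_tensor :: "('a, 'm) module \<Rightarrow> (('a \<times> 'm) \<Rightarrow>\<^sub>0 int) set \<Rightarrow> 'm" where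
  "eval_tensor M = map_on_generators (carrier A \<times> carrier M) (BT M) M
     (\<lambda>(a, x). BP M a x) (\<lambda>(a, x). a \<odot>\<^bsub>M\<^esub> x)"

definition d_tensor :: "('a, 'm) module \<Rightarrow> (('a \<times> 'm) \<Rightarrow>\<^sub>0 int) set \<Rightarrow> (('a \<times> 'm) \<Rightarrow>\<^sub>0 int) set" where
  "d_tensor M = map_on_generators (carrier A \<times> carrier M) (BT M) (FT 1 M)
     (\<lambda>(a, x). BP M a x) (\<lambda>(a, x). FP 1 M (ext_d \<Omega> a) x)"

lemma base_tensor_lift:
  fixes Q :: "('q, 'u) ring_scheme"
  assumes M: "left_module A M" and Q: "abelian_group Q"
    and "\<And>x. x \<in> carrier M \<Longrightarrow> additive_map A Q (\<lambda>a. \<beta> a x)"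
    and "\<And>a. a \<in> carrier A \<Longrightarrow> additive_map M Q (\<beta> a)"
    and "\<And>a c x. \<lbrakk>a \<in> carrier A; c \<in> carrier K; x \<in> carrier M\<rbrakk>
      \<Longrightarrow> \<beta> (c \<odot>\<^bsub>A\<^esub> a) x = \<beta> a ((c \<odot>\<^bsub>A\<^esub> \<one>\<^bsub>A\<^esub>) \<odot>\<^bsub>M\<^esub> x)"
  shows "additive_map (BT M) Q (map_on_generators (carrier A \<times> carrier M)
      (BT M) Q (\<lambda>(a, x). BP M a x) (\<lambda>(a, x). \<beta> a x))"
    and "\<lbrakk>a \<in> carrier A; x \<in> carrier M\<rbrakk> \<Longrightarrow> map_on_generators (carrier A \<times> carrier M)
      (BT M) Q (\<lambda>(a, x). BP M a x) (\<lambda>(a, x). \<beta> a x) (BP M a x) = \<beta> a x"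
proof -
  interpret balanced_pair A "\<lambda>b c. c \<odot>\<^bsub>A\<^esub> b" K "scalar_module A M" by (rule base_balanced_pair[OF M])
  obtain \<phi> where \<phi>: "additive_map (BT M) Q \<phi>"
    "\<And>a x. \<lbrakk>a \<in> carrier A; x \<in> carrier M\<rbrakk> \<Longrightarrow> \<phi> (BP M a x) = \<beta> a x"
  proof (rule tensor_lift[of Q \<beta> "monoid.mult A"])
    show "additive_map (scalar_module A M) Q (\<beta> a)" if "a \<in> carrier A" for a
      using assms(4)[OF that] by (simp add: additive_map_def)
  qed (use assms in \<open>auto simp: base_tensor_def base_pure_def\<close>)
  have v: "\<phi> ((\<lambda>(a, x). BP M a x) t) = (\<lambda>(a, x). \<beta> a x) t"
    if "t \<in> carrier A \<times> carrier M" for t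
    using that \<phi>(2) by auto
  note gen = generated_by_base_pure[OF M] \<phi>(1) abelian_group_base_tensor[OF M] Q v
  show "additive_map (BT M) Q (map_on_generators (carrier A \<times> carrier M)
      (BT M) Q (\<lambda>(a, x). BP M a x) (\<lambda>(a, x). \<beta> a x))"
    by (rule map_on_generators_additive'[OF gen])
  show "map_on_generators (carrier A \<times> carrier M)
      (BT M) Q (\<lambda>(a, x). BP M a x) (\<lambda>(a, x). \<beta> a x) (BP M a x) = \<beta> a x"
    if "a \<in> carrier A" "x \<in> carrier M"
    using map_on_generators_value'[OF gen, where t = "(a, x)"] that by simp
qed

lemma
  assumes M: "left_module A M"
  shows eval_tensor_additive: "additive_map (BT M) M (eval_tensor M)"
    and eval_tensor_pure:
      "\<lbrakk>a \<in> carrier A; x \<in> carrier M\<rbrakk> \<Longrightarrow> eval_tensor M (BP M a x) = a \<odot>\<^bsub>M\<^esub> x"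
proof -
  interpret left_module A M by fact
  have 1: "additive_map A M (\<lambda>a. a \<odot>\<^bsub>M\<^esub> x)" if "x \<in> carrier M" for x
    using that by (intro additive_mapI) (auto simp: smult_closed smult_l_distr)
  have 2: "(c \<odot>\<^bsub>A\<^esub> a) \<odot>\<^bsub>M\<^esub> x = a \<odot>\<^bsub>M\<^esub> ((c \<odot>\<^bsub>A\<^esub> \<one>\<^bsub>A\<^esub>) \<odot>\<^bsub>M\<^esub> x)"
    if "a \<in> carrier A" "c \<in> carrier K" "x \<in> carrier M" for a c x
    using that smult_assoc[of a "c \<odot>\<^bsub>A\<^esub> \<one>\<^bsub>A\<^esub>" x] A.smult_mult_r[of c a "\<one>\<^bsub>A\<^esub>"] by simp
  note lift = base_tensor_lift[OF M M.abelian_group_axioms 1 left_module_smult_additive[OF M] 2]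
  show "additive_map (BT M) M (eval_tensor M)"
    unfolding eval_tensor_def by (rule lift(1))
  show "eval_tensor M (BP M a x) = a \<odot>\<^bsub>M\<^esub> x" if "a \<in> carrier A" "x \<in> carrier M"
    unfolding eval_tensor_def by (rule lift(2)[OF _ _ _ _ _ that])
qed

lemma d_additive: "additive_map A (form_module \<Omega> 1) (ext_d \<Omega>)"
  by (rule additive_mapI) (auto simp: d_A add_A A_closed d_add)

lemma
  assumes M: "left_module A M"
  shows d_tensor_additive: "additive_map (BT M) (FT 1 M) (d_tensor M)"
    and d_tensor_pure: "\<lbrakk>a \<in> carrier A; x \<in> carrier M\<rbrakk>
      \<Longrightarrow> d_tensor M (BP M a x) = FP 1 M (ext_d \<Omega> a) x"
proof -
  have 1: "additive_map A (FT 1 M) (\<lambda>a. FP 1 M (ext_d \<Omega> a) x)"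
    if "x \<in> carrier M" for x
    by (rule additive_map_comp[OF d_additive form_pure_additive_left[OF M that]])
  have 2: "additive_map M (FT 1 M) (FP 1 M (ext_d \<Omega> a))"
    if "a \<in> carrier A" for a
    by (rule form_pure_additive_right[OF M d_A[OF that]])
  \<comment> \<open>Balance over \<open>K\<close>: the differential commutes with scalars, and
    scaling a form by \<open>c\<close> is right multiplication by \<open>c 1\<close>, which lies in
    \<open>A\<close> and may cross the tensor sign.\<close>
  have 3: "FP 1 M (ext_d \<Omega> (c \<odot>\<^bsub>A\<^esub> a)) x =
      FP 1 M (ext_d \<Omega> a) ((c \<odot>\<^bsub>A\<^esub> \<one>\<^bsub>A\<^esub>) \<odot>\<^bsub>M\<^esub> x)"
    if "a \<in> carrier A" "c \<in> carrier K" "x \<in> carrier M" for a c x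
  proof -
    have "ext_d \<Omega> (c \<odot>\<^bsub>A\<^esub> a) = ext_d \<Omega> a \<otimes>\<^bsub>\<Omega>\<^esub> (c \<odot>\<^bsub>A\<^esub> \<one>\<^bsub>A\<^esub>)"
      using that linear_map_smult[OF d_linear, of c a]
      by (simp add: mult_scalar_one d_closed A_closed smult_A[of c a])
    then show ?thesis
      using form_pure_balanced[OF M d_A[OF that(1)] scalar_one_closed[OF that(2)] that(3)] by simp
  qed
  note lift = base_tensor_lift[OF M abelian_group_form_tensor[OF M] 1 2 3]
  show "additive_map (BT M) (FT 1 M) (d_tensor M)"
    unfolding d_tensor_def by (rule lift(1))
  show "d_tensor M (BP M a x) = FP 1 M (ext_d \<Omega> a) x"
    if "a \<in> carrier A" "x \<in> carrier M"
    unfolding d_tensor_def by (rule lift(2)[OF _ _ _ _ _ that])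
qed

lemma eval_tensor_smult:
  assumes M: "left_module A M" and a: "a \<in> carrier A" and z: "z \<in> carrier (BT M)"
  shows "eval_tensor M (a \<odot>\<^bsub>BT M\<^esub> z) = a \<odot>\<^bsub>M\<^esub> eval_tensor M z"
  by (rule additive_map_eqI[OF generated_by_base_pure[OF M]
        additive_map_comp[OF base_tensor_smult(1)[OF M a] eval_tensor_additive[OF M]]
        additive_map_comp[OF eval_tensor_additive[OF M] left_module_smult_additive[OF M a]]
        abelian_group_base_tensor[OF M] left_module_abelian_group[OF M] _ z])
    (use a in \<open>auto simp: base_tensor_smult(2)[OF M] eval_tensor_pure[OF M] left_module.smult_assoc[OF M]\<close>)

lemma d_mult: "\<lbrakk>a \<in> carrier A; b \<in> carrier A\<rbrakk>
    \<Longrightarrow> ext_d \<Omega> (a \<otimes>\<^bsub>A\<^esub> b) = ext_d \<Omega> a \<otimes>\<^bsub>\<Omega>\<^esub> b \<oplus>\<^bsub>\<Omega>\<^esub> a \<otimes>\<^bsub>\<Omega>\<^esub> ext_d \<Omega> b"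
  using d_mult_A[of a b] by (simp add: mult_A A_closed)

text \<open>The Leibniz rule, with \<open>b\<close> moved across the tensor sign in the term
  \<open>da b\<close>. It is the source both of the non-linearity of \<open>d_tensor\<close> and of
  the formula for the first obstruction.\<close>

lemma form_pure_d_mult:
  assumes M: "left_module A M" and a: "a \<in> carrier A" and b: "b \<in> carrier A" and x: "x \<in> carrier M"
  shows "FP 1 M (ext_d \<Omega> (a \<otimes>\<^bsub>A\<^esub> b)) x =
    FP 1 M (a \<otimes>\<^bsub>\<Omega>\<^esub> ext_d \<Omega> b) x \<oplus>\<^bsub>FT 1 M\<^esub> FP 1 M (ext_d \<Omega> a) (b \<odot>\<^bsub>M\<^esub> x)"
proof -
  interpret T: abelian_group "FT 1 M" by (rule abelian_group_form_tensor[OF M])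
  have "ext_d \<Omega> a \<otimes>\<^bsub>\<Omega>\<^esub> b \<in> forms \<Omega> 1" "a \<otimes>\<^bsub>\<Omega>\<^esub> ext_d \<Omega> b \<in> forms \<Omega> 1"
    using a b by (auto intro: form_act act_form d_A)
  then show ?thesis
    using additive_map_add[OF form_pure_additive_left[OF M x, of 1], of "ext_d \<Omega> a \<otimes>\<^bsub>\<Omega>\<^esub> b" "a \<otimes>\<^bsub>\<Omega>\<^esub> ext_d \<Omega> b"]
      form_pure_balanced[OF M d_A[OF a] b x] T.a_comm form_pure_closed[OF M _ x]
      form_pure_closed[OF M d_A[OF a] left_module.smult_closed[OF M b x]]
    by (simp add: d_mult[OF a b])
qed

text \<open>Linearity fails by a term that depends only on the evaluation of \<open>z\<close>. Where
  the evaluation vanishes the defect disappears, so the common kernel of \<open>eval_tensor\<close>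
  and \<open>d_tensor\<close> is stable under \<open>A\<close>.\<close>

lemma d_tensor_smult:
  assumes M: "left_module A M" and a: "a \<in> carrier A" and z: "z \<in> carrier (BT M)"
  shows "d_tensor M (a \<odot>\<^bsub>BT M\<^esub> z) =
    wedge_tensor 1 1 M a (d_tensor M z) \<oplus>\<^bsub>FT 1 M\<^esub> FP 1 M (ext_d \<Omega> a) (eval_tensor M z)"
proof (rule additive_map_eqI[OF generated_by_base_pure[OF M]
        additive_map_comp[OF base_tensor_smult(1)[OF M a] d_tensor_additive[OF M]]
        additive_map_sum[OF additive_map_comp[OF d_tensor_additive[OF M] wedge_tensor_additive[OF M A_forms[OF a]]]
          additive_map_comp[OF eval_tensor_additive[OF M] form_pure_additive_right[OF M d_A[OF a]]]
          abelian_group_form_tensor[OF M]]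
        abelian_group_base_tensor[OF M] abelian_group_form_tensor[OF M] _ z])
  show "(1::nat) = 0 + 1" by simp
  fix t assume "t \<in> carrier A \<times> carrier M"
  then obtain b x where t: "t = (b, x)" "b \<in> carrier A" "x \<in> carrier M" by auto
  show "d_tensor M (a \<odot>\<^bsub>BT M\<^esub> ((\<lambda>(a, x). BP M a x) t)) =
    wedge_tensor 1 1 M a (d_tensor M ((\<lambda>(a, x). BP M a x) t)) \<oplus>\<^bsub>FT 1 M\<^esub>
      FP 1 M (ext_d \<Omega> a) (eval_tensor M ((\<lambda>(a, x). BP M a x) t))"
    using t a form_pure_d_mult[OF M a t(2,3)] wedge_tensor_pure[OF M A_forms[OF a] _ d_A[OF t(2)] t(3), of 1]
    by (simp add: base_tensor_smult(2)[OF M] d_tensor_pure[OF M, simplified] eval_tensor_pure[OF M])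
qed

text \<open>The definition speaks of lists of pairs; as pure tensors generate, its two conditions
  say that the two components of the represented tensor vanish. The set is thus a common kernel, and
  the choice of list drops out.\<close>

lemma jet1_null_eq:
  assumes M: "left_module A M"
  shows "jet1_null K A \<Omega> M =
    {z \<in> carrier (BT M). eval_tensor M z = \<zero>\<^bsub>M\<^esub> \<and> d_tensor M z = \<zero>\<^bsub>FT 1 M\<^esub>}"
proof -
  interpret B: abelian_group "BT M" by (rule abelian_group_base_tensor[OF M])
  have cl: "set (map (\<lambda>(a, x). BP M a x) ts) \<subseteq> carrier (BT M)"
    if "set ts \<subseteq> carrier A \<times> carrier M" for ts
    using that by (auto intro!: base_pure_closed[OF M])
  have ev: "eval_tensor M (list_sum (BT M) (map (\<lambda>(a, x). BP M a x) ts)) =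
      list_sum M (map (\<lambda>(a, e). a \<odot>\<^bsub>M\<^esub> e) ts)" if ts: "set ts \<subseteq> carrier A \<times> carrier M" for ts
    unfolding additive_map_list_sum[OF eval_tensor_additive[OF M] B.abelian_group_axioms
        left_module_abelian_group[OF M] cl[OF ts]] map_map
    by (rule arg_cong[of _ _ "list_sum _"]) (use ts in \<open>auto simp: eval_tensor_pure[OF M]\<close>)
  have dv: "d_tensor M (list_sum (BT M) (map (\<lambda>(a, x). BP M a x) ts)) =
      list_sum (FT 1 M) (map (\<lambda>(a, e). FP 1 M (ext_d \<Omega> a) e) ts)"
    if ts: "set ts \<subseteq> carrier A \<times> carrier M" for ts
    unfolding additive_map_list_sum[OF d_tensor_additive[OF M] B.abelian_group_axioms
        abelian_group_form_tensor[OF M] cl[OF ts]] map_map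
    by (rule arg_cong[of _ _ "list_sum _"], rule map_cong[OF refl]) (use ts d_tensor_pure[OF M] in \<open>auto simp del: set_eq_iff\<close>)
  show ?thesis (is "_ = ?R")
  proof
    show "jet1_null K A \<Omega> M \<subseteq> ?R"
    proof
      fix z assume "z \<in> jet1_null K A \<Omega> M"
      then obtain ts where ts: "set ts \<subseteq> carrier A \<times> carrier M"
        "z = list_sum (BT M) (map (\<lambda>(a, x). BP M a x) ts)"
        "list_sum M (map (\<lambda>(a, e). a \<odot>\<^bsub>M\<^esub> e) ts) = \<zero>\<^bsub>M\<^esub>"
        "list_sum (FT 1 M) (map (\<lambda>(a, e). FP 1 M (ext_d \<Omega> a) e) ts) = \<zero>\<^bsub>FT 1 M\<^esub>"
        unfolding jet1_null_def by blast
      then show "z \<in> ?R"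
        using ev[OF ts(1)] dv[OF ts(1)] B.list_sum_closed[OF cl[OF ts(1)]] by simp
    qed
    show "?R \<subseteq> jet1_null K A \<Omega> M"
    proof
      fix z assume z: "z \<in> ?R"
      then obtain ts where ts: "set ts \<subseteq> carrier A \<times> carrier M"
        "z = list_sum (BT M) (map (\<lambda>(a, x). BP M a x) ts)"
        by (auto elim: generated_byE[OF generated_by_base_pure[OF M]])
      then show "z \<in> jet1_null K A \<Omega> M"
        unfolding jet1_null_def using z ev[OF ts(1)] dv[OF ts(1)] by auto
    qed
  qed
qed

lemma additive_subgroup_jet1_null:
  assumes M: "left_module A M"
  shows "additive_subgroup (jet1_null K A \<Omega> M) (BT M)"
proof (rule additive_subgroupI'[OF abelian_group_base_tensor[OF M]])
  interpret B: abelian_group "BT M" by (rule abelian_group_base_tensor[OF M])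
  interpret T: abelian_group "FT 1 M" by (rule abelian_group_form_tensor[OF M])
  interpret N: abelian_group M by (rule left_module_abelian_group[OF M])
  note ad = eval_tensor_additive[OF M] d_tensor_additive[OF M]
  note z = additive_map_zero[OF ad(1) B.abelian_group_axioms N.abelian_group_axioms]
    additive_map_zero[OF ad(2) B.abelian_group_axioms T.abelian_group_axioms]
  note u = additive_map_uminus[OF ad(1) B.abelian_group_axioms N.abelian_group_axioms]
    additive_map_uminus[OF ad(2) B.abelian_group_axioms T.abelian_group_axioms]
  show "\<zero>\<^bsub>BT M\<^esub> \<in> jet1_null K A \<Omega> M"
    unfolding jet1_null_eq[OF M] using z by simp
  show "x \<oplus>\<^bsub>BT M\<^esub> y \<in> jet1_null K A \<Omega> M"
    if "x \<in> jet1_null K A \<Omega> M" "y \<in> jet1_null K A \<Omega> M" for x y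
    using that unfolding jet1_null_eq[OF M]
    using additive_map_add[OF ad(1), of x y] additive_map_add[OF ad(2), of x y] by simp
  show "\<ominus>\<^bsub>BT M\<^esub> x \<in> jet1_null K A \<Omega> M" if "x \<in> jet1_null K A \<Omega> M" for x
    using that unfolding jet1_null_eq[OF M] using u(1)[of x] u(2)[of x] by simp
qed (simp add: jet1_null_eq[OF M] subset_iff)

lemma jet1_null_smult:
  assumes M: "left_module A M" and a: "a \<in> carrier A"
  shows "(\<lambda>z. a \<odot>\<^bsub>BT M\<^esub> z) ` jet1_null K A \<Omega> M \<subseteq> jet1_null K A \<Omega> M"
proof -
  interpret T: abelian_group "FT 1 M" by (rule abelian_group_form_tensor[OF M])
  interpret N: abelian_group M by (rule left_module_abelian_group[OF M])
  have s: "a \<odot>\<^bsub>M\<^esub> \<zero>\<^bsub>M\<^esub> = \<zero>\<^bsub>M\<^esub>"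
    using additive_map_zero[OF left_module_smult_additive[OF M a]] N.abelian_group_axioms by blast
  have f: "FP 1 M (ext_d \<Omega> a) \<zero>\<^bsub>M\<^esub> = \<zero>\<^bsub>FT 1 M\<^esub>"
    using additive_map_zero[OF form_pure_additive_right[OF M d_A[OF a]]]
      N.abelian_group_axioms T.abelian_group_axioms by blast
  have w: "wedge_tensor 1 1 M a \<zero>\<^bsub>FT 1 M\<^esub> = \<zero>\<^bsub>FT 1 M\<^esub>"
    by (rule wedge_tensor_zero[OF M A_forms[OF a]]) simp
  have "a \<odot>\<^bsub>BT M\<^esub> z \<in> jet1_null K A \<Omega> M" if "z \<in> jet1_null K A \<Omega> M" for z
  proof -
    from that have z: "z \<in> carrier (BT M)" "eval_tensor M z = \<zero>\<^bsub>M\<^esub>"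
      "d_tensor M z = \<zero>\<^bsub>FT 1 M\<^esub>" by (auto simp: jet1_null_eq[OF M])
    show ?thesis
      unfolding jet1_null_eq[OF M]
      using eval_tensor_smult[OF M a z(1)] d_tensor_smult[OF M a z(1)]
        additive_map_closed[OF base_tensor_smult(1)[OF M a] z(1)] s f w z(2,3) by simp
  qed
  then show ?thesis by blast
qed

lemma abelian_group_jet1: "left_module A M \<Longrightarrow> abelian_group (J1 M)"
  unfolding jet1_def by (rule abelian_group_quot_module[OF abelian_group_base_tensor additive_subgroup_jet1_null])

lemma generated_by_jet1_class:
  "left_module A M \<Longrightarrow>
    generated_by (carrier A \<times> carrier M) (J1 M) (\<lambda>(a, x). J1_class M a x)"
  using generated_by_quot_module[OF abelian_group_base_tensor additive_subgroup_jet1_null generated_by_base_pure, of M]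
  by (simp add: jet1_def jet1_class_def split_def)

lemma jet1_class_closed:
  "\<lbrakk>left_module A M; a \<in> carrier A; x \<in> carrier M\<rbrakk> \<Longrightarrow> J1_class M a x \<in> carrier (J1 M)"
  using generated_by_closed[OF generated_by_jet1_class, of M "(a, x)"] by simp

lemma jet1_coset_additive:
  "left_module A M \<Longrightarrow>
    additive_map (BT M) (J1 M) (\<lambda>z. jet1_null K A \<Omega> M +>\<^bsub>BT M\<^esub> z)"
  unfolding jet1_def by (rule coset_additive[OF abelian_group_base_tensor additive_subgroup_jet1_null])

lemma jet1_class_add_left:
  "\<lbrakk>left_module A M; a \<in> carrier A; b \<in> carrier A; x \<in> carrier M\<rbrakk>
    \<Longrightarrow> J1_class M (a \<oplus>\<^bsub>A\<^esub> b) x = J1_class M a x \<oplus>\<^bsub>J1 M\<^esub> J1_class M b x"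
  using additive_map_add[OF jet1_coset_additive[of M] base_pure_closed[of M a x] base_pure_closed[of M b x]]
  by (simp add: jet1_class_def base_pure_add_left)

lemma jet1_class_additive_right:
  "\<lbrakk>left_module A M; a \<in> carrier A\<rbrakk> \<Longrightarrow> additive_map M (J1 M) (J1_class M a)"
  using additive_map_add[OF jet1_coset_additive[of M] base_pure_closed[of M a] base_pure_closed[of M a]]
  by (auto intro!: additive_mapI jet1_class_closed simp: jet1_class_def base_pure_add_right)

lemma
  assumes M: "left_module A M" and a: "a \<in> carrier A"
  shows jet1_smult_additive:
      "additive_map (J1 M) (J1 M) (\<lambda>x. a \<odot>\<^bsub>J1 M\<^esub> x)"
    and jet1_smult_class: "\<lbrakk>b \<in> carrier A; x \<in> carrier M\<rbrakk>
      \<Longrightarrow> a \<odot>\<^bsub>J1 M\<^esub> J1_class M b x = J1_class M (a \<otimes>\<^bsub>A\<^esub> b) x"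
proof -
  note B = abelian_group_base_tensor[OF M] additive_subgroup_jet1_null[OF M]
  note q = B B base_tensor_smult(1)[OF M a] jet1_null_smult[OF M a]
  show "additive_map (J1 M) (J1 M) (\<lambda>x. a \<odot>\<^bsub>J1 M\<^esub> x)"
    using quot_map_additive[OF q] by (simp add: jet1_def)
  show "a \<odot>\<^bsub>J1 M\<^esub> J1_class M b x = J1_class M (a \<otimes>\<^bsub>A\<^esub> b) x"
    if "b \<in> carrier A" "x \<in> carrier M"
    using quot_map_coset[OF q base_pure_closed[OF M that]] base_tensor_smult(2)[OF M a that]
    by (simp add: jet1_def jet1_class_def)
qed

lemma left_module_jet1:
  assumes M: "left_module A M"
  shows "left_module A (J1 M)"
  by (rule left_module_of_generators[OF ring_A abelian_group_jet1[OF M]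
        generated_by_jet1_class[OF M] jet1_smult_additive[OF M]])
    (auto simp: jet1_smult_class[OF M] jet1_class_add_left[OF M] A.l_distr A.m_assoc)

definition jet1_eval :: "('a, 'm) module \<Rightarrow> (('a \<times> 'm) \<Rightarrow>\<^sub>0 int) set set \<Rightarrow> 'm" where
  "jet1_eval M = quot_lift (eval_tensor M)"

definition jet1_d :: "('a, 'm) module \<Rightarrow> (('a \<times> 'm) \<Rightarrow>\<^sub>0 int) set set \<Rightarrow> (('a \<times> 'm) \<Rightarrow>\<^sub>0 int) set" where
  "jet1_d M = quot_lift (d_tensor M)"

context
  fixes M :: "('a, 'm) module"
  assumes M: "left_module A M"
begin

lemma jet1_eval_lift:
  "additive_map (J1 M) M (jet1_eval M)"
  "z \<in> carrier (BT M) \<Longrightarrow> jet1_eval M (jet1_null K A \<Omega> M +>\<^bsub>BT M\<^esub> z) = eval_tensor M z"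
proof -
  have "eval_tensor M z = \<zero>\<^bsub>M\<^esub>" if "z \<in> jet1_null K A \<Omega> M" for z
    using that by (simp add: jet1_null_eq[OF M])
  note q = abelian_group_base_tensor[OF M] additive_subgroup_jet1_null[OF M]
    left_module_abelian_group[OF M] eval_tensor_additive[OF M] this
  show "additive_map (J1 M) M (jet1_eval M)"
    using quot_lift_additive[OF q] by (simp add: jet1_def jet1_eval_def)
  show "z \<in> carrier (BT M) \<Longrightarrow> jet1_eval M (jet1_null K A \<Omega> M +>\<^bsub>BT M\<^esub> z) = eval_tensor M z"
    unfolding jet1_eval_def by (rule quot_lift_coset[OF q])
qed

lemma jet1_d_lift:
  "additive_map (J1 M) (FT 1 M) (jet1_d M)"
  "z \<in> carrier (BT M) \<Longrightarrow> jet1_d M (jet1_null K A \<Omega> M +>\<^bsub>BT M\<^esub> z) = d_tensor M z"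
proof -
  have "d_tensor M z = \<zero>\<^bsub>FT 1 M\<^esub>" if "z \<in> jet1_null K A \<Omega> M" for z
    using that by (simp add: jet1_null_eq[OF M])
  note q = abelian_group_base_tensor[OF M] additive_subgroup_jet1_null[OF M]
    abelian_group_form_tensor[OF M] d_tensor_additive[OF M] this
  show "additive_map (J1 M) (FT 1 M) (jet1_d M)"
    using quot_lift_additive[OF q] by (simp add: jet1_def jet1_d_def)
  show "z \<in> carrier (BT M) \<Longrightarrow> jet1_d M (jet1_null K A \<Omega> M +>\<^bsub>BT M\<^esub> z) = d_tensor M z"
    unfolding jet1_d_def by (rule quot_lift_coset[OF q])
qed

lemma jet1_eval_class:
  "\<lbrakk>a \<in> carrier A; x \<in> carrier M\<rbrakk> \<Longrightarrow> jet1_eval M (J1_class M a x) = a \<odot>\<^bsub>M\<^esub> x"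
  unfolding jet1_class_def
  by (simp add: jet1_eval_lift(2) base_pure_closed[OF M] eval_tensor_pure[OF M])

lemma jet1_d_class:
  "\<lbrakk>a \<in> carrier A; x \<in> carrier M\<rbrakk>
    \<Longrightarrow> jet1_d M (J1_class M a x) = FP 1 M (ext_d \<Omega> a) x"
  unfolding jet1_class_def
  using jet1_d_lift(2)[OF base_pure_closed[OF M]] d_tensor_pure[OF M] by simp

text \<open>Representatives with equal components differ by an element of the common kernel, which
  is exactly what has been divided out. The criterion is what shows that maps with values in jets
  are well defined.\<close>

lemma jet1_eqI:
  assumes X: "X \<in> carrier (J1 M)" and Y: "Y \<in> carrier (J1 M)"
    and eq: "jet1_eval M X = jet1_eval M Y" "jet1_d M X = jet1_d M Y"
  shows "X = Y"
proof -
  note B = abelian_group_base_tensor[OF M] additive_subgroup_jet1_null[OF M]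
  interpret B: abelian_group "BT M" by (rule abelian_group_base_tensor[OF M])
  interpret T: abelian_group "FT 1 M" by (rule abelian_group_form_tensor[OF M])
  interpret N: abelian_group M by (rule left_module_abelian_group[OF M])
  obtain x where x: "x \<in> carrier (BT M)" "X = jet1_null K A \<Omega> M +>\<^bsub>BT M\<^esub> x"
    using X unfolding jet1_def by (rule quot_moduleE[OF B])
  obtain y where y: "y \<in> carrier (BT M)" "Y = jet1_null K A \<Omega> M +>\<^bsub>BT M\<^esub> y"
    using Y unfolding jet1_def by (rule quot_moduleE[OF B])
  have "eval_tensor M x = eval_tensor M y" "d_tensor M x = d_tensor M y"
    using eq jet1_eval_lift(2)[OF x(1)] jet1_eval_lift(2)[OF y(1)]
      jet1_d_lift(2)[OF x(1)] jet1_d_lift(2)[OF y(1)] by (simp_all add: x(2) y(2))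
  then have "x \<ominus>\<^bsub>BT M\<^esub> y \<in> jet1_null K A \<Omega> M"
    unfolding jet1_null_eq[OF M]
    using x(1) y(1) additive_map_minus[OF eval_tensor_additive[OF M] B.abelian_group_axioms N.abelian_group_axioms x(1) y(1)]
      additive_map_minus[OF d_tensor_additive[OF M] B.abelian_group_axioms T.abelian_group_axioms x(1) y(1)]
      additive_map_closed[OF eval_tensor_additive[OF M] y(1)] additive_map_closed[OF d_tensor_additive[OF M] y(1)]
    by (simp add: N.minus_eq N.r_neg T.minus_eq T.r_neg)
  then show ?thesis
    using coset_eq_iff[OF B x(1) y(1)] x(2) y(2) by simp
qed

lemma jet1_eval_linear: "linear_map A (J1 M) M (jet1_eval M)"
proof (rule linear_mapI[OF jet1_eval_lift(1)])
  fix a x assume a: "a \<in> carrier A" and x: "x \<in> carrier (J1 M)"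
  show "jet1_eval M (a \<odot>\<^bsub>J1 M\<^esub> x) = a \<odot>\<^bsub>M\<^esub> jet1_eval M x"
    by (rule additive_map_eqI[OF generated_by_jet1_class[OF M]
          additive_map_comp[OF jet1_smult_additive[OF M a] jet1_eval_lift(1)]
          additive_map_comp[OF jet1_eval_lift(1) left_module_smult_additive[OF M a]]
          abelian_group_jet1[OF M] left_module_abelian_group[OF M] _ x])
      (use a in \<open>auto simp: jet1_smult_class[OF M] jet1_eval_class left_module.smult_assoc[OF M]\<close>)
qed

text \<open>The same Leibniz defect as for \<open>d_tensor\<close>; it is needed explicitly in the
  balance computation for the second obstruction.\<close>

lemma jet1_d_smult:
  assumes a: "a \<in> carrier A" and x: "x \<in> carrier (J1 M)"
  shows "jet1_d M (a \<odot>\<^bsub>J1 M\<^esub> x) =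
    wedge_tensor 1 1 M a (jet1_d M x) \<oplus>\<^bsub>FT 1 M\<^esub> FP 1 M (ext_d \<Omega> a) (jet1_eval M x)"
proof (rule additive_map_eqI[OF generated_by_jet1_class[OF M]
        additive_map_comp[OF jet1_smult_additive[OF M a] jet1_d_lift(1)]
        additive_map_sum[OF additive_map_comp[OF jet1_d_lift(1) wedge_tensor_additive[OF M A_forms[OF a]]]
          additive_map_comp[OF jet1_eval_lift(1) form_pure_additive_right[OF M d_A[OF a]]]
          abelian_group_form_tensor[OF M]]
        abelian_group_jet1[OF M] abelian_group_form_tensor[OF M] _ x])
  show "(1::nat) = 0 + 1" by simp
  fix t assume "t \<in> carrier A \<times> carrier M"
  then obtain b x where t: "t = (b, x)" "b \<in> carrier A" "x \<in> carrier M" by auto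
  show "jet1_d M (a \<odot>\<^bsub>J1 M\<^esub> ((\<lambda>(a, x). J1_class M a x) t)) =
    wedge_tensor 1 1 M a (jet1_d M ((\<lambda>(a, x). J1_class M a x) t)) \<oplus>\<^bsub>FT 1 M\<^esub>
      FP 1 M (ext_d \<Omega> a) (jet1_eval M ((\<lambda>(a, x). J1_class M a x) t))"
    using t a form_pure_d_mult[OF M a t(2,3)] wedge_tensor_pure[OF M A_forms[OF a] _ d_A[OF t(2)] t(3), of 1]
    by (simp add: jet1_smult_class[OF M] jet1_d_class jet1_eval_class)
qed

end

end

section \<open>Obstruction maps\<close>

text \<open>An outer generator is additive in its second argument, so expanding that argument in
  generators of \<open>N\<close> splits it into generators of nested form. For jets of jets this
  yields the triples on which the obstructions are prescribed.\<close>

lemma generated_by_nested: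
  assumes J: "abelian_group J" and N: "abelian_group N"
    and gen: "generated_by (S \<times> carrier N) J (\<lambda>(a, x). \<gamma> a x)"
    and add: "\<And>a. a \<in> S \<Longrightarrow> additive_map N J (\<gamma> a)" and genN: "generated_by I N g"
  shows "generated_by (S \<times> I) J (\<lambda>(a, i). \<gamma> a (g i))"
proof -
  interpret J: abelian_group J by fact
  have gN: "set (map g ts) \<subseteq> carrier N" if "set ts \<subseteq> I" for ts
    using that generated_by_closed[OF genN] by auto
  have cl: "\<gamma> a (g i) \<in> carrier J" if "a \<in> S" "i \<in> I" for a i
    using additive_map_closed[OF add[OF that(1)] generated_by_closed[OF genN that(2)]] .
  then have cl': "set (map (\<lambda>(a, i). \<gamma> a (g i)) ts) \<subseteq> carrier J" if "set ts \<subseteq> S \<times> I" for ts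
    using that by auto
  have ex: "\<exists>us. set us \<subseteq> S \<times> I \<and>
      list_sum J (map (\<lambda>(a, x). \<gamma> a x) ts) = list_sum J (map (\<lambda>(a, i). \<gamma> a (g i)) us)"
    if "set ts \<subseteq> S \<times> carrier N" for ts
    using that
  proof (induction ts)
    case (Cons t ts)
    then obtain a x where t: "t = (a, x)" "a \<in> S" "x \<in> carrier N" by auto
    obtain us where us: "set us \<subseteq> S \<times> I"
      "list_sum J (map (\<lambda>(a, x). \<gamma> a x) ts) = list_sum J (map (\<lambda>(a, i). \<gamma> a (g i)) us)"
      using Cons by auto
    obtain vs where vs: "set vs \<subseteq> I" "x = list_sum N (map g vs)"
      using genN t(3) by (rule generated_byE)
    have "\<gamma> a x = list_sum J (map (\<gamma> a) (map g vs))"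
      unfolding vs(2) by (rule additive_map_list_sum[OF add[OF t(2)] N J gN[OF vs(1)]])
    also have "map (\<gamma> a) (map g vs) = map (\<lambda>(a, i). \<gamma> a (g i)) (map (Pair a) vs)"
      by simp
    finally have "\<gamma> a x = list_sum J (map (\<lambda>(a, i). \<gamma> a (g i)) (map (Pair a) vs))" .
    moreover have sub: "set (map (Pair a) vs) \<subseteq> S \<times> I" using vs(1) t(2) by auto
    ultimately have "list_sum J (map (\<lambda>(a, x). \<gamma> a x) (t # ts)) =
        list_sum J (map (\<lambda>(a, i). \<gamma> a (g i)) (map (Pair a) vs @ us))"
      using J.list_sum_append[OF cl'[OF sub] cl'[OF us(1)]] us(2) t(1) by simp
    then show ?case
      using sub us(1) by (intro exI[of _ "map (Pair a) vs @ us"]) auto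
  qed (auto intro: exI[of _ "[]"])
  show ?thesis
    unfolding generated_by_def
  proof (intro conjI ballI)
    show "(\<lambda>(a, i). \<gamma> a (g i)) \<in> S \<times> I \<rightarrow> carrier J" using cl by auto
    fix x assume "x \<in> carrier J"
    then obtain ts where "set ts \<subseteq> S \<times> carrier N" "x = list_sum J (map (\<lambda>(a, x). \<gamma> a x) ts)"
      by (rule generated_byE[OF gen])
    then show "\<exists>us. set us \<subseteq> S \<times> I \<and> x = list_sum J (map (\<lambda>(a, i). \<gamma> a (g i)) us)"
      using ex by blast
  qed
qed

lemma left_module_restrict:
  assumes M: "left_module R M" and H: "additive_subgroup H M"
    and smult: "\<And>a x. \<lbrakk>a \<in> carrier R; x \<in> H\<rbrakk> \<Longrightarrow> a \<odot>\<^bsub>M\<^esub> x \<in> H"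
  shows "left_module R (M\<lparr>carrier := H\<rparr>)"
proof -
  interpret left_module R M by fact
  interpret H: additive_subgroup H M by fact
  have sub: "x \<in> carrier M" if "x \<in> H" for x using that H.a_subset by blast
  have "abelian_group (M\<lparr>carrier := H\<rparr>)"
  proof (rule abelian_groupI)
    fix x assume "x \<in> carrier (M\<lparr>carrier := H\<rparr>)"
    then show "\<exists>y\<in>carrier (M\<lparr>carrier := H\<rparr>). y \<oplus>\<^bsub>M\<lparr>carrier := H\<rparr>\<^esub> x = \<zero>\<^bsub>M\<lparr>carrier := H\<rparr>\<^esub>"
      using H.a_inv_closed[of x] by (intro bexI[of _ "\<ominus>\<^bsub>M\<^esub> x"]) (auto simp: sub M.l_neg)
  qed (use H.zero_closed H.a_closed in \<open>auto simp: sub M.a_ac\<close>)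
  then show ?thesis
    by (intro left_module.intro left_module_axioms.intro R.ring_axioms)
      (auto simp: smult sub smult_l_distr smult_r_distr smult_assoc smult_one)
qed

lemma transport_module_sel [simp]:
  "carrier (transport_module f g M) = f ` carrier M" "\<zero>\<^bsub>transport_module f g M\<^esub> = f \<zero>\<^bsub>M\<^esub>"
  "x \<oplus>\<^bsub>transport_module f g M\<^esub> y = f (g x \<oplus>\<^bsub>M\<^esub> g y)"
  "a \<odot>\<^bsub>transport_module f g M\<^esub> x = f (a \<odot>\<^bsub>M\<^esub> g x)"
  by (simp_all add: transport_module_def)

text \<open>The new carrier is the image of \<open>f\<close>, on which \<open>g (f x) = x\<close>
  already makes \<open>f\<close> and \<open>g\<close> mutually inverse. This is precisely what an
  encoding by chosen representatives provides.\<close>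

lemma
  assumes M: "left_module R M" and inv: "\<And>x. x \<in> carrier M \<Longrightarrow> g (f x) = x"
  shows left_module_transport: "left_module R (transport_module f g M)"
    and linear_map_transport: "linear_map R (transport_module f g M) M g"
proof -
  interpret left_module R M by fact
  let ?T = "transport_module f g M"
  have "abelian_group ?T"
  proof (rule abelian_groupI)
    fix x assume "x \<in> carrier ?T"
    then obtain u where "u \<in> carrier M" "x = f u" by auto
    then show "\<exists>y\<in>carrier ?T. y \<oplus>\<^bsub>?T\<^esub> x = \<zero>\<^bsub>?T\<^esub>"
      by (intro bexI[of _ "f (\<ominus>\<^bsub>M\<^esub> u)"]) (auto simp: inv M.l_neg)
  qed (auto simp: inv M.a_ac)
  then show "left_module R ?T"
    by (intro left_module.intro left_module_axioms.intro R.ring_axioms)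
      (auto simp: inv smult_closed smult_l_distr smult_r_distr smult_assoc smult_one)
  show "linear_map R ?T M g"
    by (auto simp: linear_map_def inv smult_closed)
qed

context exterior_algebra
begin

text \<open>The assignment is defined on the base tensor product first. There its two components are
  \<open>f\<close> after evaluation and \<open>\<phi>\<close> after \<open>d_tensor\<close>, so both
  vanish on the null subgroup, and since components determine a jet the map descends.\<close>

lemma
  assumes M: "left_module A M" and N: "left_module A N" and f: "linear_map A M N f"
  shows jet1_map_additive: "additive_map (J1 M) (J1 N) (jet1_map K A \<Omega> M N f)"
    and jet1_map_class: "\<lbrakk>a \<in> carrier A; x \<in> carrier M\<rbrakk>
      \<Longrightarrow> jet1_map K A \<Omega> M N f (J1_class M a x) = J1_class N a (f x)"
proof -
  note fa = linear_map_additive[OF f] and fc = linear_map_closed[OF f]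
  note JN = left_module_jet1[OF N] and ab = left_module_abelian_group
  note addr = additive_map_comp[OF fa jet1_class_additive_right[OF N]]
  \<comment> \<open>This is the identity on one-forms tensored with \<open>f\<close>; linearity of
    \<open>f\<close> over \<open>A\<close> gives the balance.\<close>
  obtain \<phi> where \<phi>: "additive_map (FT 1 M) (FT 1 N) \<phi>"
    "\<And>w x. \<lbrakk>w \<in> forms \<Omega> 1; x \<in> carrier M\<rbrakk> \<Longrightarrow> \<phi> (FP 1 M w x) = FP 1 N w (f x)"
  proof (rule form_tensor_lift[OF M abelian_group_form_tensor[OF N]])
    show "additive_map (form_module \<Omega> 1) (FT 1 N) (\<lambda>w. FP 1 N w (f x))"
      if "x \<in> carrier M" for x
      by (rule form_pure_additive_left[OF N fc[OF that]])
    show "additive_map M (FT 1 N) (\<lambda>x. FP 1 N w (f x))"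
      if "w \<in> forms \<Omega> 1" for w
      by (rule additive_map_comp[OF fa form_pure_additive_right[OF N that]])
    show "FP 1 N (w \<otimes>\<^bsub>\<Omega>\<^esub> a) (f x) = FP 1 N w (f (a \<odot>\<^bsub>M\<^esub> x))"
      if "w \<in> forms \<Omega> 1" "a \<in> carrier A" "x \<in> carrier M" for w a x
      using form_pure_balanced[OF N that(1,2) fc[OF that(3)]] linear_map_smult[OF f that(2,3)] by simp
  qed blast
  let ?F = "map_on_generators (carrier A \<times> carrier M) (BT M) (J1 N)
    (\<lambda>(a, x). BP M a x) (\<lambda>(a, x). J1_class N a (f x))"
  have 1: "additive_map A (J1 N) (\<lambda>a. J1_class N a (f x))" if "x \<in> carrier M" for x
    using that by (auto intro!: additive_mapI jet1_class_closed[OF N] simp: fc jet1_class_add_left[OF N])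
  have 2: "J1_class N (c \<odot>\<^bsub>A\<^esub> a) (f x) = J1_class N a (f ((c \<odot>\<^bsub>A\<^esub> \<one>\<^bsub>A\<^esub>) \<odot>\<^bsub>M\<^esub> x))"
    if a: "a \<in> carrier A" and c: "c \<in> carrier K" and x: "x \<in> carrier M" for a c x
  proof -
    interpret balanced_pair A "\<lambda>b c. c \<odot>\<^bsub>A\<^esub> b" K "scalar_module A N" by (rule base_balanced_pair[OF N])
    show ?thesis
      using pure_balanced[of a c "f x"] a c fc[OF x] linear_map_smult[OF f _ x, of "c \<odot>\<^bsub>A\<^esub> \<one>\<^bsub>A\<^esub>"]
      by (simp add: jet1_class_def base_pure_def)
  qed
  have F: "additive_map (BT M) (J1 N) ?F"
    by (rule base_tensor_lift(1)[OF M ab[OF JN] 1 addr 2])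
  have Fp: "?F (BP M a x) = J1_class N a (f x)" if "a \<in> carrier A" "x \<in> carrier M" for a x
    by (rule base_tensor_lift(2)[OF M ab[OF JN] 1 addr 2 that])
  note B = abelian_group_base_tensor[OF M]
  have F0: "?F z = \<zero>\<^bsub>J1 N\<^esub>" if "z \<in> jet1_null K A \<Omega> M" for z
  proof -
    from that have z: "z \<in> carrier (BT M)" "eval_tensor M z = \<zero>\<^bsub>M\<^esub>"
      "d_tensor M z = \<zero>\<^bsub>FT 1 M\<^esub>" by (auto simp: jet1_null_eq[OF M])
    interpret J: abelian_group "J1 N" by (rule ab[OF JN])
    have "jet1_eval N (?F z) = f (eval_tensor M z)"
      by (rule additive_map_eqI[OF generated_by_base_pure[OF M]
            additive_map_comp[OF F jet1_eval_lift(1)[OF N]]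
            additive_map_comp[OF eval_tensor_additive[OF M] fa] B ab[OF N] _ z(1)])
        (auto simp: Fp eval_tensor_pure[OF M] jet1_eval_class[OF N] fc linear_map_smult[OF f])
    moreover have "jet1_d N (?F z) = \<phi> (d_tensor M z)"
      by (rule additive_map_eqI[OF generated_by_base_pure[OF M]
            additive_map_comp[OF F jet1_d_lift(1)[OF N]]
            additive_map_comp[OF d_tensor_additive[OF M] \<phi>(1)] B abelian_group_form_tensor[OF N] _ z(1)])
        (clarsimp simp: Fp d_tensor_pure[OF M] jet1_d_class[OF N] fc \<phi>(2) d_A)
    moreover have "f \<zero>\<^bsub>M\<^esub> = \<zero>\<^bsub>N\<^esub>" by (rule additive_map_zero[OF fa ab[OF M] ab[OF N]])
    moreover have "\<phi> \<zero>\<^bsub>FT 1 M\<^esub> = \<zero>\<^bsub>FT 1 N\<^esub>"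
      by (rule additive_map_zero[OF \<phi>(1) abelian_group_form_tensor[OF M] abelian_group_form_tensor[OF N]])
    moreover have "jet1_eval N \<zero>\<^bsub>J1 N\<^esub> = \<zero>\<^bsub>N\<^esub>"
      by (rule additive_map_zero[OF jet1_eval_lift(1)[OF N] ab[OF JN] ab[OF N]])
    moreover have "jet1_d N \<zero>\<^bsub>J1 N\<^esub> = \<zero>\<^bsub>FT 1 N\<^esub>"
      by (rule additive_map_zero[OF jet1_d_lift(1)[OF N] ab[OF JN] abelian_group_form_tensor[OF N]])
    ultimately show ?thesis
      using z(2,3) additive_map_closed[OF F z(1)] by (intro jet1_eqI[OF N]) simp_all
  qed
  note q = B additive_subgroup_jet1_null[OF M] ab[OF JN] F F0
  have lift: "additive_map (J1 M) (J1 N) (quot_lift ?F)"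
    using quot_lift_additive[OF q] by (simp add: jet1_def)
  have v: "quot_lift ?F ((\<lambda>(a, x). J1_class M a x) t) = (\<lambda>(a, x). J1_class N a (f x)) t"
    if "t \<in> carrier A \<times> carrier M" for t
    using that quot_lift_coset[OF q] by (auto simp: Fp jet1_class_def[of _ _ _ M] base_pure_closed[OF M])
  note gen = generated_by_jet1_class[OF M] lift abelian_group_jet1[OF M] ab[OF JN] v
  show "additive_map (J1 M) (J1 N) (jet1_map K A \<Omega> M N f)"
    unfolding jet1_map_def by (rule map_on_generators_additive'[OF gen])
  show "jet1_map K A \<Omega> M N f (J1_class M a x) = J1_class N a (f x)"
    if "a \<in> carrier A" "x \<in> carrier M"
    using map_on_generators_value'[OF gen, where t = "(a, x)"] that by (simp add: jet1_map_def)
qed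

lemma jet1_map_linear:
  assumes M: "left_module A M" and N: "left_module A N" and f: "linear_map A M N f"
  shows "linear_map A (J1 M) (J1 N) (jet1_map K A \<Omega> M N f)"
proof (rule linear_mapI[OF jet1_map_additive[OF assms]])
  fix a x assume a: "a \<in> carrier A" and x: "x \<in> carrier (J1 M)"
  show "jet1_map K A \<Omega> M N f (a \<odot>\<^bsub>J1 M\<^esub> x) = a \<odot>\<^bsub>J1 N\<^esub> jet1_map K A \<Omega> M N f x"
    by (rule additive_map_eqI[OF generated_by_jet1_class[OF M]
          additive_map_comp[OF jet1_smult_additive[OF M a] jet1_map_additive[OF assms]]
          additive_map_comp[OF jet1_map_additive[OF assms] jet1_smult_additive[OF N a]]
          abelian_group_jet1[OF M] abelian_group_jet1[OF N] _ x])
      (use a in \<open>auto simp: jet1_smult_class[OF M] jet1_smult_class[OF N] jet1_map_class[OF assms]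
        linear_map_closed[OF f]\<close>)
qed

context
  fixes M :: "('a, 'm) module"
  assumes M: "left_module A M"
begin

lemma generated_by_jet1_jet1:
  "generated_by (carrier A \<times> carrier A \<times> carrier M) (J1 (J1 M))
     (\<lambda>(a, c, x). J1_class (J1 M) a (J1_class M c x))"
  using generated_by_nested[OF abelian_group_jet1[OF left_module_jet1[OF M]] abelian_group_jet1[OF M]
      generated_by_jet1_class[OF left_module_jet1[OF M]]
      jet1_class_additive_right[OF left_module_jet1[OF M]] generated_by_jet1_class[OF M]]
  by (simp add: split_def)

text \<open>Solving the Leibniz rule for the wanted value gives
  \<open>a dc \<otimes> x = d(ac) \<otimes> x - da \<otimes> cx\<close>. The first term is
  \<open>jet1_d\<close> of the outer evaluation, the second is the outer \<open>jet1_d\<close>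
  followed by the inner evaluation, so the obstruction is a difference of maps already known to be
  well defined.\<close>

lemma
  shows obstruction1_additive:
      "additive_map (J1 (J1 M)) (FT 1 M) (obstruction1 K A \<Omega> M)"
    and obstruction1_class: "\<lbrakk>a \<in> carrier A; c \<in> carrier A; x \<in> carrier M\<rbrakk>
      \<Longrightarrow> obstruction1 K A \<Omega> M (J1_class (J1 M) a (J1_class M c x)) =
        FP 1 M (a \<otimes>\<^bsub>\<Omega>\<^esub> ext_d \<Omega> c) x"
proof -
  let ?J = "J1 M"
  note J = left_module_jet1[OF M]
  interpret T: abelian_group "FT 1 M" by (rule abelian_group_form_tensor[OF M])
  note ev = jet1_eval_linear[OF M]
  \<comment> \<open>The identity on one-forms tensored with the \<open>A\<close>-linear evaluation
    of the inner jet.\<close>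
  obtain \<psi> where \<psi>: "additive_map (FT 1 ?J) (FT 1 M) \<psi>"
    "\<And>w x. \<lbrakk>w \<in> forms \<Omega> 1; x \<in> carrier ?J\<rbrakk> \<Longrightarrow> \<psi> (FP 1 ?J w x) = FP 1 M w (jet1_eval M x)"
  proof (rule form_tensor_lift[OF J abelian_group_form_tensor[OF M]])
    show "additive_map (form_module \<Omega> 1) (FT 1 M) (\<lambda>w. FP 1 M w (jet1_eval M x))"
      if "x \<in> carrier ?J" for x
      by (rule form_pure_additive_left[OF M linear_map_closed[OF ev that]])
    show "additive_map ?J (FT 1 M) (\<lambda>x. FP 1 M w (jet1_eval M x))"
      if "w \<in> forms \<Omega> 1" for w
      by (rule additive_map_comp[OF jet1_eval_lift(1)[OF M] form_pure_additive_right[OF M that]])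
    show "FP 1 M (w \<otimes>\<^bsub>\<Omega>\<^esub> a) (jet1_eval M x) = FP 1 M w (jet1_eval M (a \<odot>\<^bsub>?J\<^esub> x))"
      if "w \<in> forms \<Omega> 1" "a \<in> carrier A" "x \<in> carrier ?J" for w a x
      using form_pure_balanced[OF M that(1,2) linear_map_closed[OF ev that(3)]] linear_map_smult[OF ev that(2,3)] by simp
  qed blast
  let ?\<phi> = "\<lambda>y. jet1_d M (jet1_eval ?J y) \<ominus>\<^bsub>FT 1 M\<^esub> \<psi> (jet1_d ?J y)"
  have \<phi>: "additive_map (J1 ?J) (FT 1 M) ?\<phi>"
    by (rule additive_map_diff[OF additive_map_comp[OF jet1_eval_lift(1)[OF J] jet1_d_lift(1)[OF M]]
          additive_map_comp[OF jet1_d_lift(1)[OF J] \<psi>(1)] T.abelian_group_axioms])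
  have v: "?\<phi> ((\<lambda>(a, c, x). J1_class ?J a (J1_class M c x)) t) =
      (\<lambda>(a, c, x). FP 1 M (a \<otimes>\<^bsub>\<Omega>\<^esub> ext_d \<Omega> c) x) t"
    if t: "t \<in> carrier A \<times> carrier A \<times> carrier M" for t
  proof -
    obtain a c x where t: "t = (a, c, x)" "a \<in> carrier A" "c \<in> carrier A" "x \<in> carrier M"
      using t by auto
    have "FP 1 M (a \<otimes>\<^bsub>\<Omega>\<^esub> ext_d \<Omega> c) x \<in> carrier (FT 1 M)"
      "FP 1 M (ext_d \<Omega> a) (c \<odot>\<^bsub>M\<^esub> x) \<in> carrier (FT 1 M)"
      using t by (auto intro!: form_pure_closed[OF M] act_form d_A left_module.smult_closed[OF M])
    then show ?thesis
      using t form_pure_d_mult[OF M t(2-4)]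
      by (simp add: jet1_eval_class[OF J] jet1_d_class[OF J] jet1_class_closed[OF M] \<psi>(2) d_A
          jet1_smult_class[OF M] jet1_d_class[OF M] jet1_eval_class[OF M] T.minus_eq T.a_assoc T.r_neg)
  qed
  note gen = generated_by_jet1_jet1 \<phi> abelian_group_jet1[OF J] T.abelian_group_axioms v
  show "additive_map (J1 ?J) (FT 1 M) (obstruction1 K A \<Omega> M)"
    unfolding obstruction1_def by (rule map_on_generators_additive'[OF gen])
  show "obstruction1 K A \<Omega> M (J1_class ?J a (J1_class M c x)) =
        FP 1 M (a \<otimes>\<^bsub>\<Omega>\<^esub> ext_d \<Omega> c) x"
    if "a \<in> carrier A" "c \<in> carrier A" "x \<in> carrier M"
    using map_on_generators_value'[OF gen, where t = "(a, c, x)"] that by (simp add: obstruction1_def)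
qed

text \<open>
  The map \<open>w \<otimes> [c \<otimes> x] \<mapsto> w \<and> dc \<otimes> x\<close> is not balanced over \<open>A\<close>, but
  \<open>w \<otimes> [c \<otimes> x] \<mapsto> d(wc) \<otimes> x = dw \<otimes> cx - w \<and> dc \<otimes> x\<close> is, and for exact \<open>w\<close> the two agree up to sign.
\<close>

lemma
  shows obstruction2_additive:
      "additive_map (J1 (J1 M)) (FT 2 M) (obstruction2 K A \<Omega> M)"
    and obstruction2_class: "\<lbrakk>a \<in> carrier A; c \<in> carrier A; x \<in> carrier M\<rbrakk>
      \<Longrightarrow> obstruction2 K A \<Omega> M (J1_class (J1 M) a (J1_class M c x)) =
        FP 2 M (ext_d \<Omega> a \<otimes>\<^bsub>\<Omega>\<^esub> ext_d \<Omega> c) x"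
proof -
  let ?J = "J1 M" and ?T = "FT 2 M"
  note J = left_module_jet1[OF M]
  interpret T: abelian_group ?T by (rule abelian_group_form_tensor[OF M])
  interpret F2: abelian_group "form_module \<Omega> 2" by (rule abelian_group_form_module)
  note ev = jet1_eval_linear[OF M]
  have l: "(2::nat) = 1 + 1" by simp
  define \<beta> where "\<beta> w x = FP 2 M (ext_d \<Omega> w) (jet1_eval M x) \<ominus>\<^bsub>?T\<^esub> wedge_tensor 1 2 M w (jet1_d M x)" for w x
  have evc: "jet1_eval M x \<in> carrier M" if "x \<in> carrier ?J" for x
    using linear_map_closed[OF ev that] .
  have dc: "jet1_d M x \<in> carrier (FT 1 M)" if "x \<in> carrier ?J" for x
    using additive_map_closed[OF jet1_d_lift(1)[OF M] that] .
  have pc: "FP 2 M w x \<in> carrier ?T" if "w \<in> forms \<Omega> 2" "x \<in> carrier M" for w x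
    by (rule form_pure_closed[OF M that])
  have wc: "wedge_tensor 1 2 M w z \<in> carrier ?T" if "w \<in> forms \<Omega> 1" "z \<in> carrier (FT 1 M)" for w z
    by (rule wedge_tensor_closed[OF M that(1) l that(2)])
  have dd: "additive_map (form_module \<Omega> 1) (form_module \<Omega> 2) (ext_d \<Omega>)"
    by (rule additive_mapI) (auto simp: d_form1 d_add forms_closed)
  obtain \<psi> where \<psi>: "additive_map (FT 1 ?J) ?T \<psi>"
    "\<And>w x. \<lbrakk>w \<in> forms \<Omega> 1; x \<in> carrier ?J\<rbrakk> \<Longrightarrow> \<psi> (FP 1 ?J w x) = \<beta> w x"
  proof (rule form_tensor_lift[OF J T.abelian_group_axioms])
    show "additive_map (form_module \<Omega> 1) ?T (\<lambda>w. \<beta> w x)" if "x \<in> carrier ?J" for x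
      unfolding \<beta>_def
    proof (rule additive_map_diff[OF additive_map_comp[OF dd form_pure_additive_left[OF M evc[OF that]]]])
      show "additive_map (form_module \<Omega> 1) ?T (\<lambda>w. wedge_tensor 1 2 M w (jet1_d M x))"
        by (rule additive_mapI) (auto simp: wc dc that wedge_tensor_add[OF M _ _ l])
    qed (rule T.abelian_group_axioms)
    show "additive_map ?J ?T (\<beta> w)" if "w \<in> forms \<Omega> 1" for w
      unfolding \<beta>_def
      by (rule additive_map_diff[OF
            additive_map_comp[OF jet1_eval_lift(1)[OF M] form_pure_additive_right[OF M d_form1[OF that]]]
            additive_map_comp[OF jet1_d_lift(1)[OF M] wedge_tensor_additive[OF M that l]] T.abelian_group_axioms])
    \<comment> \<open>Both sides acquire the same extra term
      \<open>- (w \<and> da) \<otimes> ev x\<close>: on the left from \<open>d(wa)\<close>, on the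
      right from the Leibniz defect of \<open>jet1_d\<close>. Neither summand of
      \<open>\<beta>\<close> is balanced alone.\<close>
    show "\<beta> (w \<otimes>\<^bsub>\<Omega>\<^esub> a) x = \<beta> w (a \<odot>\<^bsub>?J\<^esub> x)"
      if w: "w \<in> forms \<Omega> 1" and a: "a \<in> carrier A" and x: "x \<in> carrier ?J" for w a x
    proof -
      have f: "ext_d \<Omega> w \<otimes>\<^bsub>\<Omega>\<^esub> a \<in> forms \<Omega> 2" "w \<otimes>\<^bsub>\<Omega>\<^esub> ext_d \<Omega> a \<in> forms \<Omega> 2"
        using form_act[OF d_form1[OF w] a] wedge_form[OF w d_A[OF a] l] by simp_all
      let ?p = "FP 2 M (ext_d \<Omega> w) (a \<odot>\<^bsub>M\<^esub> jet1_eval M x)"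
      let ?q = "FP 2 M (w \<otimes>\<^bsub>\<Omega>\<^esub> ext_d \<Omega> a) (jet1_eval M x)"
      let ?r = "wedge_tensor 1 2 M w (wedge_tensor 1 1 M a (jet1_d M x))"
      have 1: "(1::nat) = 0 + 1" by simp
      have wa: "wedge_tensor 1 1 M a (jet1_d M x) \<in> carrier (FT 1 M)"
        by (rule wedge_tensor_closed[OF M A_forms[OF a] 1 dc[OF x]])
      have cl: "?p \<in> carrier ?T" "?q \<in> carrier ?T" "?r \<in> carrier ?T"
        using w a x f wa by (auto intro!: pc wc d_form1 evc left_module.smult_closed[OF M])
      \<comment> \<open>Negation in a record is determined relative to its carrier, so the negative
        taken among two-forms has to be identified with the one in the whole algebra.\<close>
      have "ext_d \<Omega> (w \<otimes>\<^bsub>\<Omega>\<^esub> a) = ext_d \<Omega> w \<otimes>\<^bsub>\<Omega>\<^esub> a \<ominus>\<^bsub>form_module \<Omega> 2\<^esub> w \<otimes>\<^bsub>\<Omega>\<^esub> ext_d \<Omega> a"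
      proof -
        have "\<ominus>\<^bsub>form_module \<Omega> 2\<^esub> (w \<otimes>\<^bsub>\<Omega>\<^esub> ext_d \<Omega> a) = \<ominus>\<^bsub>\<Omega>\<^esub> (w \<otimes>\<^bsub>\<Omega>\<^esub> ext_d \<Omega> a)"
          using F2.l_neg[of "w \<otimes>\<^bsub>\<Omega>\<^esub> ext_d \<Omega> a"] F2.a_inv_closed[of "w \<otimes>\<^bsub>\<Omega>\<^esub> ext_d \<Omega> a"] f(2)
          by (intro Om.minus_equality[symmetric]) (auto simp: forms_closed)
        then show ?thesis
          using d_mult_form1[OF w A_closed[OF a]] by (simp add: a_minus_def)
      qed
      then have "FP 2 M (ext_d \<Omega> (w \<otimes>\<^bsub>\<Omega>\<^esub> a)) (jet1_eval M x) = ?p \<ominus>\<^bsub>?T\<^esub> ?q"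
        using additive_map_minus[OF form_pure_additive_left[OF M evc[OF x]]
            F2.abelian_group_axioms T.abelian_group_axioms, of "ext_d \<Omega> w \<otimes>\<^bsub>\<Omega>\<^esub> a" "w \<otimes>\<^bsub>\<Omega>\<^esub> ext_d \<Omega> a"] f
          form_pure_balanced[OF M d_form1[OF w] a evc[OF x]] by simp
      moreover have "wedge_tensor 1 2 M (w \<otimes>\<^bsub>\<Omega>\<^esub> a) (jet1_d M x) = ?r"
        by (rule wedge_tensor_assoc[OF M w a l dc[OF x]])
      moreover have "wedge_tensor 1 2 M w (jet1_d M (a \<odot>\<^bsub>?J\<^esub> x)) = ?r \<oplus>\<^bsub>?T\<^esub> ?q"
        using jet1_d_smult[OF M a x] wa evc[OF x] a
          additive_map_add[OF wedge_tensor_additive[OF M w l] wa form_pure_closed[OF M d_A[OF a] evc[OF x]]]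
        by (simp add: wedge_tensor_pure[OF M w l d_A[OF a]])
      ultimately show ?thesis
        unfolding \<beta>_def using linear_map_smult[OF ev a x] cl
        by (simp add: T.minus_eq T.minus_add T.a_ac)
    qed
  qed blast
  let ?\<phi> = "\<lambda>y. \<ominus>\<^bsub>?T\<^esub> \<psi> (jet1_d ?J y)"
  have \<phi>: "additive_map (J1 ?J) ?T ?\<phi>"
    by (rule additive_map_neg[OF additive_map_comp[OF jet1_d_lift(1)[OF J] \<psi>(1)] T.abelian_group_axioms])
  have v: "?\<phi> ((\<lambda>(a, c, x). J1_class ?J a (J1_class M c x)) t) =
      (\<lambda>(a, c, x). FP 2 M (ext_d \<Omega> a \<otimes>\<^bsub>\<Omega>\<^esub> ext_d \<Omega> c) x) t"
    if t: "t \<in> carrier A \<times> carrier A \<times> carrier M" for t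
  proof -
    obtain a c x where t: "t = (a, c, x)" "a \<in> carrier A" "c \<in> carrier A" "x \<in> carrier M"
      using t by auto
    have x: "J1_class M c x \<in> carrier ?J"
      using t by (simp add: jet1_class_closed[OF M])
    have f: "FP 2 M (ext_d \<Omega> a \<otimes>\<^bsub>\<Omega>\<^esub> ext_d \<Omega> c) x \<in> carrier ?T"
      using t by (auto intro!: pc wedge_form[OF _ _ l] d_A)
    have "\<psi> (jet1_d ?J (J1_class ?J a (J1_class M c x))) = \<beta> (ext_d \<Omega> a) (J1_class M c x)"
      using t x by (simp add: jet1_d_class[OF J] \<psi>(2) d_A)
    \<comment> \<open>As \<open>d(da) = 0\<close>, the first summand of \<open>\<beta>\<close>
      vanishes for the exact form \<open>da\<close>, and only the wedge term is left, with a minus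
      sign that \<open>?\<phi>\<close> undoes.\<close>
    also have "\<dots> = \<ominus>\<^bsub>?T\<^esub> FP 2 M (ext_d \<Omega> a \<otimes>\<^bsub>\<Omega>\<^esub> ext_d \<Omega> c) x"
      using t f form_pure_zero[OF M, of "c \<odot>\<^bsub>M\<^esub> x" 2]
      by (simp add: \<beta>_def jet1_eval_class[OF M] jet1_d_class[OF M] d_d A_closed left_module.smult_closed[OF M]
          wedge_tensor_pure[OF M d_A l] d_A T.minus_eq)
    finally show ?thesis using t(1) f by simp
  qed
  note gen = generated_by_jet1_jet1 \<phi> abelian_group_jet1[OF J] T.abelian_group_axioms v
  show "additive_map (J1 ?J) ?T (obstruction2 K A \<Omega> M)"
    unfolding obstruction2_def by (rule map_on_generators_additive'[OF gen])
  show "obstruction2 K A \<Omega> M (J1_class ?J a (J1_class M c x)) =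
        FP 2 M (ext_d \<Omega> a \<otimes>\<^bsub>\<Omega>\<^esub> ext_d \<Omega> c) x"
    if "a \<in> carrier A" "c \<in> carrier A" "x \<in> carrier M"
    using map_on_generators_value'[OF gen, where t = "(a, c, x)"] that by (simp add: obstruction2_def)
qed

lemma obstruction1_smult:
  assumes a: "a \<in> carrier A" and y: "y \<in> carrier (J1 (J1 M))"
  shows "obstruction1 K A \<Omega> M (a \<odot>\<^bsub>J1 (J1 M)\<^esub> y) = wedge_tensor 1 1 M a (obstruction1 K A \<Omega> M y)"
proof (rule additive_map_eqI[OF generated_by_jet1_jet1
      additive_map_comp[OF jet1_smult_additive[OF left_module_jet1[OF M] a] obstruction1_additive]
      additive_map_comp[OF obstruction1_additive wedge_tensor_additive[OF M A_forms[OF a]]]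
      abelian_group_jet1[OF left_module_jet1[OF M]] abelian_group_form_tensor[OF M] _ y])
  show "(1::nat) = 0 + 1" by simp
  fix t assume "t \<in> carrier A \<times> carrier A \<times> carrier M"
  then obtain b c x where t: "t = (b, c, x)" "b \<in> carrier A" "c \<in> carrier A" "x \<in> carrier M" by auto
  have "b \<otimes>\<^bsub>\<Omega>\<^esub> ext_d \<Omega> c \<in> forms \<Omega> 1" using t by (auto intro: act_form d_A)
  moreover have "(a \<otimes>\<^bsub>A\<^esub> b) \<otimes>\<^bsub>\<Omega>\<^esub> ext_d \<Omega> c = a \<otimes>\<^bsub>\<Omega>\<^esub> (b \<otimes>\<^bsub>\<Omega>\<^esub> ext_d \<Omega> c)"
    using a t by (simp add: mult_A Om.m_assoc A_closed d_closed)
  ultimately show "obstruction1 K A \<Omega> M (a \<odot>\<^bsub>J1 (J1 M)\<^esub>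
        ((\<lambda>(a, c, x). J1_class (J1 M) a (J1_class M c x)) t)) =
      wedge_tensor 1 1 M a (obstruction1 K A \<Omega> M
        ((\<lambda>(a, c, x). J1_class (J1 M) a (J1_class M c x)) t))"
    using t a
    by (simp add: jet1_smult_class[OF left_module_jet1[OF M]] jet1_class_closed[OF M] obstruction1_class
        wedge_tensor_pure[OF M A_forms[OF a]])
qed

text \<open>From \<open>d(ab) \<and> dc = a db \<and> dc + da \<and> b dc\<close>: the defect of
  linearity is the first obstruction wedged with \<open>da\<close>. Hence the kernel of this map
  alone need not be a submodule, but its intersection with the kernel of the first obstruction
  is.\<close>

lemma obstruction2_smult:
  assumes a: "a \<in> carrier A" and y: "y \<in> carrier (J1 (J1 M))"
  shows "obstruction2 K A \<Omega> M (a \<odot>\<^bsub>J1 (J1 M)\<^esub> y) =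
    wedge_tensor 2 2 M a (obstruction2 K A \<Omega> M y) \<oplus>\<^bsub>FT 2 M\<^esub>
    wedge_tensor 1 2 M (ext_d \<Omega> a) (obstruction1 K A \<Omega> M y)"
proof (rule additive_map_eqI[OF generated_by_jet1_jet1
      additive_map_comp[OF jet1_smult_additive[OF left_module_jet1[OF M] a] obstruction2_additive]
      additive_map_sum[OF additive_map_comp[OF obstruction2_additive wedge_tensor_additive[OF M A_forms[OF a]]]
        additive_map_comp[OF obstruction1_additive wedge_tensor_additive[OF M d_A[OF a]]]
        abelian_group_form_tensor[OF M]]
      abelian_group_jet1[OF left_module_jet1[OF M]] abelian_group_form_tensor[OF M] _ y])
  show l: "(2::nat) = 0 + 2" "(2::nat) = 1 + 1" by simp_all
  interpret T: abelian_group "FT 2 M" by (rule abelian_group_form_tensor[OF M])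
  fix t assume "t \<in> carrier A \<times> carrier A \<times> carrier M"
  then obtain b c x where t: "t = (b, c, x)" "b \<in> carrier A" "c \<in> carrier A" "x \<in> carrier M" by auto
  have f: "b \<otimes>\<^bsub>\<Omega>\<^esub> ext_d \<Omega> c \<in> forms \<Omega> 1" "ext_d \<Omega> b \<otimes>\<^bsub>\<Omega>\<^esub> ext_d \<Omega> c \<in> forms \<Omega> 2"
    using t by (auto intro!: act_form d_A wedge_form[OF _ _ l(2)])
  let ?u = "a \<otimes>\<^bsub>\<Omega>\<^esub> (ext_d \<Omega> b \<otimes>\<^bsub>\<Omega>\<^esub> ext_d \<Omega> c)" and ?v = "ext_d \<Omega> a \<otimes>\<^bsub>\<Omega>\<^esub> (b \<otimes>\<^bsub>\<Omega>\<^esub> ext_d \<Omega> c)"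
  have uv: "?u \<in> forms \<Omega> 2" "?v \<in> forms \<Omega> 2"
    using act_form[OF f(2) a] wedge_form[OF d_A[OF a] f(1) l(2)] by simp_all
  have "ext_d \<Omega> (a \<otimes>\<^bsub>A\<^esub> b) \<otimes>\<^bsub>\<Omega>\<^esub> ext_d \<Omega> c = ?u \<oplus>\<^bsub>\<Omega>\<^esub> ?v"
    using a t by (simp add: d_mult A_closed d_closed Om.l_distr Om.m_assoc Om.a_comm)
  then have "FP 2 M (ext_d \<Omega> (a \<otimes>\<^bsub>A\<^esub> b) \<otimes>\<^bsub>\<Omega>\<^esub> ext_d \<Omega> c) x =
      FP 2 M ?u x \<oplus>\<^bsub>FT 2 M\<^esub> FP 2 M ?v x"
    using additive_map_add[OF form_pure_additive_left[OF M t(4), of 2], of ?u ?v] uv by simp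
  then show "obstruction2 K A \<Omega> M (a \<odot>\<^bsub>J1 (J1 M)\<^esub>
        ((\<lambda>(a, c, x). J1_class (J1 M) a (J1_class M c x)) t)) =
      wedge_tensor 2 2 M a (obstruction2 K A \<Omega> M
        ((\<lambda>(a, c, x). J1_class (J1 M) a (J1_class M c x)) t)) \<oplus>\<^bsub>FT 2 M\<^esub>
      wedge_tensor 1 2 M (ext_d \<Omega> a) (obstruction1 K A \<Omega> M
        ((\<lambda>(a, c, x). J1_class (J1 M) a (J1_class M c x)) t))"
    using t a f
    by (simp add: jet1_smult_class[OF left_module_jet1[OF M]] jet1_class_closed[OF M]
        obstruction1_class obstruction2_class
        wedge_tensor_pure[OF M A_forms[OF a] l(1)] wedge_tensor_pure[OF M d_A[OF a] l(2)])
qed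

end

end

section \<open>Iterated jets\<close>

context exterior_algebra
begin

text \<open>A representing list exists because the classes generate the first jet module, so the
  choice in \<open>jet_encode\<close> meets its specification; in particular encoding is
  injective.\<close>

lemma jet_decode_encode:
  assumes M: "left_module A M" and x: "x \<in> carrier (J1 M)"
  shows "jet_decode K A \<Omega> M (jet_encode K A \<Omega> M x) = x"
proof -
  obtain ts where "set ts \<subseteq> carrier A \<times> carrier M"
    "x = list_sum (J1 M) (map (\<lambda>(a, x). J1_class M a x) ts)"
    using generated_by_jet1_class[OF M] x by (rule generated_byE)
  then have "\<exists>ts. set ts \<subseteq> carrier A \<times> carrier M \<and> jet_decode K A \<Omega> M (Prolonged ts) = x"
    by auto
  from someI_ex[OF this] show ?thesis unfolding jet_encode_def by blast
qed

lemma jet1_prolong_closed: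
  "\<lbrakk>left_module A M; x \<in> carrier M\<rbrakk> \<Longrightarrow> jet1_prolong K A \<Omega> M x \<in> carrier (J1 M)"
  unfolding jet1_prolong_def by (simp add: jet1_class_closed)

lemma jet1_eval_prolong:
  "\<lbrakk>left_module A M; x \<in> carrier M\<rbrakk> \<Longrightarrow> jet1_eval M (jet1_prolong K A \<Omega> M x) = x"
  unfolding jet1_prolong_def by (simp add: jet1_eval_class left_module.smult_one)

text \<open>The carrier condition from the recursion of \<open>jet\<close>, with the inclusion
  \<open>l\<close> kept as a parameter so that the submodule property can be proved apart from any
  encoding.\<close>

definition prolongable ::
  "('a, 'm) module \<Rightarrow> ('a, 'n) module \<Rightarrow> ('n \<Rightarrow> (('a \<times> 'm) \<Rightarrow>\<^sub>0 int) set set)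
    \<Rightarrow> (('a \<times> 'n) \<Rightarrow>\<^sub>0 int) set set set" where
  "prolongable M N l = {x \<in> carrier (J1 N).
     let y = jet1_map K A \<Omega> N (J1 M) l x
     in obstruction1 K A \<Omega> M y = \<zero>\<^bsub>FT 1 M\<^esub> \<and>
        obstruction2 K A \<Omega> M y = \<zero>\<^bsub>FT 2 M\<^esub>}"

context
  fixes M :: "('a, 'm) module" and N :: "('a, 'n) module" and l
  assumes M: "left_module A M" and N: "left_module A N"
    and l: "linear_map A N (J1 M) l"
begin

lemma prolongable_iff: "x \<in> prolongable M N l \<longleftrightarrow> x \<in> carrier (J1 N) \<and>
    obstruction1 K A \<Omega> M (jet1_map K A \<Omega> N (J1 M) l x) = \<zero>\<^bsub>FT 1 M\<^esub> \<and>
    obstruction2 K A \<Omega> M (jet1_map K A \<Omega> N (J1 M) l x) = \<zero>\<^bsub>FT 2 M\<^esub>"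
  by (simp add: prolongable_def Let_def)

text \<open>Closure under addition holds because both conditions cut out kernels of additive maps.
  For closure under scalars the two must be used together: the first makes the defect in the second
  vanish.\<close>

lemma left_module_prolongable: "left_module A ((J1 N)\<lparr>carrier := prolongable M N l\<rparr>)"
proof (rule left_module_restrict[OF left_module_jet1[OF N]])
  interpret T1: abelian_group "FT 1 M" by (rule abelian_group_form_tensor[OF M])
  interpret T2: abelian_group "FT 2 M" by (rule abelian_group_form_tensor[OF M])
  interpret J: abelian_group "J1 N" by (rule abelian_group_jet1[OF N])
  note j = jet1_map_linear[OF N left_module_jet1[OF M] l]
  note o1 = additive_map_comp[OF linear_map_additive[OF j] obstruction1_additive[OF M]]
  note o2 = additive_map_comp[OF linear_map_additive[OF j] obstruction2_additive[OF M]]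
  note ab1 = J.abelian_group_axioms T1.abelian_group_axioms
  note ab2 = J.abelian_group_axioms T2.abelian_group_axioms
  show "additive_subgroup (prolongable M N l) (J1 N)"
  proof (rule additive_subgroupI'[OF J.abelian_group_axioms])
    show "prolongable M N l \<subseteq> carrier (J1 N)" by (auto simp: prolongable_iff)
    show "\<zero>\<^bsub>J1 N\<^esub> \<in> prolongable M N l"
      using additive_map_zero[OF o1 ab1] additive_map_zero[OF o2 ab2] by (simp add: prolongable_iff)
    show "x \<oplus>\<^bsub>J1 N\<^esub> y \<in> prolongable M N l"
      if "x \<in> prolongable M N l" "y \<in> prolongable M N l" for x y
      using that additive_map_add[OF o1, of x y] additive_map_add[OF o2, of x y]
      by (simp add: prolongable_iff)
    show "\<ominus>\<^bsub>J1 N\<^esub> x \<in> prolongable M N l" if "x \<in> prolongable M N l" for x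
      using that additive_map_uminus[OF o1 ab1, of x] additive_map_uminus[OF o2 ab2, of x]
      by (simp add: prolongable_iff)
  qed
  fix a x assume a: "a \<in> carrier A" and x: "x \<in> prolongable M N l"
  have c: "x \<in> carrier (J1 N)" using x by (simp add: prolongable_iff)
  note jc = linear_map_closed[OF j c]
  have "(1::nat) = 0 + 1" "(2::nat) = 0 + 2" "(2::nat) = 1 + 1" by simp_all
  note w = wedge_tensor_zero[OF M A_forms[OF a] this(1)] wedge_tensor_zero[OF M A_forms[OF a] this(2)]
    wedge_tensor_zero[OF M d_A[OF a] this(3)]
  show "a \<odot>\<^bsub>J1 N\<^esub> x \<in> prolongable M N l"
    using x c linear_map_smult[OF j a c] obstruction1_smult[OF M a jc] obstruction2_smult[OF M a jc] w
      additive_map_closed[OF jet1_smult_additive[OF N a] c]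
    by (simp add: prolongable_iff)
qed

text \<open>Applying the jet functor to \<open>l\<close> turns the prolongation of \<open>x\<close>
  into the class of \<open>1 \<otimes> [1 \<otimes> y]\<close>, on which both obstructions contain
  the factor \<open>d 1 = 0\<close>.\<close>

lemma jet1_prolong_prolongable:
  assumes x: "x \<in> carrier N" and y: "y \<in> carrier M" and lx: "l x = jet1_prolong K A \<Omega> M y"
  shows "jet1_prolong K A \<Omega> N x \<in> prolongable M N l"
  using jet1_map_class[OF N left_module_jet1[OF M] l _ x, of "\<one>\<^bsub>A\<^esub>"] jet1_prolong_closed[OF N x]
    form_pure_zero[OF M y] A_closed[of "\<one>\<^bsub>A\<^esub>"] y
  by (simp add: prolongable_iff jet1_prolong_def lx obstruction1_class[OF M] obstruction2_class[OF M] d_one)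

end

lemma jet_Suc_Suc:
  "jet K A \<Omega> E (Suc (Suc n)) =
    transport_module (jet_encode K A \<Omega> (jet K A \<Omega> E (Suc n))) (jet_decode K A \<Omega> (jet K A \<Omega> E (Suc n)))
      ((J1 (jet K A \<Omega> E (Suc n)))\<lparr>carrier := prolongable (jet K A \<Omega> E n) (jet K A \<Omega> E (Suc n))
        (jet_decode K A \<Omega> (jet K A \<Omega> E n))\<rparr>)"
  by (simp add: prolongable_def Let_def)

context
  fixes E :: "('a, 'e) module"
  assumes E: "left_module A E"
begin

text \<open>The recursion for order \<open>n + 2\<close> refers to the jets of orders
  \<open>n\<close> and \<open>n + 1\<close> and to the inclusion of the latter in first jets of the
  former, so all three facts travel together. The base case covers orders 0 and 1, where nothing is
  cut out.\<close>

lemma jet_structure: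
  "left_module A (jet K A \<Omega> E n) \<and> left_module A (jet K A \<Omega> E (Suc n)) \<and>
   linear_map A (jet K A \<Omega> E (Suc n)) (J1 (jet K A \<Omega> E n)) (jet_decode K A \<Omega> (jet K A \<Omega> E n))"
proof (induction n)
  case 0
  have 0: "left_module A (jet K A \<Omega> E 0)"
    using left_module_transport[OF E, of zeroth Zeroth] by simp
  note inv = jet_decode_encode[OF 0]
  show ?case
    using 0 left_module_transport[where f = "jet_encode K A \<Omega> (jet K A \<Omega> E 0)", OF left_module_jet1[OF 0] inv]
      linear_map_transport[where f = "jet_encode K A \<Omega> (jet K A \<Omega> E 0)", OF left_module_jet1[OF 0] inv]
    by simp
next
  case (Suc n)
  let ?M = "jet K A \<Omega> E n" and ?N = "jet K A \<Omega> E (Suc n)"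
  let ?J = "(J1 ?N)\<lparr>carrier := prolongable ?M ?N (jet_decode K A \<Omega> ?M)\<rparr>"
  from Suc have M: "left_module A ?M" and N: "left_module A ?N"
    and l: "linear_map A ?N (J1 ?M) (jet_decode K A \<Omega> ?M)" by auto
  note P = left_module_prolongable[OF M N l]
  have sub: "x \<in> carrier (J1 ?N)" if "x \<in> carrier ?J" for x
    using that prolongable_iff[OF M N l] by simp
  have inv: "jet_decode K A \<Omega> ?N (jet_encode K A \<Omega> ?N x) = x" if "x \<in> carrier ?J" for x
    by (rule jet_decode_encode[OF N sub[OF that]])
  have "linear_map A (jet K A \<Omega> E (Suc (Suc n))) ?J (jet_decode K A \<Omega> ?N)"
    unfolding jet_Suc_Suc by (rule linear_map_transport[where g = "jet_decode K A \<Omega> ?N" and f = "jet_encode K A \<Omega> ?N", OF P inv])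
  \<comment> \<open>The target is enlarged from the submodule of prolongable elements to the whole
    first jet module; the operations are the same.\<close>
  then have "linear_map A (jet K A \<Omega> E (Suc (Suc n))) (J1 ?N) (jet_decode K A \<Omega> ?N)"
    using sub unfolding linear_map_def by (auto simp: Pi_iff)
  then show ?case
    using N left_module_transport[where g = "jet_decode K A \<Omega> ?N" and f = "jet_encode K A \<Omega> ?N", OF P inv] unfolding jet_Suc_Suc by blast
qed

lemma left_module_jet: "left_module A (jet K A \<Omega> E n)"
  and jet_decode_linear:
    "linear_map A (jet K A \<Omega> E (Suc n)) (J1 (jet K A \<Omega> E n)) (jet_decode K A \<Omega> (jet K A \<Omega> E n))"
  using jet_structure by auto

text \<open>The decoding equation is the defining relation between successive prolongations. It is
  carried in the induction because membership at the next order is derived from it.\<close>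

lemma jet_prolong_structure:
  assumes e: "e \<in> carrier E"
  shows "jet_prolong K A \<Omega> E n e \<in> carrier (jet K A \<Omega> E n) \<and>
    jet_prolong K A \<Omega> E (Suc n) e \<in> carrier (jet K A \<Omega> E (Suc n)) \<and>
    jet_decode K A \<Omega> (jet K A \<Omega> E n) (jet_prolong K A \<Omega> E (Suc n) e) =
      jet1_prolong K A \<Omega> (jet K A \<Omega> E n) (jet_prolong K A \<Omega> E n e)"
proof (induction n)
  case 0
  have 0: "jet_prolong K A \<Omega> E 0 e \<in> carrier (jet K A \<Omega> E 0)" using e by simp
  note p = jet1_prolong_closed[OF left_module_jet 0]
  show ?case
    using 0 p jet_decode_encode[OF left_module_jet p] by simp
next
  case (Suc n)
  let ?M = "jet K A \<Omega> E n" and ?N = "jet K A \<Omega> E (Suc n)"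
  let ?x = "jet_prolong K A \<Omega> E n e" and ?y = "jet_prolong K A \<Omega> E (Suc n) e"
  have "jet1_prolong K A \<Omega> ?N ?y \<in> prolongable ?M ?N (jet_decode K A \<Omega> ?M)"
    using Suc by (intro jet1_prolong_prolongable[OF left_module_jet left_module_jet jet_decode_linear]) auto
  moreover have y: "?y \<in> carrier ?N" using Suc by blast
  moreover have "jet_prolong K A \<Omega> E (Suc (Suc n)) e = jet_encode K A \<Omega> ?N (jet1_prolong K A \<Omega> ?N ?y)"
    by simp
  ultimately show ?case
    using jet_decode_encode[OF left_module_jet jet1_prolong_closed[OF left_module_jet y]]
    unfolding jet_Suc_Suc by simp
qed

lemma jet_projection:
  defines "P n \<equiv> \<lambda>x. jet1_eval (jet K A \<Omega> E n) (jet_decode K A \<Omega> (jet K A \<Omega> E n) x)"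
  shows "linear_map A (jet K A \<Omega> E (Suc n)) (jet K A \<Omega> E n) (P n)"
    and "e \<in> carrier E \<Longrightarrow> P n (jet_prolong K A \<Omega> E (Suc n) e) = jet_prolong K A \<Omega> E n e"
  unfolding P_def
  by (rule linear_map_comp[OF jet_decode_linear jet1_eval_linear[OF left_module_jet]])
    (use jet_prolong_structure[of e n] jet1_eval_prolong[OF left_module_jet] in metis)

lemma diffops_Suc: "diffops K A \<Omega> E F n \<subseteq> diffops K A \<Omega> E F (Suc n)"
proof
  fix \<Delta> assume "\<Delta> \<in> diffops K A \<Omega> E F n"
  then obtain \<Delta>' where \<Delta>: "\<Delta> \<in> lin_hom K (scalar_module A E) (scalar_module A F)"
    "linear_map A (jet K A \<Omega> E n) F \<Delta>'"
    "\<And>e. e \<in> carrier E \<Longrightarrow> \<Delta>' (jet_prolong K A \<Omega> E n e) = \<Delta> e"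
    unfolding diffops_def by blast
  note P = jet_projection(1)[of n] jet_projection(2)[of _ n]
  show "\<Delta> \<in> diffops K A \<Omega> E F (Suc n)"
    unfolding diffops_def
    using \<Delta>(1) linear_map_comp[OF P(1) \<Delta>(2)] P(2) \<Delta>(3) by fastforce
qed

end

end

section \<open>Differential operators and symbols\<close>

text \<open>The support changes from family to family; summing over a larger common finite set
  allows termwise comparison.\<close>

lemma (in abelian_monoid) supp_sum_eq_finsum:
  assumes "finite B" "{n. x n \<noteq> \<zero>} \<subseteq> B" "x \<in> B \<rightarrow> carrier G"
  shows "supp_sum G x = (\<Oplus>n\<in>B. x n)"
  unfolding supp_sum_def by (rule add.finprod_mono_neutral_cong_left) (use assms in auto)

lemma additive_map_finsum:
  assumes f: "additive_map M N f" and M: "abelian_group M" and N: "abelian_group N"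
    and "finite B" "x \<in> B \<rightarrow> carrier M"
  shows "f (\<Oplus>\<^bsub>M\<^esub>n\<in>B. x n) = (\<Oplus>\<^bsub>N\<^esub>n\<in>B. f (x n))"
proof -
  interpret M: abelian_group M by fact
  interpret N: abelian_group N by fact
  show ?thesis
    using assms(4,5)
  proof (induction B)
    case empty
    show ?case using additive_map_zero[OF f M N] by simp
  next
    case (insert n B)
    then have "(\<lambda>n. f (x n)) \<in> B \<rightarrow> carrier N" "f (x n) \<in> carrier N" "x \<in> B \<rightarrow> carrier M" "x n \<in> carrier M"
      using additive_map_closed[OF f] by auto
    with insert show ?case
      by (simp add: additive_map_add[OF f] M.finsum_closed)
  qed
qed

text \<open>Arguments of \<open>g\<close> are written as values of \<open>f\<close>, and linearity
  of \<open>f\<close> is read backwards. It will spare a direct computation with truncations when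
  linearity of the total symbol is proved.\<close>

lemma linear_map_inverse:
  assumes f: "linear_map R M N f"
    and M: "\<And>x y. \<lbrakk>x \<in> carrier M; y \<in> carrier M\<rbrakk> \<Longrightarrow> x \<oplus>\<^bsub>M\<^esub> y \<in> carrier M"
      "\<And>a x. \<lbrakk>a \<in> carrier R; x \<in> carrier M\<rbrakk> \<Longrightarrow> a \<odot>\<^bsub>M\<^esub> x \<in> carrier M"
    and g: "\<And>y. y \<in> carrier N \<Longrightarrow> g y \<in> carrier M"
    and fg: "\<And>y. y \<in> carrier N \<Longrightarrow> f (g y) = y" and gf: "\<And>x. x \<in> carrier M \<Longrightarrow> g (f x) = x"
  shows "linear_map R N M g"
proof (intro linear_mapI additive_mapI)
  fix y z assume y: "y \<in> carrier N" "z \<in> carrier N"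
  have "g (y \<oplus>\<^bsub>N\<^esub> z) = g (f (g y \<oplus>\<^bsub>M\<^esub> g z))"
    using additive_map_add[OF linear_map_additive[OF f] g[OF y(1)] g[OF y(2)]] fg y by simp
  then show "g (y \<oplus>\<^bsub>N\<^esub> z) = g y \<oplus>\<^bsub>M\<^esub> g z"
    using gf M g y by simp
next
  fix a y assume a: "a \<in> carrier R" and y: "y \<in> carrier N"
  have "g (a \<odot>\<^bsub>N\<^esub> y) = g (f (a \<odot>\<^bsub>M\<^esub> g y))"
    using linear_map_smult[OF f a g[OF y]] fg y by simp
  then show "g (a \<odot>\<^bsub>N\<^esub> y) = a \<odot>\<^bsub>M\<^esub> g y"
    using gf M g a y by simp
qed (rule g)

lemma restrict_scalars_sel [simp]:
  "carrier (restrict_scalars \<phi> M) = carrier M" "\<zero>\<^bsub>restrict_scalars \<phi> M\<^esub> = \<zero>\<^bsub>M\<^esub>"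
  "x \<oplus>\<^bsub>restrict_scalars \<phi> M\<^esub> y = x \<oplus>\<^bsub>M\<^esub> y" "c \<odot>\<^bsub>restrict_scalars \<phi> M\<^esub> x = \<phi> c \<odot>\<^bsub>M\<^esub> x"
  by (simp_all add: restrict_scalars_def)

lemma linear_map_restrict_scalars:
  "\<lbrakk>linear_map R M N f; \<And>c. c \<in> carrier K \<Longrightarrow> \<phi> c \<in> carrier R\<rbrakk>
    \<Longrightarrow> linear_map K (restrict_scalars \<phi> M) (restrict_scalars \<phi> N) f"
  by (auto simp: linear_map_def)

lemma map_module_sel [simp]:
  "carrier (map_module E F S) = S" "\<zero>\<^bsub>map_module E F S\<^esub> = (\<lambda>e\<in>carrier E. \<zero>\<^bsub>F\<^esub>)"
  "\<Delta> \<oplus>\<^bsub>map_module E F S\<^esub> \<Delta>' = (\<lambda>e\<in>carrier E. \<Delta> e \<oplus>\<^bsub>F\<^esub> \<Delta>' e)"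
  "h \<odot>\<^bsub>map_module E F S\<^esub> \<Delta> = compose (carrier E) h \<Delta>"
  by (simp_all add: map_module_def)

text \<open>The pointwise formula for negatives is recorded because negation is determined by the
  carrier of a record; it is what identifies subtraction in \<open>Diff\<close> with subtraction at
  a fixed order.\<close>

lemma abelian_group_map_module:
  assumes F: "abelian_group F" and S: "S \<subseteq> carrier E \<rightarrow>\<^sub>E carrier F"
    and "(\<lambda>e\<in>carrier E. \<zero>\<^bsub>F\<^esub>) \<in> S"
    and "\<And>\<Delta> \<Delta>'. \<lbrakk>\<Delta> \<in> S; \<Delta>' \<in> S\<rbrakk> \<Longrightarrow> (\<lambda>e\<in>carrier E. \<Delta> e \<oplus>\<^bsub>F\<^esub> \<Delta>' e) \<in> S"
    and neg: "\<And>\<Delta>. \<Delta> \<in> S \<Longrightarrow> (\<lambda>e\<in>carrier E. \<ominus>\<^bsub>F\<^esub> \<Delta> e) \<in> S"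
  shows "abelian_group (map_module E F S)"
    and "\<Delta> \<in> S \<Longrightarrow> \<ominus>\<^bsub>map_module E F S\<^esub> \<Delta> = (\<lambda>e\<in>carrier E. \<ominus>\<^bsub>F\<^esub> \<Delta> e)"
proof -
  interpret F: abelian_group F by fact
  have c: "\<Delta> e \<in> carrier F" if "\<Delta> \<in> S" "e \<in> carrier E" for \<Delta> e
    using that S by auto
  have x: "restrict \<Delta> (carrier E) = \<Delta>" if "\<Delta> \<in> S" for \<Delta>
    using that S by (auto simp: PiE_def extensional_restrict)
  show g: "abelian_group (map_module E F S)"
  proof (rule abelian_groupI)
    fix \<Delta> assume \<Delta>: "\<Delta> \<in> carrier (map_module E F S)"
    then show "\<exists>\<Delta>'\<in>carrier (map_module E F S). \<Delta>' \<oplus>\<^bsub>map_module E F S\<^esub> \<Delta> = \<zero>\<^bsub>map_module E F S\<^esub>"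
      using neg[of \<Delta>] by (intro bexI[of _ "\<lambda>e\<in>carrier E. \<ominus>\<^bsub>F\<^esub> \<Delta> e"]) (auto simp: c F.l_neg intro!: restrict_ext)
    show "\<zero>\<^bsub>map_module E F S\<^esub> \<oplus>\<^bsub>map_module E F S\<^esub> \<Delta> = \<Delta>"
      using x[of \<Delta>] \<Delta> by (simp add: c cong: restrict_cong)
  qed (use assms in \<open>auto simp: c F.a_ac intro!: restrict_ext\<close>)
  interpret g: abelian_group "map_module E F S" by (rule g)
  show "\<ominus>\<^bsub>map_module E F S\<^esub> \<Delta> = (\<lambda>e\<in>carrier E. \<ominus>\<^bsub>F\<^esub> \<Delta> e)" if "\<Delta> \<in> S"
    using that neg[OF that] by (intro g.minus_equality) (auto simp: c F.l_neg intro!: restrict_ext)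
qed

context exterior_algebra
begin

context
  fixes E :: "('a, 'e) module"
  assumes E: "left_module A E"
begin

abbreviation "ops F n \<equiv> diffops K A \<Omega> E F n"
abbreviation "lower F n \<equiv> lower_diffops K A \<Omega> E F n"

section \<open>Closure properties of operators of bounded order\<close>

lemma diffopsE:
  assumes "\<Delta> \<in> ops F n"
  obtains \<Delta>' where "linear_map K (scalar_module A E) (scalar_module A F) \<Delta>"
    "linear_map A (jet K A \<Omega> E n) F \<Delta>'"
    "\<forall>e\<in>carrier E. \<Delta>' (jet_prolong K A \<Omega> E n e) = \<Delta> e"
  using assms unfolding diffops_def lin_hom_def by blast

text \<open>Restricting to the carrier of \<open>E\<close> supplies the extensionality demanded of
  members of Hom sets and leaves the linear map on jets unchanged.\<close>

lemma diffopsI: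
  assumes "linear_map K (scalar_module A E) (scalar_module A F) \<Delta>"
    "linear_map A (jet K A \<Omega> E n) F \<Delta>'"
    "\<forall>e\<in>carrier E. \<Delta>' (jet_prolong K A \<Omega> E n e) = \<Delta> e"
  shows "(\<lambda>e\<in>carrier E. \<Delta> e) \<in> ops F n"
proof -
  interpret left_module A E by (rule E)
  have "linear_map K (scalar_module A E) (scalar_module A F) (\<lambda>e\<in>carrier E. \<Delta> e)"
    using assms(1) by (auto simp: linear_map_def smult_closed)
  then show ?thesis
    using assms(2,3) unfolding diffops_def lin_hom_def by auto
qed

lemma diffops_mono: "m \<le> n \<Longrightarrow> ops F m \<subseteq> ops F n"
  using lift_Suc_mono_le[of "ops F"] diffops_Suc[OF E] by blast

lemma diffops_funcset: "ops F n \<subseteq> carrier E \<rightarrow>\<^sub>E carrier F"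
  by (auto simp: diffops_def lin_hom_def linear_map_def PiE_def)

lemma diffops_compose:
  assumes \<Delta>: "\<Delta> \<in> ops F n" and f: "linear_map A F G f"
  shows "compose (carrier E) f \<Delta> \<in> ops G n"
proof -
  obtain \<Delta>' where \<Delta>: "linear_map K (scalar_module A E) (scalar_module A F) \<Delta>"
    "linear_map A (jet K A \<Omega> E n) F \<Delta>'"
    "\<forall>e\<in>carrier E. \<Delta>' (jet_prolong K A \<Omega> E n e) = \<Delta> e"
    using \<Delta> by (rule diffopsE)
  have "linear_map K (scalar_module A F) (scalar_module A G) f"
    using f by (auto simp: linear_map_def)
  from linear_map_comp[OF \<Delta>(1) this] linear_map_comp[OF \<Delta>(2) f] \<Delta>(3)
  show ?thesis unfolding compose_def by (intro diffopsI) auto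
qed

context
  fixes F :: "('a, 'f) module"
  assumes F: "left_module A F"
begin

interpretation F: left_module A F by (rule F)

lemma diffops_zero: "(\<lambda>e\<in>carrier E. \<zero>\<^bsub>F\<^esub>) \<in> ops F n"
proof (rule diffopsI)
  have z: "a \<odot>\<^bsub>F\<^esub> \<zero>\<^bsub>F\<^esub> = \<zero>\<^bsub>F\<^esub>" if "a \<in> carrier A" for a
    by (rule additive_map_zero[OF left_module_smult_additive[OF F that]]) (rule F.M.abelian_group_axioms)+
  show "linear_map K (scalar_module A E) (scalar_module A F) (\<lambda>e. \<zero>\<^bsub>F\<^esub>)"
    "linear_map A (jet K A \<Omega> E n) F (\<lambda>x. \<zero>\<^bsub>F\<^esub>)"
    by (auto simp: linear_map_def z)
qed simp

lemma diffops_add: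
  assumes "\<Delta>1 \<in> ops F n" "\<Delta>2 \<in> ops F n"
  shows "(\<lambda>e\<in>carrier E. \<Delta>1 e \<oplus>\<^bsub>F\<^esub> \<Delta>2 e) \<in> ops F n"
proof -
  obtain \<Delta>1' where 1: "linear_map K (scalar_module A E) (scalar_module A F) \<Delta>1"
    "linear_map A (jet K A \<Omega> E n) F \<Delta>1'"
    "\<forall>e\<in>carrier E. \<Delta>1' (jet_prolong K A \<Omega> E n e) = \<Delta>1 e"
    using assms(1) by (rule diffopsE)
  obtain \<Delta>2' where 2: "linear_map K (scalar_module A E) (scalar_module A F) \<Delta>2"
    "linear_map A (jet K A \<Omega> E n) F \<Delta>2'"
    "\<forall>e\<in>carrier E. \<Delta>2' (jet_prolong K A \<Omega> E n e) = \<Delta>2 e"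
    using assms(2) by (rule diffopsE)
  show ?thesis
  proof (rule diffopsI)
    show "linear_map K (scalar_module A E) (scalar_module A F) (\<lambda>e. \<Delta>1 e \<oplus>\<^bsub>F\<^esub> \<Delta>2 e)"
      using 1(1) 2(1) scalar_one_closed
      by (auto simp: linear_map_def Pi_iff F.smult_r_distr F.M.a_ac)
    show "linear_map A (jet K A \<Omega> E n) F (\<lambda>x. \<Delta>1' x \<oplus>\<^bsub>F\<^esub> \<Delta>2' x)"
      using 1(2) 2(2) by (auto simp: linear_map_def Pi_iff F.smult_r_distr F.M.a_ac)
  qed (simp add: 1(3) 2(3))
qed

lemma diffops_uminus:
  assumes "\<Delta> \<in> ops F n"
  shows "(\<lambda>e\<in>carrier E. \<ominus>\<^bsub>F\<^esub> \<Delta> e) \<in> ops F n"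
proof -
  have "linear_map A F F (\<lambda>x. \<ominus>\<^bsub>F\<^esub> x)"
  proof (rule linear_mapI[OF additive_map_neg[OF additive_map_id F.M.abelian_group_axioms]])
    fix a x assume "a \<in> carrier A" "x \<in> carrier F"
    then show "\<ominus>\<^bsub>F\<^esub> (a \<odot>\<^bsub>F\<^esub> x) = a \<odot>\<^bsub>F\<^esub> (\<ominus>\<^bsub>F\<^esub> x)"
      using additive_map_uminus[OF left_module_smult_additive[OF F]] F.M.abelian_group_axioms by metis
  qed
  from diffops_compose[OF assms this] show ?thesis by (simp add: compose_def)
qed

text \<open>At \<open>n = 0\<close> the set is the singleton standing for operators of order at most
  -1, so the claims reduce to \<open>0 + 0 = 0\<close> and \<open>- 0 = 0\<close> in
  \<open>F\<close>; otherwise they are those for order \<open>n - 1\<close>.\<close>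

lemma lower_diffops_closed:
  "(\<lambda>e\<in>carrier E. \<zero>\<^bsub>F\<^esub>) \<in> lower F n"
  "\<lbrakk>\<Delta> \<in> lower F n; \<Delta>' \<in> lower F n\<rbrakk> \<Longrightarrow> (\<lambda>e\<in>carrier E. \<Delta> e \<oplus>\<^bsub>F\<^esub> \<Delta>' e) \<in> lower F n"
  "\<Delta> \<in> lower F n \<Longrightarrow> (\<lambda>e\<in>carrier E. \<ominus>\<^bsub>F\<^esub> \<Delta> e) \<in> lower F n"
proof -
  have m0: "\<ominus>\<^bsub>F\<^esub> \<zero>\<^bsub>F\<^esub> = \<zero>\<^bsub>F\<^esub>"
    by (rule F.M.minus_equality) simp_all
  show "(\<lambda>e\<in>carrier E. \<zero>\<^bsub>F\<^esub>) \<in> lower F n"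
    by (cases n) (simp_all add: diffops_zero)
  show "\<Delta> \<in> lower F n \<Longrightarrow> \<Delta>' \<in> lower F n \<Longrightarrow> (\<lambda>e\<in>carrier E. \<Delta> e \<oplus>\<^bsub>F\<^esub> \<Delta>' e) \<in> lower F n"
    by (cases n) (simp_all add: diffops_add cong: restrict_cong)
  show "\<Delta> \<in> lower F n \<Longrightarrow> (\<lambda>e\<in>carrier E. \<ominus>\<^bsub>F\<^esub> \<Delta> e) \<in> lower F n"
    by (cases n) (simp_all add: diffops_uminus m0 cong: restrict_cong)
qed

lemma lower_diffops_subset: "lower F n \<subseteq> ops F n"
  by (cases n) (use diffops_zero diffops_Suc[OF E] in auto)

lemma diffops_lower: "m < n \<Longrightarrow> ops F m \<subseteq> lower F n"
  by (cases n) (use diffops_mono[of m "n - 1" F] in auto)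

section \<open>Groups of operators and of symbols\<close>

lemma Diff_n_sel [simp]:
  "carrier (Diff_n K A \<Omega> E F n) = ops F n" "\<zero>\<^bsub>Diff_n K A \<Omega> E F n\<^esub> = (\<lambda>e\<in>carrier E. \<zero>\<^bsub>F\<^esub>)"
  "\<Delta> \<oplus>\<^bsub>Diff_n K A \<Omega> E F n\<^esub> \<Delta>' = (\<lambda>e\<in>carrier E. \<Delta> e \<oplus>\<^bsub>F\<^esub> \<Delta>' e)"
  "h \<odot>\<^bsub>Diff_n K A \<Omega> E F n\<^esub> \<Delta> = compose (carrier E) h \<Delta>"
  by (simp_all add: Diff_n_def)

lemma Diff_sel [simp]:
  "carrier (Diff K A \<Omega> E F) = (\<Union>n. ops F n)" "\<zero>\<^bsub>Diff K A \<Omega> E F\<^esub> = (\<lambda>e\<in>carrier E. \<zero>\<^bsub>F\<^esub>)"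
  "\<Delta> \<oplus>\<^bsub>Diff K A \<Omega> E F\<^esub> \<Delta>' = (\<lambda>e\<in>carrier E. \<Delta> e \<oplus>\<^bsub>F\<^esub> \<Delta>' e)"
  "h \<odot>\<^bsub>Diff K A \<Omega> E F\<^esub> \<Delta> = compose (carrier E) h \<Delta>"
  by (simp_all add: Diff_def)

lemma abelian_group_Diff_n: "abelian_group (Diff_n K A \<Omega> E F n)"
  and Diff_n_uminus: "\<Delta> \<in> ops F n \<Longrightarrow> \<ominus>\<^bsub>Diff_n K A \<Omega> E F n\<^esub> \<Delta> = (\<lambda>e\<in>carrier E. \<ominus>\<^bsub>F\<^esub> \<Delta> e)"
  unfolding Diff_n_def
  by (rule abelian_group_map_module[OF F.M.abelian_group_axioms diffops_funcset diffops_zero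
        diffops_add diffops_uminus]; assumption)+

lemma abelian_group_Diff: "abelian_group (Diff K A \<Omega> E F)"
  and Diff_uminus: "\<Delta> \<in> ops F n \<Longrightarrow> \<ominus>\<^bsub>Diff K A \<Omega> E F\<^esub> \<Delta> = (\<lambda>e\<in>carrier E. \<ominus>\<^bsub>F\<^esub> \<Delta> e)"
proof -
  have add: "(\<lambda>e\<in>carrier E. \<Delta> e \<oplus>\<^bsub>F\<^esub> \<Delta>' e) \<in> (\<Union>n. ops F n)"
    if m: "\<Delta> \<in> (\<Union>n. ops F n)" "\<Delta>' \<in> (\<Union>n. ops F n)" for \<Delta> \<Delta>'
  proof -
    obtain m n where "\<Delta> \<in> ops F m" "\<Delta>' \<in> ops F n" using m by blast
    then have "\<Delta> \<in> ops F (max m n)" "\<Delta>' \<in> ops F (max m n)"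
      using diffops_mono[of m "max m n" F] diffops_mono[of n "max m n" F] by auto
    then show ?thesis using diffops_add by blast
  qed
  have sub: "(\<Union>n. ops F n) \<subseteq> carrier E \<rightarrow>\<^sub>E carrier F" using diffops_funcset by blast
  have zero: "(\<lambda>e\<in>carrier E. \<zero>\<^bsub>F\<^esub>) \<in> (\<Union>n. ops F n)" using diffops_zero by blast
  have neg: "(\<lambda>e\<in>carrier E. \<ominus>\<^bsub>F\<^esub> \<Delta> e) \<in> (\<Union>n. ops F n)" if "\<Delta> \<in> (\<Union>n. ops F n)" for \<Delta>
    using that diffops_uminus by blast
  note g = abelian_group_map_module[OF F.M.abelian_group_axioms sub zero add neg]
  show "abelian_group (Diff K A \<Omega> E F)" unfolding Diff_def by (rule g)
  show "\<Delta> \<in> ops F n \<Longrightarrow> \<ominus>\<^bsub>Diff K A \<Omega> E F\<^esub> \<Delta> = (\<lambda>e\<in>carrier E. \<ominus>\<^bsub>F\<^esub> \<Delta> e)"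
    unfolding Diff_def by (rule g(2)) auto
qed

lemma additive_subgroup_lower_diffops: "additive_subgroup (lower F n) (Diff_n K A \<Omega> E F n)"
proof (rule additive_subgroupI'[OF abelian_group_Diff_n])
  show "\<ominus>\<^bsub>Diff_n K A \<Omega> E F n\<^esub> \<Delta> \<in> lower F n" if "\<Delta> \<in> lower F n" for \<Delta>
    using that Diff_n_uminus[of \<Delta> n] lower_diffops_subset[of n] lower_diffops_closed(3) by auto
qed (use lower_diffops_subset lower_diffops_closed in auto)

lemma abelian_group_Symb_n: "abelian_group (Symb_n K A \<Omega> E F n)"
  unfolding Symb_n_def
  by (rule abelian_group_quot_module[OF abelian_group_Diff_n additive_subgroup_lower_diffops])

lemma symbol_additive: "additive_map (Diff_n K A \<Omega> E F n) (Symb_n K A \<Omega> E F n) (symbol K A \<Omega> E F n)"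
  unfolding Symb_n_def symbol_def
  by (rule coset_additive[OF abelian_group_Diff_n additive_subgroup_lower_diffops])

lemma symbol_closed: "\<Delta> \<in> ops F n \<Longrightarrow> symbol K A \<Omega> E F n \<Delta> \<in> carrier (Symb_n K A \<Omega> E F n)"
  using additive_map_closed[OF symbol_additive] by simp

lemma symbol_eq_zero_iff:
  "\<Delta> \<in> ops F n \<Longrightarrow> symbol K A \<Omega> E F n \<Delta> = \<zero>\<^bsub>Symb_n K A \<Omega> E F n\<^esub> \<longleftrightarrow> \<Delta> \<in> lower F n"
  using coset_eq_zero_iff[OF abelian_group_Diff_n additive_subgroup_lower_diffops, of \<Delta> n]
  by (simp add: Symb_n_def symbol_def)

text \<open>Truncations subtract in \<open>Diff\<close>, while the symbol of order \<open>n\<close>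
  is additive on \<open>Diff_n\<close>; this passes from one to the other.\<close>

lemma Diff_minus:
  assumes "\<Delta> \<in> ops F n" "\<Delta>' \<in> ops F n"
  shows "\<Delta> \<ominus>\<^bsub>Diff K A \<Omega> E F\<^esub> \<Delta>' \<in> ops F n" "\<Delta> \<ominus>\<^bsub>Diff K A \<Omega> E F\<^esub> \<Delta>' = \<Delta> \<ominus>\<^bsub>Diff_n K A \<Omega> E F n\<^esub> \<Delta>'"
  using assms diffops_add[OF assms(1) diffops_uminus[OF assms(2)]]
  by (simp_all add: a_minus_def Diff_uminus[of _ n] Diff_n_uminus)

end

section \<open>Postcomposition with linear maps\<close>

lemma lower_diffops_compose:
  assumes F: "left_module A F" and G: "left_module A G"
    and \<Delta>: "\<Delta> \<in> lower F n" and f: "linear_map A F G f"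
  shows "compose (carrier E) f \<Delta> \<in> lower G n"
proof (cases n)
  case 0
  have "f \<zero>\<^bsub>F\<^esub> = \<zero>\<^bsub>G\<^esub>"
    by (rule additive_map_zero[OF linear_map_additive[OF f] left_module_abelian_group[OF F]
          left_module_abelian_group[OF G]])
  then show ?thesis using 0 \<Delta> by (simp add: compose_def cong: restrict_cong)
next
  case (Suc m)
  then show ?thesis using \<Delta> diffops_compose[OF _ f] by simp
qed

context
  fixes F G :: "('a, 'f) module" and f
  assumes F: "left_module A F" and G: "left_module A G" and f: "linear_map A F G f"
begin

lemma compose_additive:
  "additive_map (Diff_n K A \<Omega> E F n) (Diff_n K A \<Omega> E G n) (\<lambda>\<Delta>. compose (carrier E) f \<Delta>)"
  "additive_map (Diff K A \<Omega> E F) (Diff K A \<Omega> E G) (\<lambda>\<Delta>. compose (carrier E) f \<Delta>)"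
proof -
  have add: "compose (carrier E) f (\<lambda>e\<in>carrier E. \<Delta> e \<oplus>\<^bsub>F\<^esub> \<Delta>' e) =
      (\<lambda>e\<in>carrier E. compose (carrier E) f \<Delta> e \<oplus>\<^bsub>G\<^esub> compose (carrier E) f \<Delta>' e)"
    if "\<Delta> \<in> ops F m" "\<Delta>' \<in> ops F n" for \<Delta> \<Delta>' m n
  proof -
    have "\<Delta> e \<in> carrier F" "\<Delta>' e \<in> carrier F" if "e \<in> carrier E" for e
      using PiE_mem[OF subsetD[OF diffops_funcset \<open>\<Delta> \<in> ops F m\<close>] that]
        PiE_mem[OF subsetD[OF diffops_funcset \<open>\<Delta>' \<in> ops F n\<close>] that] .
    then show ?thesis
      by (simp add: compose_def additive_map_add[OF linear_map_additive[OF f]] cong: restrict_cong)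
  qed
  show "additive_map (Diff_n K A \<Omega> E F n) (Diff_n K A \<Omega> E G n) (\<lambda>\<Delta>. compose (carrier E) f \<Delta>)"
  proof (rule additive_mapI)
    fix \<Delta> \<Delta>' assume "\<Delta> \<in> carrier (Diff_n K A \<Omega> E F n)" "\<Delta>' \<in> carrier (Diff_n K A \<Omega> E F n)"
    then show "compose (carrier E) f (\<Delta> \<oplus>\<^bsub>Diff_n K A \<Omega> E F n\<^esub> \<Delta>') =
        compose (carrier E) f \<Delta> \<oplus>\<^bsub>Diff_n K A \<Omega> E G n\<^esub> compose (carrier E) f \<Delta>'"
      unfolding Diff_n_sel[OF F] Diff_n_sel[OF G] by (rule add)
  qed (use diffops_compose[OF _ f] Diff_n_sel(1)[OF F] Diff_n_sel(1)[OF G] in blast)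
  show "additive_map (Diff K A \<Omega> E F) (Diff K A \<Omega> E G) (\<lambda>\<Delta>. compose (carrier E) f \<Delta>)"
  proof (rule additive_mapI)
    fix \<Delta> \<Delta>' assume "\<Delta> \<in> carrier (Diff K A \<Omega> E F)" "\<Delta>' \<in> carrier (Diff K A \<Omega> E F)"
    then show "compose (carrier E) f (\<Delta> \<oplus>\<^bsub>Diff K A \<Omega> E F\<^esub> \<Delta>') =
        compose (carrier E) f \<Delta> \<oplus>\<^bsub>Diff K A \<Omega> E G\<^esub> compose (carrier E) f \<Delta>'"
      unfolding Diff_sel[OF F] Diff_sel[OF G] using add by blast
  qed (use diffops_compose[OF _ f] Diff_sel(1)[OF F] Diff_sel(1)[OF G] in blast)
qed

text \<open>Postcomposition does not raise the order, so it preserves the subgroups divided out. For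
  \<open>G = F\<close> the map is the scalar multiplication by an endomorphism on symbols, and the
  lemma is used in that case too.\<close>

lemma Symb_n_map_additive:
  "additive_map (Symb_n K A \<Omega> E F n) (Symb_n K A \<Omega> E G n) (Symb_n_map K A \<Omega> E n F G f)"
proof -
  have "(\<lambda>\<Delta>. compose (carrier E) f \<Delta>) ` lower F n \<subseteq> lower G n"
    using lower_diffops_compose[OF F G _ f] by blast
  from quot_map_additive[OF abelian_group_Diff_n[OF F] additive_subgroup_lower_diffops[OF F]
      abelian_group_Diff_n[OF G] additive_subgroup_lower_diffops[OF G] compose_additive(1) this]
  show ?thesis
    unfolding Symb_n_def Symb_n_map_def .
qed

end

end

end

section \<open>Quantizations\<close>

lemma direct_sum_sel [simp]:
  "carrier (direct_sum M) = {s. (\<forall>n. s n \<in> carrier (M n)) \<and> finite {n. s n \<noteq> \<zero>\<^bsub>M n\<^esub>}}"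
  "\<zero>\<^bsub>direct_sum M\<^esub> = (\<lambda>n. \<zero>\<^bsub>M n\<^esub>)"
  "s \<oplus>\<^bsub>direct_sum M\<^esub> t = (\<lambda>n. s n \<oplus>\<^bsub>M n\<^esub> t n)"
  "a \<odot>\<^bsub>direct_sum M\<^esub> s = (\<lambda>n. a \<odot>\<^bsub>M n\<^esub> s n)"
  by (simp_all add: direct_sum_def)

lemma direct_sum_bound:
  assumes "s \<in> carrier (direct_sum M)"
  obtains N where "\<And>n. N \<le> n \<Longrightarrow> s n = \<zero>\<^bsub>M n\<^esub>"
proof -
  have "finite {n. s n \<noteq> \<zero>\<^bsub>M n\<^esub>}" using assms by simp
  then obtain N where "\<forall>n\<in>{n. s n \<noteq> \<zero>\<^bsub>M n\<^esub>}. n < N"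
    using finite_nat_set_iff_bounded by blast
  then show ?thesis using that by (metis (mono_tags, lifting) mem_Collect_eq not_le)
qed

lemma direct_sumI:
  assumes "\<And>n. s n \<in> carrier (M n)" "\<And>n. N \<le> n \<Longrightarrow> s n = \<zero>\<^bsub>M n\<^esub>"
  shows "s \<in> carrier (direct_sum M)"
proof -
  have "{n. s n \<noteq> \<zero>\<^bsub>M n\<^esub>} \<subseteq> {..<N}" using assms(2) by (auto simp: not_le[symmetric])
  then show ?thesis using assms(1) finite_subset by auto
qed

locale quantized_pair = exterior_algebra K A \<Omega>
  for K :: "'k ring" and A :: "('k, 'a) module" and \<Omega> :: "('k, 'a) calculus" +
  fixes E :: "('a, 'e) module" and F :: "('a, 'f) module"
    and q :: "nat \<Rightarrow> ('e \<Rightarrow> 'f) set \<Rightarrow> 'e \<Rightarrow> 'f"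
  assumes E: "left_module A E" and F: "left_module A F"
    and q: "full_quantization K A \<Omega> E F q"
begin

abbreviation "Dn \<equiv> Diff_n K A \<Omega> E F"
abbreviation "Sn \<equiv> Symb_n K A \<Omega> E F"
abbreviation "DD \<equiv> Diff K A \<Omega> E F"
abbreviation "SS \<equiv> Symb K A \<Omega> E F"
abbreviation "opn \<equiv> diffops K A \<Omega> E F"
abbreviation "low \<equiv> lower_diffops K A \<Omega> E F"
abbreviation "symb \<equiv> symbol K A \<Omega> E F"
abbreviation "quant \<equiv> quantization_map K A \<Omega> E F q"
abbreviation "tot \<equiv> total_symbol K A \<Omega> E F q"

lemmas Dn_sel = Diff_n_sel[OF E F] and DD_sel = Diff_sel[OF E F]

sublocale DD: abelian_group DD by (rule abelian_group_Diff[OF E F])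

lemma q_linear: "linear_map (endo_ring A F) (Sn n) (Dn n) (q n)"
  and symbol_q: "s \<in> carrier (Sn n) \<Longrightarrow> symb n (q n s) = s"
  using q unfolding full_quantization_def n_quantization_def by blast+

lemma q_closed: "s \<in> carrier (Sn n) \<Longrightarrow> q n s \<in> opn n"
  using linear_map_closed[OF q_linear] unfolding Dn_sel by blast

lemma q_zero: "q n \<zero>\<^bsub>Sn n\<^esub> = \<zero>\<^bsub>DD\<^esub>"
  using additive_map_zero[OF linear_map_additive[OF q_linear] abelian_group_Symb_n[OF E F] abelian_group_Diff_n[OF E F]]
  unfolding Dn_sel DD_sel .

lemma SS_bound:
  assumes "s \<in> carrier SS"
  obtains N where "\<And>n. N \<le> n \<Longrightarrow> s n = \<zero>\<^bsub>Sn n\<^esub>"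
  using assms unfolding Symb_def by (rule direct_sum_bound) blast

lemma SS_closed: "s \<in> carrier SS \<Longrightarrow> s n \<in> carrier (Sn n)"
  by (simp add: Symb_def)

lemma SS_add: "\<lbrakk>s \<in> carrier SS; t \<in> carrier SS\<rbrakk> \<Longrightarrow> s \<oplus>\<^bsub>SS\<^esub> t \<in> carrier SS"
  and SS_smult: "\<lbrakk>h \<in> carrier (endo_ring A F); s \<in> carrier SS\<rbrakk> \<Longrightarrow> h \<odot>\<^bsub>SS\<^esub> s \<in> carrier SS"
proof -
  have hom: "additive_map (Sn n) (Sn n) (\<lambda>x. h \<odot>\<^bsub>Sn n\<^esub> x)" if "h \<in> carrier (endo_ring A F)" for h n
    using that Symb_n_map_additive[OF E F F, of h n]
    by (simp add: endo_ring_def lin_hom_def Symb_n_map_def Symb_n_def Dn_sel)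
  show "s \<oplus>\<^bsub>SS\<^esub> t \<in> carrier SS" if s: "s \<in> carrier SS" and t: "t \<in> carrier SS"
  proof -
    obtain M N where "\<And>n. M \<le> n \<Longrightarrow> s n = \<zero>\<^bsub>Sn n\<^esub>" "\<And>n. N \<le> n \<Longrightarrow> t n = \<zero>\<^bsub>Sn n\<^esub>"
      using SS_bound[OF s] SS_bound[OF t] by metis
    then show ?thesis
      using SS_closed[OF s] SS_closed[OF t] abelian_group_Symb_n[OF E F]
      unfolding Symb_def by (intro direct_sumI[where N = "max M N"])
        (auto simp: abelian_monoid.a_closed abelian_group.axioms(1) abelian_monoid.l_zero abelian_monoid.zero_closed)
  qed
  show "h \<odot>\<^bsub>SS\<^esub> s \<in> carrier SS" if h: "h \<in> carrier (endo_ring A F)" and s: "s \<in> carrier SS"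
  proof -
    obtain N where "\<And>n. N \<le> n \<Longrightarrow> s n = \<zero>\<^bsub>Sn n\<^esub>" by (rule SS_bound[OF s]) blast
    moreover have "h \<odot>\<^bsub>Sn n\<^esub> \<zero>\<^bsub>Sn n\<^esub> = \<zero>\<^bsub>Sn n\<^esub>" for n
      by (rule additive_map_zero[OF hom[OF h] abelian_group_Symb_n[OF E F] abelian_group_Symb_n[OF E F]])
    ultimately show ?thesis
      using SS_closed[OF s] additive_map_closed[OF hom[OF h]]
      unfolding Symb_def by (intro direct_sumI[where N = N]) auto
  qed
qed

lemma q_family_closed: "s \<in> carrier SS \<Longrightarrow> (\<lambda>n. q n (s n)) \<in> B \<rightarrow> carrier DD"
  using q_closed SS_closed unfolding DD_sel by blast

text \<open>Since \<open>q n\<close> sends zero to zero, any bound on the support of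
  \<open>s\<close> bounds the support of the quantized family. Fixed ranges make sums for different
  \<open>s\<close> comparable and open the way to induction on \<open>N\<close>.\<close>

lemma quant_eq_finsum:
  assumes s: "s \<in> carrier SS" and N: "\<And>n. N \<le> n \<Longrightarrow> s n = \<zero>\<^bsub>Sn n\<^esub>"
  shows "quant s = (\<Oplus>\<^bsub>DD\<^esub>n\<in>{..<N}. q n (s n))"
  unfolding quantization_map_def
proof (rule DD.supp_sum_eq_finsum)
  show "{n. q n (s n) \<noteq> \<zero>\<^bsub>DD\<^esub>} \<subseteq> {..<N}"
    using N q_zero by (metis (mono_tags, lifting) lessThan_iff mem_Collect_eq not_le subsetI)
qed (use q_family_closed[OF s] in auto)

lemma quant_closed: "s \<in> carrier SS \<Longrightarrow> quant s \<in> carrier DD"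
proof -
  assume s: "s \<in> carrier SS"
  obtain N where N: "\<And>n. N \<le> n \<Longrightarrow> s n = \<zero>\<^bsub>Sn n\<^esub>" by (rule SS_bound[OF s]) blast
  show ?thesis
    using DD.finsum_closed[OF q_family_closed[OF s]] quant_eq_finsum[where N = N, OF s N] by simp
qed

lemma quant_linear: "linear_map (endo_ring A F) SS DD quant"
proof (rule linear_mapI[OF additive_mapI])
  show "quant s \<in> carrier DD" if "s \<in> carrier SS" for s by (rule quant_closed[OF that])
next
  fix s t assume s: "s \<in> carrier SS" and t: "t \<in> carrier SS"
  obtain M where M: "\<And>n. M \<le> n \<Longrightarrow> s n = \<zero>\<^bsub>Sn n\<^esub>" by (rule SS_bound[OF s]) blast
  obtain N where N: "\<And>n. N \<le> n \<Longrightarrow> t n = \<zero>\<^bsub>Sn n\<^esub>" by (rule SS_bound[OF t]) blast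
  obtain L where L: "\<And>n. L \<le> n \<Longrightarrow> (s \<oplus>\<^bsub>SS\<^esub> t) n = \<zero>\<^bsub>Sn n\<^esub>" by (rule SS_bound[OF SS_add[OF s t]]) blast
  let ?B = "max L (max M N)"
  have "q n ((s \<oplus>\<^bsub>SS\<^esub> t) n) = q n (s n) \<oplus>\<^bsub>DD\<^esub> q n (t n)" for n
    using additive_map_add[OF linear_map_additive[OF q_linear] SS_closed[OF s] SS_closed[OF t]]
    by (simp add: Symb_def Dn_sel DD_sel)
  then have "quant (s \<oplus>\<^bsub>SS\<^esub> t) = (\<Oplus>\<^bsub>DD\<^esub>n\<in>{..<?B}. q n (s n) \<oplus>\<^bsub>DD\<^esub> q n (t n))"
    using quant_eq_finsum[OF SS_add[OF s t], of ?B] L by simp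
  also have "\<dots> = quant s \<oplus>\<^bsub>DD\<^esub> quant t"
    using DD.finsum_addf[OF q_family_closed[OF s] q_family_closed[OF t]]
      quant_eq_finsum[OF s, of ?B] quant_eq_finsum[OF t, of ?B] M N by simp
  finally show "quant (s \<oplus>\<^bsub>SS\<^esub> t) = quant s \<oplus>\<^bsub>DD\<^esub> quant t" .
next
  fix h s assume h: "h \<in> carrier (endo_ring A F)" and s: "s \<in> carrier SS"
  have lin: "linear_map A F F h" using h by (simp add: endo_ring_def lin_hom_def)
  obtain N where N: "\<And>n. N \<le> n \<Longrightarrow> s n = \<zero>\<^bsub>Sn n\<^esub>" by (rule SS_bound[OF s]) blast
  obtain L where L: "\<And>n. L \<le> n \<Longrightarrow> (h \<odot>\<^bsub>SS\<^esub> s) n = \<zero>\<^bsub>Sn n\<^esub>" by (rule SS_bound[OF SS_smult[OF h s]]) blast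
  let ?B = "max L N"
  have "q n ((h \<odot>\<^bsub>SS\<^esub> s) n) = h \<odot>\<^bsub>DD\<^esub> q n (s n)" for n
    using linear_map_smult[OF q_linear h SS_closed[OF s]] by (simp add: Symb_def Dn_sel DD_sel)
  then have "quant (h \<odot>\<^bsub>SS\<^esub> s) = (\<Oplus>\<^bsub>DD\<^esub>n\<in>{..<?B}. h \<odot>\<^bsub>DD\<^esub> q n (s n))"
    using quant_eq_finsum[OF SS_smult[OF h s], of ?B] L by simp
  also have "\<dots> = h \<odot>\<^bsub>DD\<^esub> (\<Oplus>\<^bsub>DD\<^esub>n\<in>{..<?B}. q n (s n))"
    using additive_map_finsum[OF compose_additive(2)[OF E F F lin] DD.abelian_group_axioms DD.abelian_group_axioms _
        q_family_closed[OF s], of "{..<?B}"] by (simp add: DD_sel)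
  finally show "quant (h \<odot>\<^bsub>SS\<^esub> s) = h \<odot>\<^bsub>DD\<^esub> quant s"
    using quant_eq_finsum[OF s, of ?B] N by simp
qed

text \<open>The range is half open: the highest summand has index \<open>m - 1\<close>, hence order
  strictly below \<open>n\<close>. For \<open>m = 0\<close> the empty sum is the zero operator,
  which lies in every \<open>low n\<close>, including \<open>low 0\<close>.\<close>

lemma finsum_lower:
  assumes s: "s \<in> carrier SS" and "m \<le> n"
  shows "(\<Oplus>\<^bsub>DD\<^esub>k\<in>{..<m}. q k (s k)) \<in> low n"
  using assms(2)
proof (induction m)
  case 0
  show ?case using lower_diffops_closed(1)[OF E F] by (simp only: lessThan_0 DD.finsum_empty DD_sel)
next
  case (Suc m)
  have qm: "q m (s m) \<in> low n"
    using q_closed[OF SS_closed[OF s]] diffops_lower[OF E F, of m n] Suc.prems by auto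
  moreover have "(\<Oplus>\<^bsub>DD\<^esub>k\<in>{..<Suc m}. q k (s k)) = q m (s m) \<oplus>\<^bsub>DD\<^esub> (\<Oplus>\<^bsub>DD\<^esub>k\<in>{..<m}. q k (s k))"
    unfolding lessThan_Suc using q_family_closed[OF s] by (intro DD.finsum_insert) auto
  ultimately show ?case
    using lower_diffops_closed(2)[OF E F qm Suc.IH] Suc.prems by (simp only: DD_sel Suc_leD)
qed

text \<open>The support is peeled off from above: the sum of all but the top term has lower order,
  so the top term has too, and the top symbol is zero. Then \<open>N\<close> itself bounds the
  support and the shorter sum still vanishes.\<close>

lemma finsum_eq_zeroD:
  assumes s: "s \<in> carrier SS" and "\<And>n. N \<le> n \<Longrightarrow> s n = \<zero>\<^bsub>Sn n\<^esub>"
    and "(\<Oplus>\<^bsub>DD\<^esub>k\<in>{..<N}. q k (s k)) = \<zero>\<^bsub>DD\<^esub>"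
  shows "s n = \<zero>\<^bsub>Sn n\<^esub>"
  using assms(2,3)
proof (induction N)
  case (Suc N)
  let ?r = "\<Oplus>\<^bsub>DD\<^esub>k\<in>{..<N}. q k (s k)"
  have r: "?r \<in> low N" by (rule finsum_lower[OF s order_refl])
  then have rN: "?r \<in> opn N" using lower_diffops_subset[OF E F] by blast
  then have rD: "?r \<in> carrier DD" and qD: "q N (s N) \<in> carrier DD"
    using q_closed[OF SS_closed[OF s]] unfolding DD_sel by blast+
  have eq: "q N (s N) \<oplus>\<^bsub>DD\<^esub> ?r = \<zero>\<^bsub>DD\<^esub>"
    using Suc.prems(2) q_family_closed[OF s]
    unfolding lessThan_Suc by (subst (asm) DD.finsum_insert) auto
  have "q N (s N) = \<ominus>\<^bsub>DD\<^esub> ?r"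
    by (rule DD.minus_equality[OF eq rD qD, symmetric])
  then have "q N (s N) \<in> low N"
    using lower_diffops_closed(3)[OF E F r] Diff_uminus[OF E F rN] by simp
  then have z: "s N = \<zero>\<^bsub>Sn N\<^esub>"
    using symbol_eq_zero_iff[OF E F q_closed[OF SS_closed[OF s]], of N] symbol_q[OF SS_closed[OF s], of N]
    by simp
  show ?case
  proof (rule Suc.IH)
    show "s n = \<zero>\<^bsub>Sn n\<^esub>" if "N \<le> n" for n
      using Suc.prems(1) z that by (cases "n = N") auto
    show "?r = \<zero>\<^bsub>DD\<^esub>"
      using eq z q_zero rD by simp
  qed
qed simp

lemma quant_inject:
  assumes s: "s \<in> carrier SS" and t: "t \<in> carrier SS" and eq: "quant s = quant t"
  shows "s = t"
proof -
  let ?u = "\<lambda>n. s n \<ominus>\<^bsub>Sn n\<^esub> t n"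
  have sub: "s n \<ominus>\<^bsub>Sn n\<^esub> t n \<in> carrier (Sn n)" for n
    using SS_closed[OF s] SS_closed[OF t] abelian_group_Symb_n[OF E F] by (simp add: abelian_group.minus_closed)
  obtain M where M: "\<And>n. M \<le> n \<Longrightarrow> s n = \<zero>\<^bsub>Sn n\<^esub>" by (rule SS_bound[OF s]) blast
  obtain N where N: "\<And>n. N \<le> n \<Longrightarrow> t n = \<zero>\<^bsub>Sn n\<^esub>" by (rule SS_bound[OF t]) blast
  let ?B = "max M N"
  have z: "?u n = \<zero>\<^bsub>Sn n\<^esub>" if "?B \<le> n" for n
  proof -
    interpret S: abelian_group "Sn n" by (rule abelian_group_Symb_n[OF E F])
    show ?thesis using M N that by (simp add: S.minus_eq S.r_neg)
  qed
  have u: "?u \<in> carrier SS" unfolding Symb_def by (rule direct_sumI[where N = ?B, OF sub z])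
  \<comment> \<open>Expressing \<open>s\<close> as \<open>?u\<close> plus \<open>t\<close> reduces
    the claim to additivity of \<open>quant\<close>.\<close>
  have st: "s = ?u \<oplus>\<^bsub>SS\<^esub> t"
  proof
    fix n
    interpret S: abelian_group "Sn n" by (rule abelian_group_Symb_n[OF E F])
    show "s n = (?u \<oplus>\<^bsub>SS\<^esub> t) n"
      using SS_closed[OF s, of n] SS_closed[OF t, of n] by (simp add: Symb_def S.minus_eq S.a_assoc S.l_neg)
  qed
  then have "quant s = quant ?u \<oplus>\<^bsub>DD\<^esub> quant t"
    using additive_map_add[OF linear_map_additive[OF quant_linear] u t] by simp
  then have "quant ?u = \<zero>\<^bsub>DD\<^esub>"
    using quant_closed[OF u] quant_closed[OF t] eq by simp
  then have "?u n = \<zero>\<^bsub>Sn n\<^esub>" for n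
    using finsum_eq_zeroD[where N = ?B, OF u z, of n] quant_eq_finsum[where N = ?B, OF u z] by simp
  then have uz: "?u = (\<lambda>n. \<zero>\<^bsub>Sn n\<^esub>)" by blast
  have "(?u \<oplus>\<^bsub>SS\<^esub> t) n = t n" for n
  proof -
    interpret S: abelian_group "Sn n" by (rule abelian_group_Symb_n[OF E F])
    show ?thesis unfolding uz using SS_closed[OF t, of n] by (simp add: Symb_def)
  qed
  then show ?thesis using st by (metis ext)
qed

context
  fixes \<Delta> and n
  assumes \<Delta>: "\<Delta> \<in> opn n"
begin

abbreviation "tr \<equiv> truncation_from K A \<Omega> E F q n \<Delta>"

lemma truncation_from_top: "n \<le> k \<Longrightarrow> tr k = \<Delta>"
  by (simp add: truncation_from.simps[of K A \<Omega> E F q n \<Delta> k])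

lemma truncation_from_step: "k < n \<Longrightarrow> tr k = tr (Suc k) \<ominus>\<^bsub>DD\<^esub> q (Suc k) (symb (Suc k) (tr (Suc k)))"
  by (simp add: truncation_from.simps[of K A \<Omega> E F q n \<Delta> k] Let_def)

text \<open>Both terms have the same symbol of order \<open>k\<close>, because \<open>q k\<close>
  splits the symbol map; so the symbol of the difference is zero.\<close>

lemma diff_quantized_symbol:
  assumes "\<Theta> \<in> opn k"
  shows "\<Theta> \<ominus>\<^bsub>DD\<^esub> q k (symb k \<Theta>) \<in> low k"
proof -
  interpret S: abelian_group "Sn k" by (rule abelian_group_Symb_n[OF E F])
  have s: "symb k \<Theta> \<in> carrier (Sn k)" by (rule symbol_closed[OF E F assms])
  note qs = q_closed[OF s]
  have "symb k (\<Theta> \<ominus>\<^bsub>Dn k\<^esub> q k (symb k \<Theta>)) = symb k \<Theta> \<ominus>\<^bsub>Sn k\<^esub> symb k (q k (symb k \<Theta>))"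
    by (rule additive_map_minus[OF symbol_additive[OF E F] abelian_group_Diff_n[OF E F] S.abelian_group_axioms])
      (use assms qs in \<open>simp_all add: Dn_sel\<close>)
  also have "\<dots> = \<zero>\<^bsub>Sn k\<^esub>"
    using s by (simp add: symbol_q[OF s] S.minus_eq S.r_neg)
  finally show ?thesis
    using symbol_eq_zero_iff[OF E F] Diff_minus[OF E F assms qs] by metis
qed

text \<open>Above \<open>n\<close> this is monotonicity of the filtration; below \<open>n\<close>
  the truncations descend from \<open>\<Delta>\<close>, so the induction runs downwards.\<close>

lemma truncation_from_closed: "tr k \<in> opn k"
proof (cases "n \<le> k")
  case True
  then show ?thesis
    using truncation_from_top \<Delta> diffops_mono[OF E True] by auto
next
  case False
  then have "k \<le> n" by simp
  then show ?thesis
  proof (induction k rule: inc_induct)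
    case base
    show ?case using truncation_from_top \<Delta> by simp
  next
    case (step k)
    \<comment> \<open>By definition \<open>low (Suc k)\<close> is the set of operators of order
      \<open>k\<close>, which is the claim one step down.\<close>
    show ?case
      using truncation_from_step[OF step(2)] diff_quantized_symbol[OF step(3)] by simp
  qed
qed

text \<open>The recursion read upwards: each truncation is the preceding one plus the quantization
  of its own symbol. The formula holds also beyond \<open>n\<close>, where the additional terms are
  zero.\<close>

lemma truncation_from_sum: "tr k = (\<Oplus>\<^bsub>DD\<^esub>j\<in>{..<Suc k}. q j (symb j (tr j)))"
proof (induction k)
  have qD: "q j (symb j (tr j)) \<in> carrier DD" for j
    using q_closed[OF symbol_closed[OF E F truncation_from_closed]] unfolding DD_sel by blast
  have trD: "tr j \<in> carrier DD" for j
    using truncation_from_closed unfolding DD_sel by blast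
  {
    case 0
    \<comment> \<open>The lower operators at order 0 consist of zero alone, so the truncation of
      order 0 equals the quantization of its symbol.\<close>
    have "tr 0 \<ominus>\<^bsub>DD\<^esub> q 0 (symb 0 (tr 0)) = \<zero>\<^bsub>DD\<^esub>"
      using diff_quantized_symbol[OF truncation_from_closed[of 0]] by (simp add: DD_sel)
    then have "tr 0 = q 0 (symb 0 (tr 0))"
      using qD[of 0] trD[of 0] by (metis DD.minus_eq DD.minus_equality DD.minus_minus DD.a_inv_closed)
    then show ?case
      using DD.finsum_insert[of "{}" 0 "\<lambda>j. q j (symb j (tr j))"] qD[of 0] by (simp add: lessThan_Suc)
  next
    case (Suc k)
    have step: "tr (Suc k) = q (Suc k) (symb (Suc k) (tr (Suc k))) \<oplus>\<^bsub>DD\<^esub> tr k"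
    proof (cases "k < n")
      case True
      then show ?thesis
        using truncation_from_step[OF True] qD[of "Suc k"] trD[of "Suc k"]
        by (simp add: DD.minus_eq DD.a_lcomm DD.r_neg)
    next
      case False
      \<comment> \<open>Past the bound the truncations are constant, and \<open>\<Delta>\<close> has
        order below \<open>Suc k\<close>; its symbol there vanishes and contributes
        \<open>q 0 = 0\<close>.\<close>
      then have eq: "tr (Suc k) = \<Delta>" "tr k = \<Delta>" using truncation_from_top by auto
      have "\<Delta> \<in> low (Suc k)" using \<Delta> False diffops_lower[OF E F, of n "Suc k"] by auto
      moreover have "\<Delta> \<in> opn (Suc k)" using truncation_from_closed[of "Suc k"] eq by simp
      ultimately have "symb (Suc k) \<Delta> = \<zero>\<^bsub>Sn (Suc k)\<^esub>"
        using symbol_eq_zero_iff[OF E F] by blast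
      then show ?thesis using eq q_zero[of "Suc k"] trD[of k] by simp
    qed
    have "(\<Oplus>\<^bsub>DD\<^esub>j\<in>{..<Suc (Suc k)}. q j (symb j (tr j))) =
        q (Suc k) (symb (Suc k) (tr (Suc k))) \<oplus>\<^bsub>DD\<^esub> (\<Oplus>\<^bsub>DD\<^esub>j\<in>{..<Suc k}. q j (symb j (tr j)))"
      unfolding lessThan_Suc[of "Suc k"] using qD by (intro DD.finsum_insert) auto
    also have "\<dots> = tr (Suc k)"
      by (rule trans[OF step arg_cong[OF Suc.IH, of "\<lambda>x. q (Suc k) (symb (Suc k) (tr (Suc k))) \<oplus>\<^bsub>DD\<^esub> x"], symmetric])
    finally show ?case by (rule sym)
  }
qed

end

lemma
  assumes \<Delta>: "\<Delta> \<in> carrier DD"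
  shows total_symbol_closed: "tot \<Delta> \<in> carrier SS"
    and quant_total_symbol: "quant (tot \<Delta>) = \<Delta>"
proof -
  define n where "n = (LEAST n. \<Delta> \<in> opn n)"
  have "\<exists>n. \<Delta> \<in> opn n" using \<Delta> unfolding DD_sel by blast
  then have n: "\<Delta> \<in> opn n" unfolding n_def by (rule LeastI_ex)
  have tot: "tot \<Delta> = (\<lambda>k. symb k (truncation_from K A \<Omega> E F q n \<Delta> k))"
    by (simp add: total_symbol_def truncation_def n_def fun_eq_iff)
  \<comment> \<open>Above the order \<open>n\<close> the truncation is \<open>\<Delta>\<close>
    itself, an operator of order less than \<open>k\<close>; this gives finite support.\<close>
  have z: "tot \<Delta> k = \<zero>\<^bsub>Sn k\<^esub>" if "Suc n \<le> k" for k
    using that n symbol_eq_zero_iff[OF E F, of \<Delta> k] diffops_lower[OF E F, of n k] diffops_mono[OF E, of n k F]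
    by (auto simp: tot truncation_from_top[OF n])
  show c: "tot \<Delta> \<in> carrier SS"
    unfolding Symb_def
    by (rule direct_sumI[where N = "Suc n", OF _ z]) (simp add: tot symbol_closed[OF E F truncation_from_closed[OF n]])
  show "quant (tot \<Delta>) = \<Delta>"
    \<comment> \<open>The summation formula is taken at \<open>k = n\<close>, where the truncation
      is \<open>\<Delta>\<close> and the range \<open>{..<Suc n}\<close> contains the whole
      support.\<close>
    using quant_eq_finsum[where N = "Suc n", OF c z] truncation_from_sum[OF n, of n] truncation_from_top[OF n, of n]
    by (simp add: tot)
qed

text \<open>Quantizing both sides gives \<open>quant s\<close>, since \<open>tot\<close> is a right
  inverse of \<open>quant\<close>; injectivity of \<open>quant\<close> does the rest.\<close>

lemma total_symbol_quant: "s \<in> carrier SS \<Longrightarrow> tot (quant s) = s"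
  by (rule quant_inject[OF total_symbol_closed[OF quant_closed] _ quant_total_symbol[OF quant_closed]])

lemma linear_isomorphism_total_symbol:
  "linear_isomorphism (endo_ring A F) DD SS tot quant"
  unfolding linear_isomorphism_def
proof (intro conjI ballI)
  show "linear_map (endo_ring A F) DD SS tot"
    by (rule linear_map_inverse[OF quant_linear])
      (rule SS_add SS_smult total_symbol_closed quant_total_symbol total_symbol_quant; assumption)+
qed (simp_all add: quant_linear quant_total_symbol total_symbol_quant)

text \<open>Finiteness is stated together with the formula because a sum over an infinite index set
  would be a mere default value. It is inherited from the total symbol, as \<open>q k\<close> sends
  zero to zero.\<close>

lemma quantized_components:
  assumes \<Delta>: "\<Delta> \<in> carrier DD"
  shows "finite {k. quantized_component K A \<Omega> E F q \<Delta> k \<noteq> \<zero>\<^bsub>DD\<^esub>}"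
    and "\<Delta> = supp_sum DD (quantized_component K A \<Omega> E F q \<Delta>)"
proof -
  have eq: "quantized_component K A \<Omega> E F q \<Delta> = (\<lambda>k. q k (tot \<Delta> k))"
    by (simp add: quantized_component_def fun_eq_iff)
  have "finite {k. tot \<Delta> k \<noteq> \<zero>\<^bsub>Sn k\<^esub>}"
    using total_symbol_closed[OF \<Delta>] by (simp add: Symb_def)
  then show "finite {k. quantized_component K A \<Omega> E F q \<Delta> k \<noteq> \<zero>\<^bsub>DD\<^esub>}"
    unfolding eq by (rule rev_finite_subset) (use q_zero in auto)
  show "\<Delta> = supp_sum DD (quantized_component K A \<Omega> E F q \<Delta>)"
    using quant_total_symbol[OF \<Delta>] by (simp add: eq quantization_map_def)
qed

end

lemma natural_transformation_linear:
  "\<lbrakk>natural_transformation K A S S_map T T_map \<eta>; left_module A F\<rbrakk> \<Longrightarrow> linear_map K (S F) (T F) (\<eta> F)"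
  by (simp add: natural_transformation_def)

lemma natural_transformation_natural:
  "\<lbrakk>natural_transformation K A S S_map T T_map \<eta>; left_module A F; left_module A G; f \<in> lin_hom A F G;
    x \<in> carrier (S F)\<rbrakk> \<Longrightarrow> \<eta> G (S_map F G f x) = T_map F G f (\<eta> F x)"
  by (simp add: natural_transformation_def)

lemma natural_full_quantizationD:
  assumes "natural_full_quantization K A \<Omega> E q"
  shows "natural_transformation K A
       (\<lambda>F. restrict_scalars (homothety A F) (Symb_n K A \<Omega> E F n)) (Symb_n_map K A \<Omega> E n)
       (\<lambda>F. restrict_scalars (homothety A F) (Diff_n K A \<Omega> E F n)) (Diff_map E) (q n)"
    and "left_module A F \<Longrightarrow> \<forall>s\<in>carrier (Symb_n K A \<Omega> E F n). symbol K A \<Omega> E F n (q n F s) = s"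
proof -
  have "natural_n_quantization K A \<Omega> E n (q n)"
    using assms unfolding natural_full_quantization_def by (rule spec)
  note n = this[unfolded natural_n_quantization_def]
  show "natural_transformation K A
       (\<lambda>F. restrict_scalars (homothety A F) (Symb_n K A \<Omega> E F n)) (Symb_n_map K A \<Omega> E n)
       (\<lambda>F. restrict_scalars (homothety A F) (Diff_n K A \<Omega> E F n)) (Diff_map E) (q n)"
    by (rule n[THEN conjunct1])
  show "left_module A F \<Longrightarrow> \<forall>s\<in>carrier (Symb_n K A \<Omega> E F n). symbol K A \<Omega> E F n (q n F s) = s"
    by (rule n[THEN conjunct2, THEN spec, THEN mp])
qed

context exterior_algebra
begin

lemma homothety_endo:
  assumes F: "left_module A F" and c: "c \<in> carrier K"
  shows "homothety A F c \<in> carrier (endo_ring A F)"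
proof -
  interpret left_module A F by (rule F)
  have "(c \<odot>\<^bsub>A\<^esub> \<one>\<^bsub>A\<^esub>) \<otimes>\<^bsub>A\<^esub> a = a \<otimes>\<^bsub>A\<^esub> (c \<odot>\<^bsub>A\<^esub> \<one>\<^bsub>A\<^esub>)" if "a \<in> carrier A" for a
    using A.smult_mult_l[OF c A.one_closed that] A.smult_mult_r[OF c that A.one_closed] that by simp
  then have "(c \<odot>\<^bsub>A\<^esub> \<one>\<^bsub>A\<^esub>) \<odot>\<^bsub>F\<^esub> (a \<odot>\<^bsub>F\<^esub> x) = a \<odot>\<^bsub>F\<^esub> ((c \<odot>\<^bsub>A\<^esub> \<one>\<^bsub>A\<^esub>) \<odot>\<^bsub>F\<^esub> x)"
    if "a \<in> carrier A" "x \<in> carrier F" for a x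
    using smult_assoc[OF scalar_one_closed[OF c] that] smult_assoc[OF that(1) scalar_one_closed[OF c] that(2)]
      that(1) by simp
  then have "linear_map A F F (\<lambda>x. (c \<odot>\<^bsub>A\<^esub> \<one>\<^bsub>A\<^esub>) \<odot>\<^bsub>F\<^esub> x)"
    using left_module_smult_additive[OF F scalar_one_closed[OF c]] by (intro linear_mapI)
  then show ?thesis
    unfolding endo_ring_def lin_hom_def homothety_def linear_map_def
    by (simp add: Pi_iff smult_closed)
qed

text \<open>A natural transformation is assumed linear over \<open>K\<close> only. An endomorphism
  \<open>h\<close> of \<open>F\<close> is also an arrow from \<open>F\<close> to \<open>F\<close>,
  and it acts on operators and on symbols exactly as the functors do on that arrow; so the
  naturality square for \<open>h\<close> is linearity over the endomorphism ring.\<close>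

lemma natural_full_quantization_full:
  fixes q :: "nat \<Rightarrow> ('a, 'f) module \<Rightarrow> ('e \<Rightarrow> 'f) set \<Rightarrow> 'e \<Rightarrow> 'f"
  assumes E: "left_module A E" and q: "natural_full_quantization K A \<Omega> E q" and F: "left_module A F"
  shows "full_quantization K A \<Omega> E F (\<lambda>n. q n F)"
  unfolding full_quantization_def n_quantization_def
proof (intro allI conjI)
  fix n
  have nat: "natural_transformation K A
       (\<lambda>F. restrict_scalars (homothety A F) (Symb_n K A \<Omega> E F n)) (Symb_n_map K A \<Omega> E n)
       (\<lambda>F. restrict_scalars (homothety A F) (Diff_n K A \<Omega> E F n)) (Diff_map E) (q n)"
    by (rule natural_full_quantizationD(1)[OF q])
  show "\<forall>s\<in>carrier (Symb_n K A \<Omega> E F n). symbol K A \<Omega> E F n (q n F s) = s"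
    by (rule natural_full_quantizationD(2)[OF q F])
  have lin: "linear_map K (restrict_scalars (homothety A F) (Symb_n K A \<Omega> E F n))
      (restrict_scalars (homothety A F) (Diff_n K A \<Omega> E F n)) (q n F)"
    by (rule natural_transformation_linear[OF nat F])
  show "linear_map (endo_ring A F) (Symb_n K A \<Omega> E F n) (Diff_n K A \<Omega> E F n) (q n F)"
  proof (rule linear_mapI)
    show "additive_map (Symb_n K A \<Omega> E F n) (Diff_n K A \<Omega> E F n) (q n F)"
      using linear_map_additive[OF lin] by (simp add: additive_map_def)
    fix h s assume "h \<in> carrier (endo_ring A F)" and s: "s \<in> carrier (Symb_n K A \<Omega> E F n)"
    then have h: "h \<in> lin_hom A F F" by (simp add: endo_ring_def)
    have "q n F (Symb_n_map K A \<Omega> E n F F h s) = Diff_map E F F h (q n F s)"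
      using natural_transformation_natural[OF nat F F h] s by simp
    then show "q n F (h \<odot>\<^bsub>Symb_n K A \<Omega> E F n\<^esub> s) = h \<odot>\<^bsub>Diff_n K A \<Omega> E F n\<^esub> q n F s"
      by (simp add: Symb_n_map_def Diff_map_def Symb_n_def Diff_n_sel[OF E F])
  qed
qed

text \<open>Over each \<open>F\<close> the isomorphism is the earlier one with scalars restricted
  along homotheties. Naturality is proved for the quantization map, termwise on a finite sum, and
  transferred to its inverse.\<close>

lemma natural_isomorphism_total_symbol:
  fixes q :: "nat \<Rightarrow> ('a, 'f) module \<Rightarrow> ('e \<Rightarrow> 'f) set \<Rightarrow> 'e \<Rightarrow> 'f"
  assumes E: "left_module A E" and q: "natural_full_quantization K A \<Omega> E q"
  shows "natural_isomorphism K A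
      (\<lambda>F. restrict_scalars (homothety A F) (Diff K A \<Omega> E F)) (Diff_map E)
      (\<lambda>F. restrict_scalars (homothety A F) (Symb K A \<Omega> E F)) (Symb_map K A \<Omega> E)
      (\<lambda>F. total_symbol K A \<Omega> E F (\<lambda>n. q n F))
      (\<lambda>F. quantization_map K A \<Omega> E F (\<lambda>n. q n F))"
proof -
  have pair: "quantized_pair K A \<Omega> E F (\<lambda>n. q n F)" if "left_module A F" for F
    by (rule quantized_pair.intro[OF exterior_algebra_axioms
          quantized_pair_axioms.intro[OF E that natural_full_quantization_full[OF E q that]]])
  have iso: "linear_isomorphism K (restrict_scalars (homothety A F) (Diff K A \<Omega> E F))
      (restrict_scalars (homothety A F) (Symb K A \<Omega> E F))
      (total_symbol K A \<Omega> E F (\<lambda>n. q n F)) (quantization_map K A \<Omega> E F (\<lambda>n. q n F))"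
    if "left_module A F" for F
    using quantized_pair.linear_isomorphism_total_symbol[OF pair[OF that]] homothety_endo[OF that]
    unfolding linear_isomorphism_def by (auto intro: linear_map_restrict_scalars)
  \<comment> \<open>Membership of the transported family in the direct sum is included, since
    cancelling \<open>tot\<close> against \<open>quant\<close> at \<open>G\<close> depends on
    it.\<close>
  have nat: "Symb_map K A \<Omega> E F G f s \<in> carrier (Symb K A \<Omega> E G) \<and>
      quantization_map K A \<Omega> E G (\<lambda>n. q n G) (Symb_map K A \<Omega> E F G f s) =
        Diff_map E F G f (quantization_map K A \<Omega> E F (\<lambda>n. q n F) s)"
    if F: "left_module A F" and G: "left_module A G" and f: "f \<in> lin_hom A F G"
      and s: "s \<in> carrier (Symb K A \<Omega> E F)" for F G f s
  proof -
    interpret F: quantized_pair K A \<Omega> E F "\<lambda>n. q n F" by (rule pair[OF F])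
    interpret G: quantized_pair K A \<Omega> E G "\<lambda>n. q n G" by (rule pair[OF G])
    have lin: "linear_map A F G f" using f by (simp add: lin_hom_def)
    note sm = Symb_n_map_additive[OF E F G lin]
    obtain N where N: "\<And>n. N \<le> n \<Longrightarrow> s n = \<zero>\<^bsub>F.Sn n\<^esub>" by (rule F.SS_bound[OF s]) blast
    have z: "Symb_map K A \<Omega> E F G f s n = \<zero>\<^bsub>G.Sn n\<^esub>" if "N \<le> n" for n
      using additive_map_zero[OF sm abelian_group_Symb_n[OF E F] abelian_group_Symb_n[OF E G]] N[OF that]
      by (simp add: Symb_map_def)
    have c: "Symb_map K A \<Omega> E F G f s \<in> carrier G.SS"
      unfolding Symb_def
      by (rule direct_sumI[where N = N, OF _ z]) (simp add: Symb_map_def additive_map_closed[OF sm F.SS_closed[OF s]])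
    have qn: "q n G (Symb_map K A \<Omega> E F G f s n) = compose (carrier E) f (q n F (s n))" for n
    proof -
      have "natural_transformation K A
         (\<lambda>F. restrict_scalars (homothety A F) (Symb_n K A \<Omega> E F n)) (Symb_n_map K A \<Omega> E n)
         (\<lambda>F. restrict_scalars (homothety A F) (Diff_n K A \<Omega> E F n)) (Diff_map E) (q n)"
        by (rule natural_full_quantizationD[OF q])
      from natural_transformation_natural[OF this F G f] show ?thesis
        using F.SS_closed[OF s, of n] by (simp add: Symb_map_def Diff_map_def)
    qed
    have "G.quant (Symb_map K A \<Omega> E F G f s) = (\<Oplus>\<^bsub>G.DD\<^esub>n\<in>{..<N}. compose (carrier E) f (q n F (s n)))"
      using G.quant_eq_finsum[where N = N, OF c z] qn by simp
    also have "\<dots> = compose (carrier E) f (\<Oplus>\<^bsub>F.DD\<^esub>n\<in>{..<N}. q n F (s n))"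
      using additive_map_finsum[OF compose_additive(2)[OF E F G lin] F.DD.abelian_group_axioms
          G.DD.abelian_group_axioms _ F.q_family_closed[OF s], of "{..<N}"] by simp
    also have "\<dots> = Diff_map E F G f (F.quant s)"
      using F.quant_eq_finsum[where N = N, OF s N] by (simp add: Diff_map_def)
    finally show ?thesis using c by blast
  qed
  show ?thesis
    unfolding natural_isomorphism_def
  proof (intro conjI allI impI)
    show "natural_transformation K A
        (\<lambda>F. restrict_scalars (homothety A F) (Symb K A \<Omega> E F)) (Symb_map K A \<Omega> E)
        (\<lambda>F. restrict_scalars (homothety A F) (Diff K A \<Omega> E F)) (Diff_map E)
        (\<lambda>F. quantization_map K A \<Omega> E F (\<lambda>n. q n F))"
      unfolding natural_transformation_def
      using iso nat by (simp add: linear_isomorphism_def)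
    show "natural_transformation K A
        (\<lambda>F. restrict_scalars (homothety A F) (Diff K A \<Omega> E F)) (Diff_map E)
        (\<lambda>F. restrict_scalars (homothety A F) (Symb K A \<Omega> E F)) (Symb_map K A \<Omega> E)
        (\<lambda>F. total_symbol K A \<Omega> E F (\<lambda>n. q n F))"
      unfolding natural_transformation_def
    proof (intro conjI allI impI ballI)
      fix F G :: "('a, 'f) module" and f \<Delta>
      assume F: "left_module A F" and G: "left_module A G" and f: "f \<in> lin_hom A F G"
        and "\<Delta> \<in> carrier (restrict_scalars (homothety A F) (Diff K A \<Omega> E F))"
      then have \<Delta>: "\<Delta> \<in> carrier (Diff K A \<Omega> E F)" by simp
      interpret F: quantized_pair K A \<Omega> E F "\<lambda>n. q n F" by (rule pair[OF F])
      interpret G: quantized_pair K A \<Omega> E G "\<lambda>n. q n G" by (rule pair[OF G])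
      \<comment> \<open>Writing \<open>\<Delta>\<close> as the quantization of its total symbol
        turns naturality of \<open>quant\<close> into that of \<open>tot\<close>: applying
        \<open>tot\<close> at \<open>G\<close> cancels \<open>quant\<close>.\<close>
      have eq: "Diff_map E F G f \<Delta> = G.quant (Symb_map K A \<Omega> E F G f (F.tot \<Delta>))"
        using nat[OF F G f F.total_symbol_closed[OF \<Delta>]] F.quant_total_symbol[OF \<Delta>] by simp
      show "G.tot (Diff_map E F G f \<Delta>) = Symb_map K A \<Omega> E F G f (F.tot \<Delta>)"
        unfolding eq
        by (rule G.total_symbol_quant[OF conjunct1[OF nat[OF F G f F.total_symbol_closed[OF \<Delta>]]]])
    qed (use iso in \<open>simp add: linear_isomorphism_def\<close>)
  qed (rule iso)
qed

end

theorem proposition5p24: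
  fixes K :: "'k ring" and A :: "('k, 'a) module" and \<Omega> :: "('k, 'a) calculus"
    and E :: "('a, 'e) module"
  assumes "exterior_algebra K A \<Omega>" and "left_module A E"
  shows
    "(\<forall>(F :: ('a, 'f) module) q.
        left_module A F \<longrightarrow> full_quantization K A \<Omega> E F q \<longrightarrow>
          linear_isomorphism (endo_ring A F) (Diff K A \<Omega> E F) (Symb K A \<Omega> E F)
            (total_symbol K A \<Omega> E F q) (quantization_map K A \<Omega> E F q) \<and>
          (\<forall>\<Delta>\<in>carrier (Diff K A \<Omega> E F).
             finite {k. quantized_component K A \<Omega> E F q \<Delta> k \<noteq> \<zero>\<^bsub>Diff K A \<Omega> E F\<^esub>} \<and>
             \<Delta> = supp_sum (Diff K A \<Omega> E F) (quantized_component K A \<Omega> E F q \<Delta>))) \<and>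
     (\<forall>q :: nat \<Rightarrow> ('a, 'f) module \<Rightarrow> ('e \<Rightarrow> 'f) set \<Rightarrow> 'e \<Rightarrow> 'f.
        natural_full_quantization K A \<Omega> E q \<longrightarrow>
          natural_isomorphism K A
            (\<lambda>F. restrict_scalars (homothety A F) (Diff K A \<Omega> E F)) (Diff_map E)
            (\<lambda>F. restrict_scalars (homothety A F) (Symb K A \<Omega> E F)) (Symb_map K A \<Omega> E)
            (\<lambda>F. total_symbol K A \<Omega> E F (\<lambda>n. q n F))
            (\<lambda>F. quantization_map K A \<Omega> E F (\<lambda>n. q n F)))"
proof (intro conjI allI impI ballI)
  fix F :: "('a, 'f) module" and q
  assume "left_module A F" "full_quantization K A \<Omega> E F q"
  then have q: "quantized_pair K A \<Omega> E F q"
    by (rule quantized_pair.intro[OF assms(1) quantized_pair_axioms.intro[OF assms(2)]])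
  show "linear_isomorphism (endo_ring A F) (Diff K A \<Omega> E F) (Symb K A \<Omega> E F)
      (total_symbol K A \<Omega> E F q) (quantization_map K A \<Omega> E F q)"
    by (rule quantized_pair.linear_isomorphism_total_symbol[OF q])
  fix \<Delta> assume \<Delta>: "\<Delta> \<in> carrier (Diff K A \<Omega> E F)"
  show "finite {k. quantized_component K A \<Omega> E F q \<Delta> k \<noteq> \<zero>\<^bsub>Diff K A \<Omega> E F\<^esub>}"
    by (rule quantized_pair.quantized_components(1)[OF q \<Delta>])
  show "\<Delta> = supp_sum (Diff K A \<Omega> E F) (quantized_component K A \<Omega> E F q \<Delta>)"
    by (rule quantized_pair.quantized_components(2)[OF q \<Delta>])
next
  fix q :: "nat \<Rightarrow> ('a, 'f) module \<Rightarrow> ('e \<Rightarrow> 'f) set \<Rightarrow> 'e \<Rightarrow> 'f"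
  assume "natural_full_quantization K A \<Omega> E q"
  then show "natural_isomorphism K A
      (\<lambda>F. restrict_scalars (homothety A F) (Diff K A \<Omega> E F)) (Diff_map E)
      (\<lambda>F. restrict_scalars (homothety A F) (Symb K A \<Omega> E F)) (Symb_map K A \<Omega> E)
      (\<lambda>F. total_symbol K A \<Omega> E F (\<lambda>n. q n F))
      (\<lambda>F. quantization_map K A \<Omega> E F (\<lambda>n. q n F))"
    by (rule exterior_algebra.natural_isomorphism_total_symbol[OF assms])
qed

end
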